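(* Let $u$ be the weak solution of the parabolic integro-differential problem described in the context and let $\{U^n_h\}_{n=0}^N$ be the fine-grid solution produced by Algorithm 4.1 (described in the context). Then, for sufficiently small $\Delta t$, for all $n\ge1$ (with $t_n\le T$), $$\|U^n_h-u(t_n)\|_1\le C\,(H^r+h^{r-1}+\Delta t),$$ where $C>0$ is a constant independent of $h$, $H$, $\Delta t$ and $n$.
   Context: Setting. $\Omega\subset\mathbb R^d$ ($d\ge1$) is a bounded polyhedral domain with piecewise smooth boundary, $T>0$, $\mathcal H^1_0=\mathcal H^1_0(\Omega)$; $(\cdot,\cdot)$ and $\|\cdot\|$ are the $L^2(\Omega)$ inner product and norm, $\|\cdot\|_r$ the $\mathcal H^r(\Omega)$ norm. The problem is $u_t+Au+\int_0^tK(t-s)Bu(s)\,ds=f$ in $\Omega\times(0,T]$, $u=0$ on $\partial\Omega\times(0,T]$, $u(\cdot,0)=u_0$, with $K$ a (smooth or nonsmooth) memory kernel, $f$ known, $A$ a symmetric positive definite second-order elliptic operator with coefficients smooth in $x$ and $t$, and $Bu=-\nabla\cdot(\alpha(u)\nabla u+\beta(u))+\gamma(u)\cdot\nabla u+g(u)$, where $\alpha(x,u)\in\mathbb R^{d\times d}$, $\beta(x,u),\gamma(x,u)\in\mathbb R^d$, $g(x,u)\in\mathbb R$ (dependence on $x$ suppressed) are smooth and bounded together with their derivatives, and $\beta(0)=0$, $g(0)=0$. $A(\cdot,\cdot)$ is the bilinear form of $A$ on $\mathcal H^1_0\times \mathcal H^1_0$ (possible $t$-dependence suppressed), with $A(v,v)\ge\nu_0\|v\|_1^2$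 and $|A(u,v)|\le\nu_1\|u\|_1\|v\|_1$. Set $\tilde B(w;u,v)=(\alpha(w)\nabla u+\beta(w),\nabla v)+(\gamma(w)\cdot\nabla u+g(w),v)$ and $B(u,v)=\tilde B(u;u,v)$. The weak solution $u$ satisfies $(u_t,v)+A(u,v)+\int_0^tK(t-s)B(u(s),v)\,ds=(f,v)$ for all $v\in \mathcal H^1_0$, $u(0)=u_0$. Spaces. $\{S_h\}_{0<h\le1}$ are finite-dimensional subspaces of $\mathcal H^1_0$ with $\inf_{\chi\in S_h}\{\|v-\chi\|+h\|v-\chi\|_1\}\le C h^r\|v\|_r$ for $v\in \mathcal H^r\cap \mathcal H^1_0$ ($r\ge1+\frac d2$), and $\|\nabla\chi\|_\infty\le Ch^{-d/2}\|\nabla\chi\|$ for $\chi\in S_h$, with $C$ independent of $h$. $S_H$ (coarse, mesh size $H$) and $S_h$ (fine, mesh size $h\ll H$) are two members of this family, built on triangulations $\mathcal T_H$ and $\mathcal T_h$ of $\Omega$. Time discretization. $N$ is a positive integer, $\Delta t=T/N$, $t_n=n\Delta t$, $f^n=f(t_n)$. The weights $\omega_{ni}$ satisfy $|\omega_{ni}|\le K_1$ for $1\le i\le n\le N$, $\omega_{nn}\ne0$, and $\Delta t\sum_{i=1}^n\omega_{ni}\phi(t_i)=\int_0^{t_n}K(t_n-s)\phi(s)\,ds+O(\Delta t)$. Ritz–Volterra projection and standing regularity. With $B_1(w;u,v)=(\alpha(w)\nabla u,\nabla v)+(\gamma(w)\cdot\nabla u,v)$, $V_hu(t)\in S_h$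 is defined by $A(u-V_hu,v)+\int_0^tK(t-s)B_1(u(s);u(s)-V_hu(s),v)\,ds=0$ for all $v\in S_h$. The solution $u$ is assumed regular enough that $u,u_t$ are bounded in time with values in $\mathcal H^r\cap \mathcal H^1_0$, $\nabla u$ is bounded, $u_{tt}$ is bounded in time with values in $L^2(\Omega)$, that $\rho=u-V_hu$ satisfies $\|\rho\|+h\|\rho\|_1+\|\rho_t\|\le Ch^r$ and $\|\nabla V_hu\|_\infty+\|\nabla(V_hu)_t\|_\infty\le C$ on $[0,T]$ (and likewise with $H$ in place of $h$), and that the quadrature error for $\phi(s)=B_1(u(s);V_hu(s),v)$ and for $\phi(s)=(\beta(u(s)),\nabla v)+(g(u(s)),v)$ is at most $C\Delta t\|v\|_1$. Algorithm 4.1. Step one (coarse grid): $U^0_H=u^0_H\in S_H$, and for $1\le n\le N$ find $U^n_H\in S_H$ with $\frac1{\Delta t}(U^n_H-U^{n-1}_H,v)+A(U^n_H,v)+\Delta t\sum_{i=1}^n\omega_{ni}\tilde B(U^i_H;U^i_H,v)=(f^n,v)$ for all $v\in S_H$. Step two (fine grid): $U^0_h=u^0_h\in S_h$, and for $1\le n\le N$ find $U^n_h\in S_h$ with $\frac1{\Delta t}(U^n_h-U^{n-1}_h,v)+A(U^n_h,v)+\Delta t\sum_{i=1}^n\omega_{ni}\tilde B(U^i_H;U^i_h,v)=(f^n,v)$ for all $v\in S_h$. The initial data $u^0_h\in S_h$, $u^0_H\in S_H$ are appropriate approximations of $u_0$: $\|u^0_h-V_hu(0)\|_1\le Ch^r$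 and $\|u^0_H-V_Hu(0)\|_1\le CH^r$. "For sufficiently small $\Delta t$" means: there is $\delta_0>0$, independent of $h$, $H$, such that the claim holds for all $\Delta t\le\delta_0$. *)

theory Defs
  imports "HOL-Analysis.Analysis"
begin

primrec iter_deriv ::
  "'a list \<Rightarrow> ('a::real_normed_vector \<Rightarrow> 'b::real_normed_vector) \<Rightarrow> 'a \<Rightarrow> 'b" where
  "iter_deriv [] f = f"
| "iter_deriv (b # bs) f = (\<lambda>x. frechet_derivative (iter_deriv bs f) (at x) b)"

text \<open>The following two predicates are meant for open sets \<^term>\<open>S\<close>: existence and differentiability
  of all iterated partial derivatives is then the same as being of class C-infinity on \<^term>\<open>S\<close>.\<close>

definition smooth_open :: "'a::euclidean_space set \<Rightarrow> ('a \<Rightarrow> 'b::real_normed_vector) \<Rightarrow> bool" where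
  "smooth_open S f \<longleftrightarrow> (\<forall>bs. set bs \<subseteq> Basis \<longrightarrow> iter_deriv bs f differentiable_on S)"

definition smooth_bounded :: "'a::euclidean_space set \<Rightarrow> ('a \<Rightarrow> 'b::real_normed_vector) \<Rightarrow> bool" where
  "smooth_bounded S f \<longleftrightarrow>
     smooth_open S f \<and> (\<forall>bs. set bs \<subseteq> Basis \<longrightarrow> bounded (iter_deriv bs f ` S))"

definition test_fun :: "'a::euclidean_space set \<Rightarrow> ('a \<Rightarrow> real) set" where
  "test_fun \<Omega> = {\<phi>. smooth_open UNIV \<phi> \<and>
      compact (closure {x. \<phi> x \<noteq> 0}) \<and> closure {x. \<phi> x \<noteq> 0} \<subseteq> \<Omega>}"

text \<open>Elements of the function spaces are represented by functions on the whole space of which only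
  the values almost everywhere on \<^term>\<open>\<Omega>\<close> matter.\<close>

definition L2_space :: "'a::euclidean_space set \<Rightarrow> ('a \<Rightarrow> real) set" where
  "L2_space \<Omega> = {f. f \<in> borel_measurable (lebesgue_on \<Omega>) \<and>
      integrable (lebesgue_on \<Omega>) (\<lambda>x. (f x)\<^sup>2)}"

definition L2_inner ::
  "'a::euclidean_space set \<Rightarrow> ('a \<Rightarrow> 'b::real_inner) \<Rightarrow> ('a \<Rightarrow> 'b) \<Rightarrow> real" where
  "L2_inner \<Omega> f g = (LINT x|lebesgue_on \<Omega>. f x \<bullet> g x)"

definition L2_norm :: "'a::euclidean_space set \<Rightarrow> ('a \<Rightarrow> 'b::real_inner) \<Rightarrow> real" where
  "L2_norm \<Omega> f = sqrt (L2_inner \<Omega> f f)"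

text \<open>A mixed partial derivative is addressed by the list of basis vectors along which one
  differentiates.\<close>

definition has_weak_deriv ::
  "'a::euclidean_space set \<Rightarrow> 'a list \<Rightarrow> ('a \<Rightarrow> real) \<Rightarrow> ('a \<Rightarrow> real) \<Rightarrow> bool" where
  "has_weak_deriv \<Omega> bs u w \<longleftrightarrow> u \<in> L2_space \<Omega> \<and> w \<in> L2_space \<Omega> \<and>
     (\<forall>\<phi>\<in>test_fun \<Omega>. L2_inner \<Omega> u (iter_deriv bs \<phi>) = (- 1) ^ length bs * L2_inner \<Omega> w \<phi>)"

definition weak_deriv :: "'a::euclidean_space set \<Rightarrow> 'a list \<Rightarrow> ('a \<Rightarrow> real) \<Rightarrow> 'a \<Rightarrow> real" where
  "weak_deriv \<Omega> bs u = (SOME w. has_weak_deriv \<Omega> bs u w)"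

definition weak_grad :: "(real^'n) set \<Rightarrow> (real^'n \<Rightarrow> real) \<Rightarrow> real^'n \<Rightarrow> real^'n" where
  "weak_grad \<Omega> u x = (\<chi> i. weak_deriv \<Omega> [axis i 1] u x)"

abbreviation dirs :: "nat \<Rightarrow> 'a::euclidean_space list set" where
  "dirs k \<equiv> {bs. set bs \<subseteq> Basis \<and> length bs = k}"

text \<open>Sobolev spaces of real order \<^term>\<open>s \<ge> 0\<close>; for fractional \<^term>\<open>s\<close> the top order derivatives have
  a finite Slobodeckij seminorm.  The sum over \<^term>\<open>dirs k\<close> is the squared Frobenius norm of the
  tensor of all k-th order derivatives (mixed derivatives are counted with multiplicity).\<close>

definition slobodeckij_integrand :: "real \<Rightarrow> ('a::euclidean_space \<Rightarrow> real) \<Rightarrow> 'a \<times> 'a \<Rightarrow> real" where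
  "slobodeckij_integrand \<sigma> w =
     (\<lambda>(x, y). (w x - w y)\<^sup>2 / norm (x - y) powr (real DIM('a) + 2 * \<sigma>))"

definition Hs_space :: "'a::euclidean_space set \<Rightarrow> real \<Rightarrow> ('a \<Rightarrow> real) set" where
  "Hs_space \<Omega> s = {u. u \<in> L2_space \<Omega> \<and>
     (\<forall>k \<le> nat \<lfloor>s\<rfloor>. \<forall>bs \<in> dirs k. \<exists>w. has_weak_deriv \<Omega> bs u w) \<and>
     (frac s > 0 \<longrightarrow> (\<forall>bs \<in> dirs (nat \<lfloor>s\<rfloor>).
        integrable (lebesgue_on \<Omega> \<Otimes>\<^sub>M lebesgue_on \<Omega>)
          (slobodeckij_integrand (frac s) (weak_deriv \<Omega> bs u))))}"

definition Hs_norm :: "'a::euclidean_space set \<Rightarrow> real \<Rightarrow> ('a \<Rightarrow> real) \<Rightarrow> real" where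
  "Hs_norm \<Omega> s u = sqrt
     ((\<Sum>k \<le> nat \<lfloor>s\<rfloor>. \<Sum>bs \<in> dirs k. (L2_norm \<Omega> (weak_deriv \<Omega> bs u))\<^sup>2) +
      (if frac s > 0 then \<Sum>bs \<in> dirs (nat \<lfloor>s\<rfloor>).
         (LINT z|(lebesgue_on \<Omega> \<Otimes>\<^sub>M lebesgue_on \<Omega>).
            slobodeckij_integrand (frac s) (weak_deriv \<Omega> bs u) z) else 0))"

definition H1_norm :: "(real^'n) set \<Rightarrow> (real^'n \<Rightarrow> real) \<Rightarrow> real" where
  "H1_norm \<Omega> u = sqrt ((L2_norm \<Omega> u)\<^sup>2 + (L2_norm \<Omega> (weak_grad \<Omega> u))\<^sup>2)"

definition H10_space :: "(real^'n) set \<Rightarrow> (real^'n \<Rightarrow> real) set" where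
  "H10_space \<Omega> = {u \<in> Hs_space \<Omega> 1. \<exists>\<phi>. (\<forall>k::nat. \<phi> k \<in> test_fun \<Omega>) \<and>
      (\<lambda>k. H1_norm \<Omega> (u - \<phi> k)) \<longlonglongrightarrow> 0}"

definition has_L2_time_deriv ::
  "(real^'n) set \<Rightarrow> real \<Rightarrow> (real \<Rightarrow> real^'n \<Rightarrow> real) \<Rightarrow> (real \<Rightarrow> real^'n \<Rightarrow> real) \<Rightarrow> bool" where
  "has_L2_time_deriv \<Omega> T u v \<longleftrightarrow> (\<forall>t\<in>{0..T}. u t \<in> L2_space \<Omega> \<and> v t \<in> L2_space \<Omega> \<and>
     ((\<lambda>s. L2_norm \<Omega> (\<lambda>x. (u s x - u t x) / (s - t) - v t x)) \<longlongrightarrow> 0) (at t within {0..T}))"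

definition grad_bounded_by :: "(real^'n) set \<Rightarrow> (real^'n \<Rightarrow> real) \<Rightarrow> real \<Rightarrow> bool" where
  "grad_bounded_by \<Omega> v C \<longleftrightarrow> (AE x in lebesgue_on \<Omega>. norm (weak_grad \<Omega> v x) \<le> C)"

text \<open>The boundary consists of finitely many flat faces, so it is in particular piecewise smooth.\<close>

definition polyhedral_domain :: "(real^'n) set \<Rightarrow> bool" where
  "polyhedral_domain \<Omega> \<longleftrightarrow> open \<Omega> \<and> connected \<Omega> \<and> bounded \<Omega> \<and> \<Omega> \<noteq> {} \<and>
     (\<exists>\<F>. finite \<F> \<and> (\<forall>F\<in>\<F>. polytope F \<and> aff_dim F = int CARD('n) - 1) \<and> frontier \<Omega> = \<Union>\<F>)"

definition finite_dim_space :: "('a \<Rightarrow> real) set \<Rightarrow> bool" where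
  "finite_dim_space S \<longleftrightarrow> (\<exists>B. finite B \<and> S = {f. \<exists>c. f = (\<lambda>x. \<Sum>b\<in>B. c b * b x)})"

definition fem_family :: "(real^'n) set \<Rightarrow> real \<Rightarrow> (real \<Rightarrow> (real^'n \<Rightarrow> real) set) \<Rightarrow> bool" where
  "fem_family \<Omega> r S \<longleftrightarrow>
     (\<forall>h\<in>{0<..1}. finite_dim_space (S h) \<and> S h \<subseteq> H10_space \<Omega>) \<and>
     (\<exists>C. \<forall>h\<in>{0<..1}. \<forall>v\<in>Hs_space \<Omega> r \<inter> H10_space \<Omega>.
        (INF \<eta>\<in>S h. L2_norm \<Omega> (v - \<eta>) + h * H1_norm \<Omega> (v - \<eta>)) \<le> C * h powr r * Hs_norm \<Omega> r v) \<and>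
     (\<exists>C. \<forall>h\<in>{0<..1}. \<forall>\<eta>\<in>S h. grad_bounded_by \<Omega> \<eta>
        (C * h powr (- (real CARD('n) / 2)) * L2_norm \<Omega> (weak_grad \<Omega> \<eta>)))"

text \<open>The bilinear form of the self-adjoint operator \<open>A v = - div (a grad v) + a0 v\<close> at time \<^term>\<open>t\<close>.\<close>

definition A_form ::
  "(real^'n) set \<Rightarrow> (real^'n \<Rightarrow> real \<Rightarrow> real^'n^'n) \<Rightarrow> (real^'n \<Rightarrow> real \<Rightarrow> real) \<Rightarrow>
   real \<Rightarrow> (real^'n \<Rightarrow> real) \<Rightarrow> (real^'n \<Rightarrow> real) \<Rightarrow> real" where
  "A_form \<Omega> a a0 t u v =
     L2_inner \<Omega> (\<lambda>x. a x t *v weak_grad \<Omega> u x) (weak_grad \<Omega> v) + L2_inner \<Omega> (\<lambda>x. a0 x t * u x) v"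

definition elliptic_operator ::
  "(real^'n) set \<Rightarrow> real \<Rightarrow> (real^'n \<Rightarrow> real \<Rightarrow> real^'n^'n) \<Rightarrow> (real^'n \<Rightarrow> real \<Rightarrow> real) \<Rightarrow> bool" where
  "elliptic_operator \<Omega> T a a0 \<longleftrightarrow>
     (\<exists>W. open W \<and> closure \<Omega> \<times> {0..T} \<subseteq> W \<and>
        smooth_open W (\<lambda>(x, t). a x t) \<and> smooth_open W (\<lambda>(x, t). a0 x t)) \<and>
     (\<forall>x\<in>closure \<Omega>. \<forall>t\<in>{0..T}. transpose (a x t) = a x t \<and>
        (\<forall>\<xi>. \<xi> \<noteq> 0 \<longrightarrow> 0 < (a x t *v \<xi>) \<bullet> \<xi>)) \<and>
     (\<exists>\<nu>0>0. \<forall>t\<in>{0..T}. \<forall>v\<in>H10_space \<Omega>. A_form \<Omega> a a0 t v v \<ge> \<nu>0 * (H1_norm \<Omega> v)\<^sup>2) \<and>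
     (\<exists>\<nu>1. \<forall>t\<in>{0..T}. \<forall>u\<in>H10_space \<Omega>. \<forall>v\<in>H10_space \<Omega>.
        \<bar>A_form \<Omega> a a0 t u v\<bar> \<le> \<nu>1 * H1_norm \<Omega> u * H1_norm \<Omega> v)"

definition B_tilde ::
  "(real^'n) set \<Rightarrow> (real^'n \<Rightarrow> real \<Rightarrow> real^'n^'n) \<Rightarrow> (real^'n \<Rightarrow> real \<Rightarrow> real^'n) \<Rightarrow>
   (real^'n \<Rightarrow> real \<Rightarrow> real^'n) \<Rightarrow> (real^'n \<Rightarrow> real \<Rightarrow> real) \<Rightarrow>
   (real^'n \<Rightarrow> real) \<Rightarrow> (real^'n \<Rightarrow> real) \<Rightarrow> (real^'n \<Rightarrow> real) \<Rightarrow> real" where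
  "B_tilde \<Omega> \<alpha> \<beta> \<gamma> g w u v =
     L2_inner \<Omega> (\<lambda>x. \<alpha> x (w x) *v weak_grad \<Omega> u x + \<beta> x (w x)) (weak_grad \<Omega> v) +
     L2_inner \<Omega> (\<lambda>x. \<gamma> x (w x) \<bullet> weak_grad \<Omega> u x + g x (w x)) v"

definition B1_form ::
  "(real^'n) set \<Rightarrow> (real^'n \<Rightarrow> real \<Rightarrow> real^'n^'n) \<Rightarrow> (real^'n \<Rightarrow> real \<Rightarrow> real^'n) \<Rightarrow>
   (real^'n \<Rightarrow> real) \<Rightarrow> (real^'n \<Rightarrow> real) \<Rightarrow> (real^'n \<Rightarrow> real) \<Rightarrow> real" where
  "B1_form \<Omega> \<alpha> \<gamma> w u v =
     L2_inner \<Omega> (\<lambda>x. \<alpha> x (w x) *v weak_grad \<Omega> u x) (weak_grad \<Omega> v) +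
     L2_inner \<Omega> (\<lambda>x. \<gamma> x (w x) \<bullet> weak_grad \<Omega> u x) v"

definition weak_solution ::
  "(real^'n) set \<Rightarrow> real \<Rightarrow> (real \<Rightarrow> real) \<Rightarrow>
   (real^'n \<Rightarrow> real \<Rightarrow> real^'n^'n) \<Rightarrow> (real^'n \<Rightarrow> real \<Rightarrow> real) \<Rightarrow>
   (real^'n \<Rightarrow> real \<Rightarrow> real^'n^'n) \<Rightarrow> (real^'n \<Rightarrow> real \<Rightarrow> real^'n) \<Rightarrow>
   (real^'n \<Rightarrow> real \<Rightarrow> real^'n) \<Rightarrow> (real^'n \<Rightarrow> real \<Rightarrow> real) \<Rightarrow>
   (real \<Rightarrow> real^'n \<Rightarrow> real) \<Rightarrow> (real^'n \<Rightarrow> real) \<Rightarrow>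
   (real \<Rightarrow> real^'n \<Rightarrow> real) \<Rightarrow> (real \<Rightarrow> real^'n \<Rightarrow> real) \<Rightarrow> bool" where
  "weak_solution \<Omega> T K a a0 \<alpha> \<beta> \<gamma> g f u0 u ut \<longleftrightarrow>
     (\<forall>t\<in>{0..T}. u t \<in> H10_space \<Omega>) \<and> has_L2_time_deriv \<Omega> T u ut \<and>
     (AE x in lebesgue_on \<Omega>. u 0 x = u0 x) \<and>
     (\<forall>t\<in>{0<..T}. \<forall>v\<in>H10_space \<Omega>.
        L2_inner \<Omega> (ut t) v + A_form \<Omega> a a0 t (u t) v
          + integral {0..t} (\<lambda>s. K (t - s) * B_tilde \<Omega> \<alpha> \<beta> \<gamma> g (u s) (u s) v)
        = L2_inner \<Omega> (f t) v)"

definition ritz_volterra ::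
  "(real^'n) set \<Rightarrow> real \<Rightarrow> (real \<Rightarrow> real) \<Rightarrow>
   (real^'n \<Rightarrow> real \<Rightarrow> real^'n^'n) \<Rightarrow> (real^'n \<Rightarrow> real \<Rightarrow> real) \<Rightarrow>
   (real^'n \<Rightarrow> real \<Rightarrow> real^'n^'n) \<Rightarrow> (real^'n \<Rightarrow> real \<Rightarrow> real^'n) \<Rightarrow>
   (real^'n \<Rightarrow> real) set \<Rightarrow> (real \<Rightarrow> real^'n \<Rightarrow> real) \<Rightarrow> (real \<Rightarrow> real^'n \<Rightarrow> real) \<Rightarrow> bool" where
  "ritz_volterra \<Omega> T K a a0 \<alpha> \<gamma> S u V \<longleftrightarrow>
     (\<forall>t\<in>{0..T}. V t \<in> S \<and> (\<forall>v\<in>S.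
        A_form \<Omega> a a0 t (u t - V t) v
          + integral {0..t} (\<lambda>s. K (t - s) * B1_form \<Omega> \<alpha> \<gamma> (u s) (u s - V s) v) = 0))"

definition tgrid :: "real \<Rightarrow> nat \<Rightarrow> nat \<Rightarrow> real" where
  "tgrid T N n = real n * (T / real N)"

text \<open>The weights form a family indexed by the number \<^term>\<open>N\<close> of time steps.\<close>

definition quad_error ::
  "real \<Rightarrow> (real \<Rightarrow> real) \<Rightarrow> (nat \<Rightarrow> nat \<Rightarrow> nat \<Rightarrow> real) \<Rightarrow> nat \<Rightarrow> nat \<Rightarrow> (real \<Rightarrow> real) \<Rightarrow> real" where
  "quad_error T K \<omega> N n \<phi> =
     (T / real N) * (\<Sum>i=1..n. \<omega> N n i * \<phi> (tgrid T N i))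
     - integral {0..tgrid T N n} (\<lambda>s. K (tgrid T N n - s) * \<phi> s)"

text \<open>The implied constant in the first order accuracy of the quadrature rule depends on the
  continuously differentiable integrand through its supremum and its total variation.\<close>

definition first_order_weights ::
  "real \<Rightarrow> (real \<Rightarrow> real) \<Rightarrow> (nat \<Rightarrow> nat \<Rightarrow> nat \<Rightarrow> real) \<Rightarrow> bool" where
  "first_order_weights T K \<omega> \<longleftrightarrow>
     (\<exists>K1. \<forall>N n i. 1 \<le> i \<and> i \<le> n \<and> n \<le> N \<longrightarrow> \<bar>\<omega> N n i\<bar> \<le> K1) \<and>
     (\<forall>N n. 1 \<le> n \<and> n \<le> N \<longrightarrow> \<omega> N n n \<noteq> 0) \<and>
     (\<exists>C. \<forall>N n \<phi> \<phi>' M. 1 \<le> n \<and> n \<le> N \<and>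
        continuous_on {0..tgrid T N n} \<phi>' \<and>
        (\<forall>s\<in>{0..tgrid T N n}. \<bar>\<phi> s\<bar> \<le> M \<and>
           (\<phi> has_real_derivative \<phi>' s) (at s within {0..tgrid T N n})) \<longrightarrow>
        \<bar>quad_error T K \<omega> N n \<phi>\<bar> \<le>
          C * (T / real N) * (M + integral {0..tgrid T N n} (\<lambda>s. \<bar>\<phi>' s\<bar>)))"

text \<open>Both steps of the two-grid algorithm are instances of the following scheme on a space
  \<^term>\<open>S\<close> with initial value \<^term>\<open>U0\<close>: the coarse-grid step is the case \<^term>\<open>W = U\<close> on the coarse
  space, and in the fine-grid step \<^term>\<open>W\<close> is the coarse-grid solution.\<close>

definition two_grid_step ::
  "(real^'n) set \<Rightarrow> real \<Rightarrow>
   (real^'n \<Rightarrow> real \<Rightarrow> real^'n^'n) \<Rightarrow> (real^'n \<Rightarrow> real \<Rightarrow> real) \<Rightarrow>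
   (real^'n \<Rightarrow> real \<Rightarrow> real^'n^'n) \<Rightarrow> (real^'n \<Rightarrow> real \<Rightarrow> real^'n) \<Rightarrow>
   (real^'n \<Rightarrow> real \<Rightarrow> real^'n) \<Rightarrow> (real^'n \<Rightarrow> real \<Rightarrow> real) \<Rightarrow>
   (real \<Rightarrow> real^'n \<Rightarrow> real) \<Rightarrow> (nat \<Rightarrow> nat \<Rightarrow> nat \<Rightarrow> real) \<Rightarrow> nat \<Rightarrow>
   (real^'n \<Rightarrow> real) set \<Rightarrow> (real^'n \<Rightarrow> real) \<Rightarrow>
   (nat \<Rightarrow> real^'n \<Rightarrow> real) \<Rightarrow> (nat \<Rightarrow> real^'n \<Rightarrow> real) \<Rightarrow> bool" where
  "two_grid_step \<Omega> T a a0 \<alpha> \<beta> \<gamma> g f \<omega> N S U0 W U \<longleftrightarrow>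
     U 0 = U0 \<and> U0 \<in> S \<and>
     (\<forall>n\<in>{1..N}. U n \<in> S \<and> (\<forall>v\<in>S.
        1 / (T / real N) * L2_inner \<Omega> (U n - U (n - 1)) v
          + A_form \<Omega> a a0 (tgrid T N n) (U n) v
          + (T / real N) * (\<Sum>i=1..n. \<omega> N n i * B_tilde \<Omega> \<alpha> \<beta> \<gamma> g (W i) (U i) v)
        = L2_inner \<Omega> (f (tgrid T N n)) v))"

end

theory Submission
  imports Defs "HOL-Library.Function_Algebras"
begin

text \<open>Write \<open>k = T / N\<close> and let \<open>\<theta>\<^sub>j = U\<^sub>j - V\<^sub>h(t\<^sub>j)\<close> be the difference between the discrete solution and the
  Ritz-Volterra projection.  Because \<open>u - V\<^sub>h\<close> is of order \<open>h\<^bsup>r - 1\<^esup>\<close> in \<open>H\<^sup>1\<close>, it suffices to bound the \<open>H\<^sup>1\<close> norm of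
  \<open>\<theta>\<^sub>m\<close> by a multiple of \<open>H\<^sup>r + h\<^sup>r + k\<close>.  Subtracting the weak form, the definition of the projection and the
  scheme gives the error equation
  \<open>(\<theta>\<^sub>j - \<theta>\<^sub>j\<^sub>-\<^sub>1, v) + k A(t\<^sub>j; \<theta>\<^sub>j, v) = k ((\<tau>\<^sub>j, v) - q\<^sub>j(v) + k \<Sum>\<^sub>i \<omega>\<^sub>j\<^sub>i F\<^sub>i(v))\<close>, in which \<open>\<tau>\<^sub>j\<close> is the truncation
  error of the time difference, \<open>q\<^sub>j\<close> the quadrature error for the functional \<open>\<Phi>(s)\<close> that maps \<open>v\<close> to
  \<open>B(u(s); V\<^sub>h(s), v)\<close>, and \<open>F\<^sub>i\<close> the error committed in the nonlinear form at \<open>t\<^sub>i\<close>; with \<open>W\<^sub>i\<close> the frozen argument,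
  \<open>F\<^sub>i\<close> is bounded on \<open>H\<^sup>1\<close> by \<open>\<parallel>u(t\<^sub>i) - W\<^sub>i\<parallel> + \<parallel>\<theta>\<^sub>i\<parallel>\<^sub>1\<close>.

  Testing with the difference quotient of \<open>\<theta>\<close> would require summation by parts in the first index of the
  weights, in which they have no regularity at all.  The bound is obtained by duality instead.  Freeze the
  elliptic form at the final time \<open>t\<^sub>m\<close>, let \<open>R\<close> be the resolvent \<open>(1 + k A)\<^sup>-\<^sup>1\<close> on \<open>S\<^sub>h\<close>, and put
  \<open>D\<^sub>l = R\<^sup>l - R\<^bsup>l + 1\<^esup>\<close>.  With \<open>w = \<theta>\<^sub>m\<close>, the discrete Duhamel formula \<open>duhamel\<close> expresses \<open>A(\<theta>\<^sub>m, w)\<close> by the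
  right-hand sides of the error equation tested with \<open>D\<^bsub>m - j\<^esub> w\<close>.  The operators \<open>D\<^sub>l\<close> are self-adjoint,
  nonnegative and decreasing in the energy inner product and their sum is at most the identity.  Hence, in
  the energy norm \<open>|.|\<close>, linear combinations \<open>\<Sum>\<^sub>l c\<^sub>l D\<^sub>l w\<close> are bounded by \<open>max |c\<^sub>l| |w|\<close> (\<open>nrm_sum_D\<close>), \<open>|D\<^sub>l w|\<close>
  decays like \<open>|w| / (l + 1)\<close> (\<open>nrm_D\<close>), and the squared \<open>L\<^sup>2\<close> norms of the \<open>D\<^sub>l w\<close> add up to at most
  \<open>k |w|\<^sup>2\<close> (\<open>sum_p_D\<close>).  The last bound takes care of \<open>\<tau>\<^sub>j\<close>, the second of the Lipschitz dependence of \<open>A\<close> on time.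
  The memory terms have the form \<open>\<Sum>\<^sub>j c\<^sub>j F\<^sub>i(D\<^bsub>m - j\<^esub> w)\<close> with \<open>F\<^sub>i\<close> independent of \<open>j\<close>, so the first bound applies and
  no logarithm of \<open>k\<close> appears.

  The same superposition principle handles the quadrature errors (\<open>quadrature_superposition\<close>).  The
  functional \<open>\<Phi>\<close> is only Lipschitz continuous in time, so its quadrature error is decomposed by Abel summation
  into errors on initial segments, to which the first order accuracy of the rule applies after
  replacing indicator functions by continuously differentiable ramps, and integrals over single cells.  The latter
  are of first order because \<open>K\<close> is essentially bounded: the rule converges, hence integrals against \<open>K\<close> inherit
  the bound of the weights (\<open>kernel_ae_bound\<close>).

  Together this gives the stability estimate
  \<open>\<parallel>\<theta>\<^sub>m\<parallel>\<^sub>1 \<le> c (\<parallel>\<theta>\<^sub>0\<parallel>\<^sub>1 + k + h\<^sup>r + k \<Sum>\<^sub>i (\<parallel>u(t\<^sub>i) - W\<^sub>i\<parallel> + \<parallel>\<theta>\<^sub>i\<parallel>\<^sub>1))\<close> (\<open>stability\<close>).  On the coarse grid \<open>W = U\<close>, and Gronwall's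
  lemma yields a bound of order \<open>H\<^sup>r + k\<close>; on the fine grid \<open>W\<close> is the coarse solution, whose \<open>L\<^sup>2\<close> error is of
  that order, and Gronwall's lemma applies once more.

  Two analytical points precede the estimates.  Weak gradients are linear only almost everywhere, which rests on
  the uniqueness of weak derivatives and thus on an ample supply of test functions.  And the exact memory
  integrand has to be integrable before the equations can be subtracted; it is Lipschitz continuous in time as the
  limit of the projected integrands for \<open>h\<close> tending to 0, where \<open>r > 1\<close> is used (\<open>exact_lipschitz\<close>).\<close>

section \<open>Semi-inner products on finite-dimensional subspaces\<close>

text \<open>A symmetric nonnegative bilinear form on a subspace.  It need not be definite, because functions
  that agree almost everywhere are not identified.\<close>

locale semi_inner =
  fixes S :: "'v::real_vector set" and b :: "'v \<Rightarrow> 'v \<Rightarrow> real"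
  assumes subspace: "subspace S"
    and sym: "x \<in> S \<Longrightarrow> y \<in> S \<Longrightarrow> b x y = b y x"
    and nonneg: "x \<in> S \<Longrightarrow> 0 \<le> b x x"
    and add_left: "x \<in> S \<Longrightarrow> y \<in> S \<Longrightarrow> z \<in> S \<Longrightarrow> b (x + y) z = b x z + b y z"
    and scale_left: "x \<in> S \<Longrightarrow> z \<in> S \<Longrightarrow> b (c *\<^sub>R x) z = c * b x z"
begin

lemmas mem_intros [simp, intro] =
  subspace_add[OF subspace] subspace_diff[OF subspace] subspace_scale[OF subspace]
  subspace_0[OF subspace] subspace_sum[OF subspace]

lemma zero_left [simp]: "y \<in> S \<Longrightarrow> b 0 y = 0"
  using scale_left[of 0 y 0] by simp

lemma minus_left: "x \<in> S \<Longrightarrow> y \<in> S \<Longrightarrow> z \<in> S \<Longrightarrow> b (x - y) z = b x z - b y z"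
  using add_left[of "x - y" y z] by simp

lemma add_right: "x \<in> S \<Longrightarrow> y \<in> S \<Longrightarrow> z \<in> S \<Longrightarrow> b z (x + y) = b z x + b z y"
  using add_left[of x y z] sym[of z x] sym[of z y] sym[of z "x+y"] by simp

lemma minus_right: "x \<in> S \<Longrightarrow> y \<in> S \<Longrightarrow> z \<in> S \<Longrightarrow> b z (x - y) = b z x - b z y"
  using minus_left[of x y z] sym[of z x] sym[of z y] sym[of z "x-y"] by simp

lemma scale_right: "x \<in> S \<Longrightarrow> z \<in> S \<Longrightarrow> b z (c *\<^sub>R x) = c * b z x"
  using scale_left[of x z c] sym[of z x] sym[of z "c *\<^sub>R x"] by simp

lemma sum_left:
  assumes "\<And>i. i \<in> I \<Longrightarrow> f i \<in> S" "z \<in> S"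
  shows "b (\<Sum>i\<in>I. c i *\<^sub>R f i) z = (\<Sum>i\<in>I. c i * b (f i) z)"
  using assms
proof (induction I rule: infinite_finite_induct)
  case (insert i I)
  have "(\<Sum>i\<in>I. c i *\<^sub>R f i) \<in> S" using insert by (intro mem_intros) auto
  then show ?case using insert by (simp add: add_left scale_left)
qed auto

lemma sum_right:
  assumes "\<And>i. i \<in> I \<Longrightarrow> f i \<in> S" "z \<in> S"
  shows "b z (\<Sum>i\<in>I. c i *\<^sub>R f i) = (\<Sum>i\<in>I. c i * b z (f i))"
proof -
  have "(\<Sum>i\<in>I. c i *\<^sub>R f i) \<in> S" using assms by (intro mem_intros) auto
  then have "b z (\<Sum>i\<in>I. c i *\<^sub>R f i) = (\<Sum>i\<in>I. c i * b (f i) z)"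
    using sum_left[of I f z c] assms by (subst sym) auto
  also have "\<dots> = (\<Sum>i\<in>I. c i * b z (f i))"
    using assms by (intro sum.cong refl) (simp add: sym[of _ z])
  finally show ?thesis .
qed

lemma cauchy_schwarz_sq:
  assumes "x \<in> S" "y \<in> S" shows "(b x y)\<^sup>2 \<le> b x x * b y y"
proof -
  have q: "0 \<le> b x x - 2 * s * b x y + s\<^sup>2 * b y y" for s
  proof -
    have "0 \<le> b (x - s *\<^sub>R y) (x - s *\<^sub>R y)" using assms by (intro nonneg) auto
    also have "\<dots> = b x x - 2 * s * b x y + s\<^sup>2 * b y y"
      using assms sym[of x y]
      by (simp add: minus_left minus_right scale_left scale_right power2_eq_square algebra_simps)
    finally show ?thesis .
  qed
  show ?thesis
  proof (cases "b y y = 0")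
    case True
    have "b x y = 0"
    proof (rule ccontr)
      assume n: "b x y \<noteq> 0"
      have "0 \<le> b x x - 2 * ((b x x + 1) / (2 * b x y)) * b x y"
        using q[of "(b x x + 1) / (2 * b x y)"] True by simp
      then show False using n by (simp add: field_simps)
    qed
    then show ?thesis using nonneg assms by simp
  next
    case False
    then have p: "0 < b y y" using nonneg[OF assms(2)] by simp
    have "0 \<le> b x x - 2 * (b x y / b y y) * b x y + (b x y / b y y)\<^sup>2 * b y y" by (rule q)
    also have "\<dots> = b x x - (b x y)\<^sup>2 / b y y" using p by (simp add: power2_eq_square field_simps)
    finally show ?thesis using p by (simp add: field_simps)
  qed
qed

text \<open>The seminorm induced by the form.\<close>

definition nrm :: "'v \<Rightarrow> real" where "nrm x = sqrt (b x x)"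

lemma nrm_nonneg [simp]: "x \<in> S \<Longrightarrow> 0 \<le> nrm x" by (simp add: nrm_def nonneg)
lemma nrm_sq: "x \<in> S \<Longrightarrow> (nrm x)\<^sup>2 = b x x" by (simp add: nrm_def nonneg)

lemma cauchy_schwarz:
  assumes "x \<in> S" "y \<in> S" shows "\<bar>b x y\<bar> \<le> nrm x * nrm y"
proof -
  have "\<bar>b x y\<bar> = sqrt ((b x y)\<^sup>2)" by simp
  also have "\<dots> \<le> sqrt (b x x * b y y)" using cauchy_schwarz_sq[OF assms] by (rule real_sqrt_le_mono)
  finally show ?thesis by (simp add: nrm_def real_sqrt_mult)
qed

lemma nrm_triangle:
  assumes "x \<in> S" "y \<in> S" shows "nrm (x + y) \<le> nrm x + nrm y"
proof -
  have "(nrm (x + y))\<^sup>2 = b x x + 2 * b x y + b y y"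
    using assms sym[of x y] by (simp add: nrm_sq add_left add_right)
  also have "\<dots> \<le> (nrm x)\<^sup>2 + 2 * (nrm x * nrm y) + (nrm y)\<^sup>2"
    using assms cauchy_schwarz[OF assms] by (simp add: nrm_sq)
  also have "\<dots> = (nrm x + nrm y)\<^sup>2" by (simp add: power2_eq_square algebra_simps)
  finally have sq: "(nrm (x + y))\<^sup>2 \<le> (nrm x + nrm y)\<^sup>2" .
  show ?thesis by (rule power2_le_imp_le[OF sq]) (use assms in auto)
qed

lemma nrm_scale: assumes "x \<in> S" shows "nrm (c *\<^sub>R x) = \<bar>c\<bar> * nrm x"
proof -
  have "b (c *\<^sub>R x) (c *\<^sub>R x) = c\<^sup>2 * b x x"
    using assms by (simp add: scale_left scale_right power2_eq_square)
  then show ?thesis by (simp add: nrm_def real_sqrt_mult)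
qed

lemma nrm_minus_commute: "x \<in> S \<Longrightarrow> y \<in> S \<Longrightarrow> nrm (x - y) = nrm (y - x)"
  using nrm_scale[of "y - x" "-1"] by simp

lemma nrm_triangle_minus:
  assumes "x \<in> S" "y \<in> S" shows "nrm (x - y) \<le> nrm x + nrm y"
  using nrm_triangle[of x "(-1) *\<^sub>R y"] nrm_scale[of y "-1"] assms mem_intros(3)[of y "-1"] by simp

lemma null_left: "x \<in> S \<Longrightarrow> y \<in> S \<Longrightarrow> b x x = 0 \<Longrightarrow> b x y = 0"
  using cauchy_schwarz[of x y] by (simp add: nrm_def)

text \<open>Gram-Schmidt orthonormalisation.  Vectors of seminorm zero are divided out only implicitly: every
  vector equals its orthogonal projection up to such a vector.\<close>

lemma orthonormal_system:
  assumes "finite B" "B \<subseteq> S"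
  shows "\<exists>E. finite E \<and> E \<subseteq> S \<and> (\<forall>e\<in>E. \<forall>e'\<in>E. b e e' = (if e = e' then 1 else 0)) \<and>
    (\<forall>x\<in>span B. nrm (x - (\<Sum>e\<in>E. b x e *\<^sub>R e)) = 0)"
  using assms
proof (induction B rule: finite_induct)
  case empty
  then show ?case by (intro exI[of _ "{}"]) (auto simp: nrm_def)
next
  case (insert v B)
  then have "B \<subseteq> S" by simp
  from insert.IH[OF this] obtain E where E0: "finite E \<and> E \<subseteq> S \<and>
    (\<forall>e\<in>E. \<forall>e'\<in>E. b e e' = (if e = e' then 1 else 0)) \<and>
    (\<forall>x\<in>span B. nrm (x - (\<Sum>e\<in>E. b x e *\<^sub>R e)) = 0)" ..
  then have E: "finite E" "E \<subseteq> S"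
      "\<And>e e'. e \<in> E \<Longrightarrow> e' \<in> E \<Longrightarrow> b e e' = (if e = e' then 1 else 0)"
      "\<And>x. x \<in> span B \<Longrightarrow> nrm (x - (\<Sum>e\<in>E. b x e *\<^sub>R e)) = 0"
    by blast+
  define P where "P x = x - (\<Sum>e\<in>E. b x e *\<^sub>R e)" for x
  have vS: "v \<in> S" and BS: "span B \<subseteq> S" using insert.prems span_minimal[OF _ subspace] by auto
  have PS: "P x \<in> S" if "x \<in> S" for x unfolding P_def using that E(2) by (intro mem_intros) auto
  have Porth: "b (P x) e = 0" if "x \<in> S" "e \<in> E" for x e
  proof -
    have "b (P x) e = b x e - (\<Sum>e'\<in>E. b x e' * b e' e)"
      unfolding P_def using that E(2) by (subst minus_left) (auto simp: sum_left subset_iff)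
    also have "(\<Sum>e'\<in>E. b x e' * b e' e) = (\<Sum>e'\<in>E. if e' = e then b x e' else 0)"
      using E(3) that by (intro sum.cong) auto
    finally show ?thesis using that E(1) by simp
  qed
  have Padd: "P (x + c *\<^sub>R y) = P x + c *\<^sub>R P y" if "x \<in> S" "y \<in> S" for x y c
  proof -
    have "(\<Sum>e\<in>E. b (x + c *\<^sub>R y) e *\<^sub>R e) = (\<Sum>e\<in>E. b x e *\<^sub>R e + c *\<^sub>R (b y e *\<^sub>R e))"
      using that E(2) by (intro sum.cong) (auto simp: add_left scale_left scaleR_add_left subset_iff)
    then show ?thesis unfolding P_def
      by (simp add: sum.distrib scaleR_sum_right scaleR_diff_right)
  qed
  have null_comb: "nrm (x + c *\<^sub>R y) = 0" if "nrm x = 0" "nrm y = 0" "x \<in> S" "y \<in> S" for x y c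
  proof -
    have "x + c *\<^sub>R y \<in> S" using that by auto
    from nrm_nonneg[OF this] have "0 \<le> nrm (x + c *\<^sub>R y)" .
    moreover have "nrm (x + c *\<^sub>R y) \<le> nrm x + nrm (c *\<^sub>R y)" using that by (intro nrm_triangle) auto
    moreover have "nrm (c *\<^sub>R y) = 0" using that by (simp add: nrm_scale)
    ultimately show ?thesis using that by linarith
  qed
  have split: "\<exists>c. \<exists>y\<in>span B. x = y + c *\<^sub>R v" if "x \<in> span (insert v B)" for x
  proof -
    obtain c where "x - c *\<^sub>R v \<in> span B" using \<open>x \<in> span (insert v B)\<close> span_breakdown_eq by blast
    then show ?thesis by (intro exI[of _ c] bexI[of _ "x - c *\<^sub>R v"]) auto
  qed
  show ?case
  proof (cases "nrm (P v) = 0")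
    case True
    \<comment> \<open>If the projection residual of the new vector is null, the old system still suffices.\<close>
    have "nrm (P x) = 0" if "x \<in> span (insert v B)" for x
    proof -
      obtain c y where "y \<in> span B" "x = y + c *\<^sub>R v" using split[OF \<open>x \<in> span (insert v B)\<close>] by auto
      moreover from this have "y \<in> S" "nrm (P y) = 0" using BS E(4)[of y] by (auto simp: P_def)
      ultimately show ?thesis using Padd[of y v c] null_comb[of "P y" "P v" c] True vS PS by simp
    qed
    then show ?thesis using E by (intro exI[of _ E]) (auto simp: P_def)
  next
    case False
    define r where "r = nrm (P v)"
    \<comment> \<open>Otherwise its normalised residual is adjoined.\<close>
    define n where "n = (1 / r) *\<^sub>R P v"
    have r0: "r \<noteq> 0" using False r_def by simp
    have nS: "n \<in> S" using PS vS by (auto simp: n_def)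
    have "b n n = (1 / r) * ((1 / r) * b (P v) (P v))"
      unfolding n_def using PS[OF vS] by (simp add: scale_left scale_right)
    also have "b (P v) (P v) = r * r" using nrm_sq[OF PS[OF vS]] by (simp add: r_def power2_eq_square)
    finally have nn: "b n n = 1" using r0 by simp
    have nE: "b n e = 0" "b e n = 0" if "e \<in> E" for e
    proof -
      have "e \<in> S" using that E(2) by auto
      then show "b n e = 0" unfolding n_def using Porth[OF vS that] PS[OF vS] by (simp add: scale_left)
      then show "b e n = 0" using sym[OF nS \<open>e \<in> S\<close>] by simp
    qed
    have notin: "n \<notin> E" using nE nn by force
    define Q where "Q x = x - (\<Sum>e\<in>insert n E. b x e *\<^sub>R e)" for x
    have Q: "Q x = P x - b x n *\<^sub>R n" for x
      unfolding Q_def P_def using notin E(1) by simp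
    have bxn: "b x n = b (P x) n" if "x \<in> S" for x
    proof -
      have "b (P x) n = b x n - (\<Sum>e\<in>E. b x e * b e n)"
        unfolding P_def using that E(2) nS by (subst minus_left) (auto simp: sum_left subset_iff)
      then show ?thesis using nE by simp
    qed
    have Qy: "nrm (Q y) = 0" if "y \<in> span B" for y
    proof -
      have y: "y \<in> S" "nrm (P y) = 0" using that BS E(4) P_def by auto
      then have "b (P y) (P y) = 0" using nrm_sq[OF PS[of y]] by auto
      then have "b y n = 0" using null_left[OF PS[of y] nS] bxn y by simp
      then show ?thesis using y by (simp add: Q)
    qed
    have Qv: "Q v = 0"
    proof -
      have "P v = r *\<^sub>R n" using r0 by (simp add: n_def)
      then have "b v n = r" using bxn[OF vS] nn nS by (simp add: scale_left)
      then show ?thesis using \<open>P v = r *\<^sub>R n\<close> by (simp add: Q)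
    qed
    have "nrm (Q x) = 0" if "x \<in> span (insert v B)" for x
    proof -
      obtain c y where y: "y \<in> span B" "x = y + c *\<^sub>R v" using split[OF \<open>x \<in> span (insert v B)\<close>] by auto
      then have yS: "y \<in> S" using BS by auto
      have "Q x = Q y + c *\<^sub>R Q v"
        using y Padd[OF yS vS] yS vS nS
        by (simp add: Q add_left scale_left scaleR_add_left scaleR_diff_right)
      then show ?thesis using Qv Qy y by simp
    qed
    moreover have "b e e' = (if e = e' then 1 else 0)" if "e \<in> insert n E" "e' \<in> insert n E" for e e'
      using that E(3) nE nn notin by (cases "e = n"; cases "e' = n") auto
    ultimately show ?thesis using E(1,2) nS
      by (intro exI[of _ "insert n E"]) (simp add: Q_def)
  qed
qed

lemma orthonormal_basis:
  assumes "S = span B" "finite B"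
  obtains E where "finite E" "E \<subseteq> S"
    "\<And>e e'. e \<in> E \<Longrightarrow> e' \<in> E \<Longrightarrow> b e e' = (if e = e' then 1 else 0)"
    "\<And>x. x \<in> S \<Longrightarrow> nrm (x - (\<Sum>e\<in>E. b x e *\<^sub>R e)) = 0"
proof -
  have "B \<subseteq> S" using assms span_superset by auto
  from orthonormal_system[OF assms(2) this] show ?thesis
    using that unfolding assms(1)[symmetric] by blast
qed

end

text \<open>On a finite-dimensional space a seminorm vanishing wherever another one does is bounded by it.\<close>

lemma finite_dim_norm_bound:
  assumes p: "semi_inner S p" and q: "semi_inner S q" and S: "S = span B" "finite B"
    and null: "\<And>x. x \<in> S \<Longrightarrow> p x x = 0 \<Longrightarrow> q x x = 0"
  shows "\<exists>C\<ge>0. \<forall>x\<in>S. sqrt (q x x) \<le> C * sqrt (p x x)"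
proof -
  interpret p: semi_inner S p by fact
  interpret q: semi_inner S q by fact
  obtain E where E: "finite E" "E \<subseteq> S" "\<And>e e'. e \<in> E \<Longrightarrow> e' \<in> E \<Longrightarrow> p e e' = (if e = e' then 1 else 0)"
      "\<And>x. x \<in> S \<Longrightarrow> p.nrm (x - (\<Sum>e\<in>E. p x e *\<^sub>R e)) = 0"
    by (rule p.orthonormal_basis[OF S]) (rule that)
  have "q.nrm x \<le> (\<Sum>e\<in>E. q.nrm e) * p.nrm x" if x: "x \<in> S" for x
  proof -
    define y where "y = (\<Sum>e\<in>E. p x e *\<^sub>R e)"
    have yS: "y \<in> S" unfolding y_def using E(2) by (intro p.mem_intros) auto
    have "p (x - y) (x - y) = 0" using E(4)[OF x] p.nrm_sq[of "x - y"] x yS by (auto simp: y_def)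
    then have z: "q.nrm (x - y) = 0" using null[of "x - y"] x yS by (simp add: q.nrm_def)
    have sum_le: "q.nrm (\<Sum>e\<in>F. p x e *\<^sub>R e) \<le> (\<Sum>e\<in>F. q.nrm e * p.nrm x)" if "F \<subseteq> E" for F
      using finite_subset[OF that E(1)] that
    proof (induction F rule: finite_induct)
      case empty
      then show ?case by (simp add: q.nrm_def)
    next
      case (insert e F)
      then have e: "e \<in> S" using E(2) by auto
      have "(\<Sum>e\<in>F. p x e *\<^sub>R e) \<in> S" using insert E(2) by (intro q.mem_intros) auto
      then have "q.nrm (\<Sum>e\<in>insert e F. p x e *\<^sub>R e) \<le> q.nrm (p x e *\<^sub>R e) + q.nrm (\<Sum>e\<in>F. p x e *\<^sub>R e)"
        using insert e q.nrm_triangle by simp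
      moreover have "p.nrm e = 1" using E(3)[of e e] insert by (simp add: p.nrm_def)
      then have "\<bar>p x e\<bar> \<le> p.nrm x" using p.cauchy_schwarz[OF x e] by simp
      then have "q.nrm (p x e *\<^sub>R e) \<le> q.nrm e * p.nrm x"
        using e mult_left_mono[of "\<bar>p x e\<bar>" "p.nrm x" "q.nrm e"] by (simp add: q.nrm_scale mult.commute)
      ultimately show ?case using insert by simp
    qed
    have "q.nrm x \<le> q.nrm (x - y) + q.nrm y" using q.nrm_triangle[of "x - y" y] x yS by auto
    also have "\<dots> \<le> (\<Sum>e\<in>E. q.nrm e * p.nrm x)" using z sum_le[of E] by (simp add: y_def)
    finally show ?thesis by (simp add: sum_distrib_right)
  qed
  moreover have "0 \<le> (\<Sum>e\<in>E. q.nrm e)" using E(2) by (intro sum_nonneg) auto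
  ultimately show ?thesis by (auto simp: p.nrm_def q.nrm_def)
qed

section \<open>The resolvent of the implicit Euler scheme\<close>

text \<open>One step of the implicit Euler scheme for a form \<open>a\<close>, with \<open>p\<close> in the role of the \<open>L\<^sup>2\<close> product and step size
  \<open>k\<close>, maps \<open>x\<close> to \<open>R x\<close>.\<close>

locale resolvent = p: semi_inner S p + a: semi_inner S a
  for S :: "'v::real_vector set" and p a :: "'v \<Rightarrow> 'v \<Rightarrow> real" +
  fixes k :: real and R :: "'v \<Rightarrow> 'v"
  assumes k_pos: "0 < k"
    and R_mem [simp]: "x \<in> S \<Longrightarrow> R x \<in> S"
    and R_eq: "x \<in> S \<Longrightarrow> v \<in> S \<Longrightarrow> p (R x) v + k * a (R x) v = p x v"
begin

lemma pow_mem [simp]: "x \<in> S \<Longrightarrow> (R ^^ n) x \<in> S"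
  by (induction n) auto

text \<open>The discrete semigroup is \<open>R\<^sup>l\<close>; up to the factor \<open>k\<close>, its difference \<open>D\<^sub>l\<close> is the generator applied to
  \<open>R\<^bsup>l + 1\<^esup>\<close> (lemma \<open>p_D\<close> below).\<close>

definition D :: "nat \<Rightarrow> 'v \<Rightarrow> 'v" where "D l x = (R ^^ l) x - (R ^^ Suc l) x"

lemma D_mem [simp]: "x \<in> S \<Longrightarrow> D l x \<in> S"
  unfolding D_def by (intro a.mem_intros pow_mem)

lemma p_diff: "x \<in> S \<Longrightarrow> v \<in> S \<Longrightarrow> p (x - R x) v = k * a (R x) v"
  using R_eq[of x v] by (simp add: p.minus_left)

lemma p_D: "x \<in> S \<Longrightarrow> v \<in> S \<Longrightarrow> p (D l x) v = k * a ((R ^^ Suc l) x) v"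
  unfolding D_def using p_diff[of "(R ^^ l) x" v] by simp

lemma R_self_adjoint:
  assumes "x \<in> S" "y \<in> S" shows "a (R x) y = a x (R y)"
proof -
  have "p x (R y) = p (R x) y"
    using R_eq[of x "R y"] R_eq[of y "R x"] assms p.sym[of "R x" "R y"] p.sym[of y "R x"]
      a.sym[of "R x" "R y"] by simp
  moreover have "k * a (R x) y = p x y - p (R x) y" using R_eq[of x y] assms by simp
  moreover have "k * a (R y) x = p y x - p (R y) x" using R_eq[of y x] assms by simp
  ultimately have "k * a (R x) y = k * a (R y) x"
    using assms p.sym[of x y] p.sym[of x "R y"] by simp
  then show ?thesis using k_pos assms a.sym[of x "R y"] by simp
qed

lemma pow_self_adjoint:
  assumes "x \<in> S" "y \<in> S" shows "a ((R ^^ n) x) y = a x ((R ^^ n) y)"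
  using assms
proof (induction n arbitrary: x y)
  case (Suc n)
  then have "a ((R ^^ Suc n) x) y = a ((R ^^ n) x) (R y)" using R_self_adjoint by simp
  also have "\<dots> = a x ((R ^^ n) (R y))" using Suc by simp
  finally show ?case by (simp only: funpow_swap1 funpow.simps o_apply)
qed auto

lemma D_self_adjoint:
  assumes "x \<in> S" "y \<in> S" shows "a (D l x) y = a x (D l y)"
  unfolding D_def using assms pow_mem[OF assms(1)] pow_mem[OF assms(2)]
    pow_self_adjoint[OF assms, of l] pow_self_adjoint[OF assms, of "Suc l"]
  by (simp only: a.minus_left a.minus_right)

text \<open>Powers of \<open>R\<close> may be distributed over both arguments of \<open>a\<close>.  Distributing them evenly turns the quadratic
  forms of \<open>R\<^sup>l\<close>, \<open>D\<^sub>l\<close> and \<open>D\<^sub>l - D\<^bsub>l + 1\<^esub>\<close> into those of \<open>l = 0\<close> or \<open>l = 1\<close>; this replaces the spectral theorem in the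
  following lemmas.\<close>

lemma pow_split:
  assumes "x \<in> S" "y \<in> S" shows "a ((R ^^ (m + n)) x) y = a ((R ^^ m) x) ((R ^^ n) y)"
  using assms pow_self_adjoint[of "(R ^^ m) x" y n] by (simp add: add.commute[of m n] funpow_add)

lemma R_nonneg: "x \<in> S \<Longrightarrow> 0 \<le> a (R x) x"
  and diff_nonneg: "x \<in> S \<Longrightarrow> 0 \<le> a (x - R x) x"
proof -
  assume x: "x \<in> S"
  have "k * a (R x) (x - R x) = p (x - R x) (x - R x)" using p_diff[OF x, of "x - R x"] x by simp
  then have *: "0 \<le> a (R x) (x - R x)"
    using p.nonneg[of "x - R x"] x k_pos
    by (metis mult_pos_neg not_less p.mem_intros(2) R_mem)
  have "a (R x) x = a (R x) (R x) + a (R x) (x - R x)" using x by (simp add: a.minus_right)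
  then show "0 \<le> a (R x) x" using * a.nonneg[of "R x"] x by simp
  have "a (x - R x) x = a (x - R x) (x - R x) + a (R x) (x - R x)"
    using x a.sym[of x "R x"] by (simp add: a.minus_right a.minus_left)
  then show "0 \<le> a (x - R x) x" using * a.nonneg[of "x - R x"] x by simp
qed

lemma nat_halves: obtains j where "l = j + j" | j where "l = Suc (j + j)"
  by (cases "even l") (auto elim!: evenE oddE simp: mult_2)

lemma pow_nonneg: assumes x: "x \<in> S" shows "0 \<le> a ((R ^^ l) x) x"
proof (cases l rule: nat_halves)
  case (1 j) then show ?thesis using pow_split[OF x x, of j j] a.nonneg x by simp
next
  case (2 j)
  have "a ((R ^^ l) x) x = a (R ((R ^^ j) x)) ((R ^^ j) x)" using pow_split[OF x x, of "Suc j" j] 2 by simp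
  then show ?thesis using R_nonneg x by simp
qed

lemma D_nonneg: assumes x: "x \<in> S" shows "0 \<le> a (D l x) x"
proof (cases l rule: nat_halves)
  case (1 j)
  define z where "z = (R ^^ j) x"
  have "a (D l x) x = a (z - R z) z"
    using pow_split[OF x x, of j j] pow_split[OF x x, of "Suc j" j] 1 x
    by (simp add: D_def a.minus_left z_def)
  then show ?thesis using diff_nonneg[of z] x by (simp add: z_def)
next
  case (2 j)
  define z where "z = (R ^^ j) x"
  have z: "z \<in> S" using x z_def by simp
  have "a (D l x) x = a (R z) z - a (R z) (R z)"
    using pow_split[OF x x, of "Suc j" j] pow_split[OF x x, of "Suc j" "Suc j"] 2 x
    by (simp add: D_def a.minus_left z_def)
  also have "\<dots> = a (R z) (z - R z)" using z by (simp add: a.minus_right)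
  also have "\<dots> = p (z - R z) (z - R z) / k" using p_diff[OF z, of "z - R z"] z k_pos by (simp add: field_simps)
  finally show ?thesis using p.nonneg[of "z - R z"] z k_pos by simp
qed

lemma D_decreasing: assumes x: "x \<in> S" shows "a (D (Suc l) x) x \<le> a (D l x) x"
proof (cases l rule: nat_halves)
  case (1 j)
  define z where "z = (R ^^ j) x"
  have z: "z \<in> S" using x z_def by simp
  have "a (D l x) x - a (D (Suc l) x) x = a z z - 2 * a (R z) z + a (R z) (R z)"
    using pow_split[OF x x, of j j] pow_split[OF x x, of "Suc j" j] pow_split[OF x x, of "Suc j" "Suc j"] 1 x
    by (simp add: D_def a.minus_left z_def)
  also have "\<dots> = a (z - R z) (z - R z)"
    using z a.sym[of z "R z"] by (simp add: a.minus_left a.minus_right)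
  finally show ?thesis using a.nonneg[of "z - R z"] z by simp
next
  case (2 j)
  define z where "z = (R ^^ j) x"
  define q where "q = z - R z"
  have z: "z \<in> S" "q \<in> S" using x z_def q_def by auto
  have "a (D l x) x - a (D (Suc l) x) x = a (R z) z - 2 * a (R z) (R z) + a (R (R z)) (R z)"
    using pow_split[OF x x, of "Suc j" j] pow_split[OF x x, of "Suc j" "Suc j"]
      pow_split[OF x x, of "Suc (Suc j)" "Suc j"] 2 x
    by (simp add: D_def a.minus_left z_def)
  also have "\<dots> = a (R q) q"
  proof -
    have "a (R q) q = a (R q) z - a (R q) (R z)" using z by (simp add: q_def a.minus_right)
    also have "\<dots> = a q (R z) - a q (R (R z))" using z by (simp add: R_self_adjoint)
    also have "\<dots> = a z (R z) - a (R z) (R z) - (a z (R (R z)) - a (R z) (R (R z)))"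
      using z by (simp add: q_def a.minus_left)
    finally show ?thesis
      using z R_self_adjoint[of z "R z"] a.sym[of z "R z"] a.sym[of "R z" "R (R z)"] by simp
  qed
  finally show ?thesis using R_nonneg[of q] z by simp
qed

lemma sum_D_eq: assumes x: "x \<in> S" shows "(\<Sum>l<m. a (D l x) x) = a x x - a ((R ^^ m) x) x"
proof (induction m)
  case (Suc m)
  have "a (D m x) x = a ((R ^^ m) x) x - a ((R ^^ Suc m) x) x"
    unfolding D_def using x by (intro a.minus_left pow_mem)
  then show ?case using Suc by (simp del: funpow.simps)
qed simp

lemma sum_D: assumes x: "x \<in> S" shows "(\<Sum>l<m. a (D l x) x) \<le> a x x"
  using sum_D_eq[OF x] pow_nonneg[OF x, of m] by simp

text \<open>The quadratic forms of the \<open>D\<^sub>l\<close> decrease in \<open>l\<close> and sum to at most that of the identity.\<close>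

lemma D_le: assumes x: "x \<in> S" shows "(real l + 1) * a (D l x) x \<le> a x x"
proof -
  have "a (D l x) x \<le> a (D i x) x" if "i \<le> l" for i
    using that by (induction rule: dec_induct) (use D_decreasing[OF x] in \<open>auto intro: order_trans\<close>)
  then have "(\<Sum>i<Suc l. a (D l x) x) \<le> (\<Sum>i<Suc l. a (D i x) x)" by (intro sum_mono) auto
  then show ?thesis using sum_D[OF x, of "Suc l"] by (simp add: algebra_simps)
qed

lemma D_form: "semi_inner S (\<lambda>x y. a (D l x) y)"
proof
  show "a (D l x) y = a (D l y) x" if "x \<in> S" "y \<in> S" for x y
    using that D_self_adjoint a.sym[of x "D l y"] by simp
  show "0 \<le> a (D l x) x" if "x \<in> S" for x using that by (rule D_nonneg)
qed (auto simp: D_self_adjoint a.add_left a.scale_left a.subspace)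

lemma sum_abs_D:
  assumes x: "x \<in> S" and y: "y \<in> S"
  shows "(\<Sum>l<m. \<bar>a (D l x) y\<bar>) \<le> a.nrm x * a.nrm y"
proof -
  have "(\<Sum>l<m. \<bar>a (D l x) y\<bar>) \<le> (\<Sum>l<m. \<bar>sqrt (a (D l x) x)\<bar> * \<bar>sqrt (a (D l y) y)\<bar>)"
  proof (rule sum_mono)
    fix l
    interpret d: semi_inner S "\<lambda>x y. a (D l x) y" by (rule D_form)
    show "\<bar>a (D l x) y\<bar> \<le> \<bar>sqrt (a (D l x) x)\<bar> * \<bar>sqrt (a (D l y) y)\<bar>"
      using d.cauchy_schwarz[OF x y] D_nonneg x y by (simp add: d.nrm_def)
  qed
  also have "\<dots> \<le> L2_set (\<lambda>l. sqrt (a (D l x) x)) {..<m} * L2_set (\<lambda>l. sqrt (a (D l y) y)) {..<m}"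
    by (rule L2_set_mult_ineq)
  also have "\<dots> \<le> a.nrm x * a.nrm y"
    unfolding L2_set_def a.nrm_def using sum_D[OF x, of m] sum_D[OF y, of m]
    by (intro mult_mono real_sqrt_le_mono) (auto simp: D_nonneg x y a.nonneg intro!: sum_nonneg)
  finally show ?thesis .
qed

lemma nrm_le_of_bound:
  assumes "x \<in> S" "0 \<le> c" "a x x \<le> c * a.nrm x" shows "a.nrm x \<le> c"
proof (cases "a.nrm x = 0")
  case False
  then have "0 < a.nrm x" using a.nrm_nonneg[OF assms(1)] by simp
  moreover have "a.nrm x * a.nrm x \<le> c * a.nrm x"
    using assms(3) a.nrm_sq[OF assms(1)] by (simp add: power2_eq_square)
  ultimately show ?thesis by simp
qed (use assms in simp)

text \<open>Linear combinations of the \<open>D\<^sub>l\<close> with bounded coefficients are bounded uniformly in the number of terms.\<close>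

lemma nrm_sum_D:
  assumes x: "x \<in> S" and c: "\<And>l. l < m \<Longrightarrow> \<bar>c l\<bar> \<le> M" and M: "0 \<le> M"
  shows "a.nrm (\<Sum>l<m. c l *\<^sub>R D l x) \<le> M * a.nrm x"
proof -
  define y where "y = (\<Sum>l<m. c l *\<^sub>R D l x)"
  have y: "y \<in> S" using x unfolding y_def by (intro a.mem_intros) auto
  have "a y y = (\<Sum>l<m. c l * a (D l x) y)" unfolding y_def
    using x y unfolding y_def by (subst a.sum_left) auto
  also have "\<dots> \<le> (\<Sum>l<m. M * \<bar>a (D l x) y\<bar>)"
  proof (rule sum_mono)
    fix l assume "l \<in> {..<m}"
    then have "\<bar>c l\<bar> * \<bar>a (D l x) y\<bar> \<le> M * \<bar>a (D l x) y\<bar>" using c by (intro mult_right_mono) auto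
    then show "c l * a (D l x) y \<le> M * \<bar>a (D l x) y\<bar>"
      using abs_ge_self[of "c l * a (D l x) y"] by (simp add: abs_mult)
  qed
  also have "\<dots> \<le> M * (a.nrm x * a.nrm y)"
    using sum_abs_D[OF x y, of m] M by (simp add: mult_left_mono flip: sum_distrib_left)
  finally show ?thesis using nrm_le_of_bound[OF y, of "M * a.nrm x"] M x y
    by (simp add: y_def mult.assoc)
qed

text \<open>Discrete parabolic smoothing.\<close>

lemma nrm_D: assumes x: "x \<in> S" shows "a.nrm (D l x) \<le> a.nrm x / (real l + 1)"
proof -
  define y where "y = D l x"
  have y: "y \<in> S" using x y_def by simp
  interpret d: semi_inner S "\<lambda>x y. a (D l x) y" by (rule D_form)
  have s: "d.nrm z \<le> a.nrm z / sqrt (real l + 1)" if "z \<in> S" for z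
    unfolding d.nrm_def a.nrm_def real_sqrt_divide[symmetric]
    using D_le[OF that, of l] by (intro real_sqrt_le_mono) (simp add: field_simps)
  have "a y y \<le> d.nrm x * d.nrm y" using d.cauchy_schwarz[OF x y] by (simp add: y_def)
  also have "\<dots> \<le> (a.nrm x / sqrt (real l + 1)) * (a.nrm y / sqrt (real l + 1))"
    using s x y by (intro mult_mono) auto
  also have "\<dots> = (a.nrm x / (real l + 1)) * a.nrm y" by simp
  finally show ?thesis using nrm_le_of_bound[OF y, of "a.nrm x / (real l + 1)"] x by (simp add: y_def)
qed

text \<open>Smoothing measured in the weaker norm: the square of \<open>D\<^sub>l\<close> in the form \<open>p\<close> equals \<open>k D\<^bsub>2 l + 1\<^esub>\<close> in the form
  \<open>a\<close>.\<close>

lemma sum_p_D: assumes x: "x \<in> S" shows "(\<Sum>l<m. p (D l x) (D l x)) \<le> k * a x x"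
proof -
  have "p (D l x) (D l x) = k * a (D (Suc (l + l)) x) x" for l
  proof -
    have "p (D l x) (D l x) = k * a ((R ^^ Suc l) x) (D l x)" using x by (intro p_D) auto
    also have "a ((R ^^ Suc l) x) (D l x) = a ((R ^^ Suc l) x) ((R ^^ l) x) - a ((R ^^ Suc l) x) ((R ^^ Suc l) x)"
      unfolding D_def using x by (intro a.minus_right pow_mem)
    also have "\<dots> = a ((R ^^ (Suc l + l)) x) x - a ((R ^^ (Suc l + Suc l)) x) x"
      using pow_split[OF x x, of "Suc l" l] pow_split[OF x x, of "Suc l" "Suc l"] by simp
    also have "\<dots> = a (D (Suc (l + l)) x) x"
      unfolding D_def using x by (subst a.minus_left) (auto simp del: funpow.simps)
    finally show ?thesis .
  qed
  then have "(\<Sum>l<m. p (D l x) (D l x)) = k * (\<Sum>l<m. a (D (Suc (l + l)) x) x)"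
    by (simp add: sum_distrib_left)
  also have "(\<Sum>l<m. a (D (Suc (l + l)) x) x) = (\<Sum>l\<in>(\<lambda>l. Suc (l + l)) ` {..<m}. a (D l x) x)"
    by (subst sum.reindex) (auto simp: inj_on_def)
  also have "\<dots> \<le> (\<Sum>l<2*m. a (D l x) x)" using x by (intro sum_mono2) (auto simp: D_nonneg)
  also have "\<dots> \<le> a x x" by (rule sum_D[OF x])
  finally show ?thesis using k_pos by simp
qed

lemma nrm_pow: assumes x: "x \<in> S" shows "a.nrm ((R ^^ m) x) \<le> a.nrm x"
proof -
  have "a ((R ^^ m) x) ((R ^^ m) x) = a ((R ^^ (m + m)) x) x" using pow_split[OF x x, of m m] by simp
  also have "\<dots> = a x x - (\<Sum>l<m + m. a (D l x) x)" using sum_D_eq[OF x, of "m + m"] by simp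
  also have "\<dots> \<le> a x x" using x by (simp add: sum_nonneg D_nonneg)
  finally show ?thesis by (simp add: a.nrm_def)
qed

text \<open>The discrete Duhamel principle in duality form: the sources \<open>G\<^sub>j\<close> are functionals, tested with the backward
  evolution of \<open>w\<close>.\<close>

lemma duhamel:
  assumes \<theta>: "\<And>j. \<theta> j \<in> S" and w: "w \<in> S"
    and eq: "\<And>j v. 1 \<le> j \<Longrightarrow> j \<le> m \<Longrightarrow> v \<in> S \<Longrightarrow> p (\<theta> j - \<theta> (j - 1)) v + k * a (\<theta> j) v = k * G j v"
  shows "a (\<theta> m) w = a (\<theta> 0) ((R ^^ m) w) + (\<Sum>j=1..m. G j (D (m - j) w))"
proof -
  have "a (\<theta> n) ((R ^^ (m - n)) w) = a (\<theta> 0) ((R ^^ m) w) + (\<Sum>j=1..n. G j (D (m - j) w))" if "n \<le> m" for n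
    using that
  proof (induction n)
    case (Suc n)
    define l where "l = m - Suc n"
    have l: "m - n = Suc l" using Suc l_def by simp
    have "k * G (Suc n) (D l w) = p (\<theta> (Suc n) - \<theta> n) (D l w) + k * a (\<theta> (Suc n)) (D l w)"
      using eq[of "Suc n" "D l w"] Suc w by simp
    also have "p (\<theta> (Suc n) - \<theta> n) (D l w) = k * a (\<theta> (Suc n) - \<theta> n) ((R ^^ Suc l) w)"
      using p_D[of w "\<theta> (Suc n) - \<theta> n" l] \<theta>[of n] \<theta>[of "Suc n"] w
        p.sym[of "\<theta> (Suc n) - \<theta> n" "D l w"] a.sym[of "\<theta> (Suc n) - \<theta> n" "(R ^^ Suc l) w"] by simp
    also have "a (\<theta> (Suc n) - \<theta> n) ((R ^^ Suc l) w) = a (\<theta> (Suc n)) ((R ^^ Suc l) w) - a (\<theta> n) ((R ^^ Suc l) w)"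
      using \<theta> w by (intro a.minus_left pow_mem)
    also have "a (\<theta> (Suc n)) (D l w) = a (\<theta> (Suc n)) ((R ^^ l) w) - a (\<theta> (Suc n)) ((R ^^ Suc l) w)"
      unfolding D_def using \<theta> w by (intro a.minus_right pow_mem)
    finally have "k * G (Suc n) (D l w) = k * (a (\<theta> (Suc n)) ((R ^^ l) w) - a (\<theta> n) ((R ^^ Suc l) w))"
      by (simp only: algebra_simps)
    then have "G (Suc n) (D l w) = a (\<theta> (Suc n)) ((R ^^ l) w) - a (\<theta> n) ((R ^^ Suc l) w)"
      using k_pos by simp
    then show ?case using Suc by (simp add: l l_def del: funpow.simps)
  qed simp
  from this[of m] show ?thesis by simp
qed

end

text \<open>The resolvent is built from an orthonormal system of \<open>p + k a\<close>.\<close>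

lemma resolvent_exists:
  assumes p: "semi_inner S p" and a: "semi_inner S a" and S: "S = span B" "finite B" and k: "0 < k"
  shows "\<exists>R. resolvent S p a k R"
proof -
  interpret p: semi_inner S p by fact
  interpret a: semi_inner S a by fact
  interpret b: semi_inner S "\<lambda>x y. p x y + k * a x y"
  proof
    show "p x y + k * a x y = p y x + k * a y x" if "x \<in> S" "y \<in> S" for x y
      using that p.sym[of x y] a.sym[of x y] by simp
  qed (use k in \<open>auto simp: p.subspace p.nonneg a.nonneg p.add_left a.add_left
      p.scale_left a.scale_left algebra_simps\<close>)
  obtain E where E: "finite E" "E \<subseteq> S"
      "\<And>e e'. e \<in> E \<Longrightarrow> e' \<in> E \<Longrightarrow> p e e' + k * a e e' = (if e = e' then 1 else 0)"
      "\<And>x. x \<in> S \<Longrightarrow> b.nrm (x - (\<Sum>e\<in>E. (p x e + k * a x e) *\<^sub>R e)) = 0"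
    by (rule b.orthonormal_basis[OF S]) (rule that)
  define R where "R x = (\<Sum>e\<in>E. p x e *\<^sub>R e)" for x
  have RS: "R x \<in> S" if "x \<in> S" for x unfolding R_def using E(2) that by (intro p.mem_intros) auto
  have "p (R x) v + k * a (R x) v = p x v" if x: "x \<in> S" and v: "v \<in> S" for x v
  proof -
    define y where "y = (\<Sum>e\<in>E. (p v e + k * a v e) *\<^sub>R e)"
    have yS: "y \<in> S" unfolding y_def using E(2) by (intro p.mem_intros) auto
    have "p (v - y) (v - y) + k * a (v - y) (v - y) = 0"
      using E(4)[OF v] b.nrm_sq[of "v - y"] v yS by (auto simp: y_def)
    moreover have "0 \<le> p (v - y) (v - y)" "0 \<le> k * a (v - y) (v - y)"
      using p.nonneg[of "v - y"] a.nonneg[of "v - y"] v yS k by auto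
    ultimately have "p (v - y) (v - y) = 0" by linarith
    then have "p (v - y) x = 0" using p.null_left v yS x by auto
    then have "p x v = p x y" using v yS x p.sym[of x v] p.sym[of x y] by (simp add: p.minus_left)
    also have "\<dots> = (\<Sum>e\<in>E. (p v e + k * a v e) * p x e)"
      unfolding y_def using E(2) x by (intro p.sum_right) auto
    also have "\<dots> = (\<Sum>e\<in>E. p x e * (p e v + k * a e v))"
      using E(2) v p.sym a.sym by (intro sum.cong) (auto simp: subset_iff)
    also have "\<dots> = p (R x) v + k * a (R x) v"
      unfolding R_def using E(2) v b.sum_left[of E "\<lambda>e. e" v "p x"] by (simp add: subset_iff)
    finally show ?thesis by simp
  qed
  then show ?thesis using k RS by (intro exI[of _ R]) (unfold_locales; simp)
qed

section \<open>Uniqueness of weak derivatives\<close>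

text \<open>For \<open>m = 0\<close> this is the standard smooth function that is flat at the origin; the derivative of a
  member of the family is a linear combination of members.\<close>

definition flat_exp :: "nat \<Rightarrow> real \<Rightarrow> real" where
  "flat_exp m s = (if s > 0 then exp (- (1 / s)) / s ^ m else 0)"

lemma power_le_exp: assumes "(0::real) \<le> y" shows "y ^ n / fact n \<le> exp y"
proof -
  have "(\<Sum>i\<in>{n}. inverse (fact i) *\<^sub>R y ^ i) \<le> (\<Sum>i. inverse (fact i) *\<^sub>R y ^ i)"
    by (rule sum_le_suminf[OF summable_exp_generic]) (use assms in auto)
  then show ?thesis by (simp add: exp_def field_simps)
qed

lemma flat_exp_le: "\<bar>flat_exp m s\<bar> \<le> fact (m + 2) * s\<^sup>2"
proof (cases "s > 0")
  case True
  define F :: real where "F = fact (m + 2)"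
  have F: "F > 0" by (simp add: F_def del: fact_Suc)
  have "(1 / s) ^ (m + 2) / F \<le> exp (1 / s)" unfolding F_def using True by (intro power_le_exp) auto
  then have "exp (- (1 / s)) \<le> F * s ^ (m + 2)"
    using True F by (simp add: exp_minus power_divide field_simps)
  then have "exp (- (1 / s)) \<le> fact (m + 2) * s ^ (m + 2)" by (simp only: F_def)
  then have "exp (- (1 / s)) / s ^ m \<le> fact (m + 2) * s ^ (m + 2) / s ^ m"
    using True by (intro divide_right_mono) auto
  also have "\<dots> = fact (m + 2) * s\<^sup>2" using True by (simp add: power_add power2_eq_square)
  finally show ?thesis using True by (simp add: flat_exp_def)
qed (simp add: flat_exp_def)

lemma flat_exp_deriv:
  "(flat_exp m has_real_derivative flat_exp (m + 2) s - real m * flat_exp (m + 1) s) (at s)"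
proof -
  consider "s > 0" | "s < 0" | "s = 0" by linarith
  then show ?thesis
  proof cases
    case 1
    have "((\<lambda>s. exp (- (1 / s)) / s ^ m) has_real_derivative
        (exp (- (1 / s)) * (1 / s\<^sup>2) * s ^ m - exp (- (1 / s)) * (real m * s ^ (m - 1))) / (s ^ m * s ^ m)) (at s)"
      using 1 by (auto intro!: derivative_eq_intros simp: power2_eq_square)
    moreover have "(exp (- (1 / s)) * (1 / s\<^sup>2) * s ^ m - exp (- (1 / s)) * (real m * s ^ (m - 1))) / (s ^ m * s ^ m)
        = flat_exp (m + 2) s - real m * flat_exp (m + 1) s"
      using 1 by (cases m) (simp_all add: flat_exp_def field_simps power2_eq_square)
    ultimately have "((\<lambda>s. exp (- (1 / s)) / s ^ m) has_real_derivative
        flat_exp (m + 2) s - real m * flat_exp (m + 1) s) (at s)" by simp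
    then show ?thesis
      by (rule has_field_derivative_transform_within_open[where S = "{0<..}"]) (use 1 in \<open>auto simp: flat_exp_def\<close>)
  next
    case 2
    have "((\<lambda>s. 0) has_real_derivative 0) (at s)" by simp
    then have "(flat_exp m has_real_derivative 0) (at s)"
      by (rule has_field_derivative_transform_within_open[where S = "{..<0}"]) (use 2 in \<open>auto simp: flat_exp_def\<close>)
    then show ?thesis using 2 by (simp add: flat_exp_def)
  next
    case 3
    have "((\<lambda>h. flat_exp m h / h) \<longlongrightarrow> 0) (at 0)"
    proof (rule Lim_null_comparison)
      show "\<forall>\<^sub>F h in at 0. norm (flat_exp m h / h) \<le> fact (m + 2) * \<bar>h\<bar>"
      proof (rule eventually_at_topological[THEN iffD2], intro exI[of _ UNIV] conjI ballI impI)
        fix h :: real assume "h \<noteq> 0"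
        have "\<bar>flat_exp m h\<bar> \<le> (fact (m + 2) * \<bar>h\<bar>) * \<bar>h\<bar>"
          using flat_exp_le[of m h] by (simp only: power2_eq_square abs_mult_self_eq mult.assoc)
        then show "norm (flat_exp m h / h) \<le> fact (m + 2) * \<bar>h\<bar>"
          using \<open>h \<noteq> 0\<close> by (simp only: real_norm_def abs_divide) (simp add: pos_divide_le_eq del: fact_Suc)
      qed auto
      show "((\<lambda>h::real. fact (m + 2) * \<bar>h\<bar>) \<longlongrightarrow> 0) (at 0)"
        by (intro tendsto_mult_right_zero tendsto_rabs_zero tendsto_ident_at)
    qed
    then show ?thesis using 3 by (simp add: flat_exp_def DERIV_def)
  qed
qed

text \<open>The linear span of products of two flat functions which, for \<open>c > 0\<close>, vanish to the left of \<open>a\<close> and to the right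
  of \<open>b\<close>.  It contains the bump functions on \<open>[a, b]\<close> and is closed under differentiation.\<close>

inductive_set bump_class :: "real \<Rightarrow> real \<Rightarrow> real \<Rightarrow> (real \<Rightarrow> real) set" for c a b where
  base: "(\<lambda>s. flat_exp m (c * (s - a)) * flat_exp l (c * (b - s))) \<in> bump_class c a b"
| add: "f \<in> bump_class c a b \<Longrightarrow> g \<in> bump_class c a b \<Longrightarrow> (\<lambda>s. f s + g s) \<in> bump_class c a b"
| scale: "f \<in> bump_class c a b \<Longrightarrow> (\<lambda>s. d * f s) \<in> bump_class c a b"

lemma bump_class_deriv:
  "f \<in> bump_class c a b \<Longrightarrow> \<exists>f'\<in>bump_class c a b. \<forall>s. (f has_real_derivative f' s) (at s)"
proof (induction rule: bump_class.induct)
  case (base m l)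
  define B where "B m l s = flat_exp m (c * (s - a)) * flat_exp l (c * (b - s))" for m l s
  define f' where "f' s = (c * B (m + 2) l s + (- c * real m) * B (m + 1) l s)
      + ((- c) * B m (l + 2) s + (c * real l) * B m (l + 1) s)" for s
  have "B m l \<in> bump_class c a b" for m l unfolding B_def by (rule bump_class.base)
  then have "f' \<in> bump_class c a b" unfolding f'_def by (intro bump_class.intros) auto
  moreover have "((\<lambda>s. flat_exp m (c * (s - a)) * flat_exp l (c * (b - s))) has_real_derivative f' s) (at s)" for s
  proof -
    have "((\<lambda>s. flat_exp m (c * (s - a))) has_real_derivative
        (flat_exp (m + 2) (c * (s - a)) - real m * flat_exp (m + 1) (c * (s - a))) * c) (at s)"
      by (rule DERIV_chain2[OF flat_exp_deriv]) (auto intro!: derivative_eq_intros)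
    moreover have "((\<lambda>s. flat_exp l (c * (b - s))) has_real_derivative
        (flat_exp (l + 2) (c * (b - s)) - real l * flat_exp (l + 1) (c * (b - s))) * (- c)) (at s)"
      by (rule DERIV_chain2[OF flat_exp_deriv]) (auto intro!: derivative_eq_intros)
    ultimately show ?thesis
      by (rule DERIV_mult[THEN DERIV_cong]) (simp add: f'_def B_def algebra_simps)
  qed
  ultimately show ?case by blast
next
  case (add f g)
  then obtain f' g' where *: "f' \<in> bump_class c a b" "g' \<in> bump_class c a b"
      "\<forall>s. (f has_real_derivative f' s) (at s)" "\<forall>s. (g has_real_derivative g' s) (at s)" by blast
  have "((\<lambda>s. f s + g s) has_real_derivative f' s + g' s) (at s)" for s
    using * by (intro DERIV_add) auto
  moreover have "(\<lambda>s. f' s + g' s) \<in> bump_class c a b" using * by (intro bump_class.add)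
  ultimately show ?case by (intro bexI[of _ "\<lambda>s. f' s + g' s"]) auto
next
  case (scale f d)
  then obtain f' where *: "f' \<in> bump_class c a b" "\<forall>s. (f has_real_derivative f' s) (at s)" by blast
  have "((\<lambda>s. d * f s) has_real_derivative d * f' s) (at s)" for s
    using * by (intro DERIV_cmult) auto
  moreover have "(\<lambda>s. d * f' s) \<in> bump_class c a b" using * by (intro bump_class.scale)
  ultimately show ?case by (intro bexI[of _ "\<lambda>s. d * f' s"]) auto
qed

text \<open>A class of differentiable functions that is closed under partial derivatives consists of smooth
  functions.\<close>

lemma iter_deriv_class:
  assumes cl: "\<And>f b. f \<in> \<C> \<Longrightarrow> b \<in> Basis \<Longrightarrow> f differentiable_on UNIV \<and> (\<lambda>x. frechet_derivative f (at x) b) \<in> \<C>"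
    and f: "f \<in> \<C>"
  shows "smooth_open UNIV (f :: 'a::euclidean_space \<Rightarrow> real)"
proof -
  have "iter_deriv bs f \<in> \<C>" if "set bs \<subseteq> Basis" for bs
    using that by (induction bs) (use cl f in auto)
  moreover have "g differentiable_on UNIV" if "g \<in> \<C>" for g
    using cl[OF that] nonempty_Basis by blast
  ultimately show ?thesis by (auto simp: smooth_open_def)
qed

text \<open>Tensor products of the one-dimensional functions, over the coordinates.\<close>

definition bump_prods :: "real \<Rightarrow> 'a::euclidean_space \<Rightarrow> 'a \<Rightarrow> ('a \<Rightarrow> real) set" where
  "bump_prods c a b = {\<lambda>x. \<Prod>i\<in>Basis. p i (x \<bullet> i) |p. \<forall>i\<in>Basis. p i \<in> bump_class c (a \<bullet> i) (b \<bullet> i)}"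

lemma bump_prods_deriv:
  fixes a b :: "'a::euclidean_space"
  assumes f: "f \<in> bump_prods c a b" and j: "j \<in> Basis"
  shows "f differentiable_on UNIV \<and> (\<lambda>x. frechet_derivative f (at x) j) \<in> bump_prods c a b"
proof -
  obtain p where p: "f = (\<lambda>x. \<Prod>i\<in>Basis. p i (x \<bullet> i))" "\<And>i. i \<in> Basis \<Longrightarrow> p i \<in> bump_class c (a \<bullet> i) (b \<bullet> i)"
    using f by (auto simp: bump_prods_def)
  have "\<forall>i\<in>Basis. \<exists>p'. p' \<in> bump_class c (a \<bullet> i) (b \<bullet> i) \<and> (\<forall>s. (p i has_real_derivative p' s) (at s))"
    using bump_class_deriv p(2) by blast
  then obtain p' where p': "\<And>i. i \<in> Basis \<Longrightarrow> p' i \<in> bump_class c (a \<bullet> i) (b \<bullet> i)"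
      "\<And>i s. i \<in> Basis \<Longrightarrow> (p i has_real_derivative p' i s) (at s)" by (metis (no_types))
  have d: "(f has_derivative (\<lambda>h. \<Sum>i\<in>Basis. ((h \<bullet> i) * p' i (x \<bullet> i)) * (\<Prod>l\<in>Basis - {i}. p l (x \<bullet> l)))) (at x)" for x
    unfolding p(1)
  proof (rule has_derivative_prod)
    fix i :: 'a assume i: "i \<in> Basis"
    have "((\<lambda>x. x \<bullet> i) has_derivative (\<lambda>h. h \<bullet> i)) (at x)" by (intro derivative_intros)
    from has_derivative_compose[OF this, of "p i" "(*) (p' i (x \<bullet> i))"]
    show "((\<lambda>x. p i (x \<bullet> i)) has_derivative (\<lambda>h. (h \<bullet> i) * p' i (x \<bullet> i))) (at x)"
      using p'(2)[OF i, of "x \<bullet> i"] by (simp add: has_field_derivative_def mult.commute)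
  qed
  have "frechet_derivative f (at x) j = (\<Prod>i\<in>Basis. (p(j := p' j)) i (x \<bullet> i))" for x
  proof -
    have "frechet_derivative f (at x) j = (\<Sum>i\<in>Basis. ((j \<bullet> i) * p' i (x \<bullet> i)) * (\<Prod>l\<in>Basis - {i}. p l (x \<bullet> l)))"
      using frechet_derivative_at[OF d[of x]] by (metis (no_types, lifting))
    also have "\<dots> = (\<Sum>i\<in>Basis. if i = j then p' j (x \<bullet> j) * (\<Prod>l\<in>Basis - {j}. p l (x \<bullet> l)) else 0)"
      using j by (intro sum.cong) (auto simp: inner_Basis)
    also have "\<dots> = p' j (x \<bullet> j) * (\<Prod>l\<in>Basis - {j}. p l (x \<bullet> l))" using j by simp
    also have "\<dots> = (p(j := p' j)) j (x \<bullet> j) * (\<Prod>l\<in>Basis - {j}. (p(j := p' j)) l (x \<bullet> l))"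
      by (intro arg_cong2[where f = "(*)"] prod.cong) auto
    also have "\<dots> = (\<Prod>i\<in>Basis. (p(j := p' j)) i (x \<bullet> i))"
      using j by (subst prod.remove[of Basis j]) auto
    finally show ?thesis .
  qed
  then have "(\<lambda>x. frechet_derivative f (at x) j) = (\<lambda>x. \<Prod>i\<in>Basis. (p(j := p' j)) i (x \<bullet> i))" by (rule ext)
  moreover have "\<dots> \<in> bump_prods c a b"
    unfolding bump_prods_def using p(2) p'(1) by (intro CollectI exI[of _ "p(j := p' j)"]) auto
  moreover have "f differentiable_on UNIV"
    unfolding differentiable_on_def differentiable_def using d by blast
  ultimately show ?thesis by metis
qed

text \<open>Test functions that converge boundedly to the indicator function of the box from \<open>a\<close> to \<open>b\<close>.\<close>

definition bump :: "nat \<Rightarrow> 'a::euclidean_space \<Rightarrow> 'a \<Rightarrow> 'a \<Rightarrow> real" where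
  "bump n a b x = (\<Prod>i\<in>Basis. flat_exp 0 (real n * (x \<bullet> i - a \<bullet> i)) * flat_exp 0 (real n * (b \<bullet> i - x \<bullet> i)))"

lemma flat_exp_bounds: "0 \<le> flat_exp 0 s" "flat_exp 0 s \<le> 1"
  by (auto simp: flat_exp_def)

lemma bump_bounds: "0 \<le> bump n a b x" "bump n a b x \<le> 1"
  unfolding bump_def by (auto intro!: prod_nonneg prod_le_1 mult_nonneg_nonneg mult_le_one flat_exp_bounds)

lemma bump_outside: assumes "x \<notin> box a b" shows "bump n a b x = 0"
proof -
  obtain i where i: "i \<in> Basis" "\<not> (a \<bullet> i < x \<bullet> i \<and> x \<bullet> i < b \<bullet> i)" using assms by (auto simp: box_def)
  have "flat_exp 0 (real n * s) = 0" if "s \<le> 0" for s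
    using that by (auto simp: flat_exp_def zero_less_mult_iff)
  then have "flat_exp 0 (real n * (x \<bullet> i - a \<bullet> i)) * flat_exp 0 (real n * (b \<bullet> i - x \<bullet> i)) = 0"
    using i(2) by (metis diff_ge_0_iff_ge diff_le_0_iff_le mult_eq_0_iff not_less)
  then show ?thesis unfolding bump_def using i(1) by (intro prod_zero) auto
qed

lemma bump_tendsto: "(\<lambda>n. bump n a b x) \<longlonglongrightarrow> indicator (box a b) x"
proof (cases "x \<in> box a b")
  case True
  have lim: "(\<lambda>n. flat_exp 0 (real n * s)) \<longlonglongrightarrow> 1" if "s > 0" for s
  proof -
    have "filterlim (\<lambda>n. real n * s) at_top sequentially"
      using that by (intro filterlim_at_top_mult_tendsto_pos[OF tendsto_const]) (auto simp: mult.commute filterlim_real_sequentially intro: filterlim_tendsto_pos_mult_at_top[OF tendsto_const])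
    then have "(\<lambda>n. exp (- (1 / (real n * s)))) \<longlonglongrightarrow> exp (- 0)"
      by (intro tendsto_exp tendsto_minus tendsto_divide_0[OF tendsto_const] filterlim_at_top_imp_at_infinity)
    moreover have "\<forall>\<^sub>F n in sequentially. exp (- (1 / (real n * s))) = flat_exp 0 (real n * s)"
      using eventually_gt_at_top[of "0::nat"]
    proof eventually_elim
      case (elim n)
      then show ?case using that by (simp add: flat_exp_def)
    qed
    ultimately show ?thesis using Lim_transform_eventually by force
  qed
  have "(\<lambda>n. bump n a b x) \<longlonglongrightarrow> (\<Prod>i\<in>(Basis::'a set). 1 * 1)"
    unfolding bump_def using True by (intro tendsto_prod tendsto_mult lim) (auto simp: box_def)
  then show ?thesis using True by simp
next
  case False
  then show ?thesis by (simp add: bump_outside)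
qed

lemma bump_test_fun:
  assumes "cbox a b \<subseteq> \<Omega>" shows "bump n a b \<in> test_fun \<Omega>"
proof -
  have "bump n a b = (\<lambda>x. \<Prod>i\<in>Basis. (\<lambda>i s. flat_exp 0 (real n * (s - a \<bullet> i)) * flat_exp 0 (real n * (b \<bullet> i - s))) i (x \<bullet> i))"
    by (rule ext) (simp add: bump_def)
  then have "bump n a b \<in> bump_prods (real n) a b"
    unfolding bump_prods_def using bump_class.base[of 0 "real n" _ 0]
    by (intro CollectI exI conjI ballI) (assumption | simp)+
  then have "smooth_open UNIV (bump n a b)" using iter_deriv_class bump_prods_deriv by metis
  moreover have sub: "closure {x. bump n a b x \<noteq> 0} \<subseteq> cbox a b"
    using bump_outside[of _ a b n] box_subset_cbox by (intro closure_minimal) (auto simp: subset_iff)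
  moreover have "compact (closure {x. bump n a b x \<noteq> 0})"
    using bounded_subset[OF bounded_cbox sub] by (simp add: compact_eq_bounded_closed)
  ultimately show ?thesis using assms by (auto simp: test_fun_def)
qed

section \<open>The space of square integrable functions\<close>

text \<open>The pointwise vector space structure on functions.\<close>

instantiation "fun" :: (type, real_vector) real_vector
begin
definition scaleR_fun :: "real \<Rightarrow> ('a \<Rightarrow> 'b) \<Rightarrow> 'a \<Rightarrow> 'b" where
  "scaleR_fun c f = (\<lambda>x. c *\<^sub>R f x)"
instance
  by standard (auto simp: scaleR_fun_def fun_eq_iff algebra_simps)
end

lemmas fun_ops = plus_fun_def fun_diff_def scaleR_fun_def zero_fun_def

text \<open>Square integrability of scalar or vector valued functions; in the scalar case this is membership in
  the space of square integrable functions.\<close>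

definition sqint :: "'a::euclidean_space set \<Rightarrow> ('a \<Rightarrow> 'b::euclidean_space) \<Rightarrow> bool" where
  "sqint \<Omega> F \<longleftrightarrow> F \<in> borel_measurable (lebesgue_on \<Omega>) \<and>
     integrable (lebesgue_on \<Omega>) (\<lambda>x. (norm (F x))\<^sup>2)"

lemma L2_space_sqint: "f \<in> L2_space \<Omega> \<longleftrightarrow> sqint \<Omega> f"
  by (simp add: L2_space_def sqint_def)

lemma sqint_bound:
  fixes F :: "'a::euclidean_space \<Rightarrow> 'b::euclidean_space" and G :: "'a \<Rightarrow> 'c::euclidean_space"
  assumes F: "F \<in> borel_measurable (lebesgue_on \<Omega>)" and G: "sqint \<Omega> G"
    and le: "AE x in lebesgue_on \<Omega>. norm (F x) \<le> c * norm (G x)"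
  shows "sqint \<Omega> F"
  unfolding sqint_def
proof
  show "integrable (lebesgue_on \<Omega>) (\<lambda>x. (norm (F x))\<^sup>2)"
  proof (rule Bochner_Integration.integrable_bound)
    show "integrable (lebesgue_on \<Omega>) (\<lambda>x. c\<^sup>2 * (norm (G x))\<^sup>2)" using G by (simp add: sqint_def)
    show "AE x in lebesgue_on \<Omega>. norm ((norm (F x))\<^sup>2) \<le> norm (c\<^sup>2 * (norm (G x))\<^sup>2)"
      using le
    proof eventually_elim
      case (elim x)
      then have "(norm (F x))\<^sup>2 \<le> (c * norm (G x))\<^sup>2" by (intro power_mono) auto
      then show ?case by (simp add: power_mult_distrib)
    qed
  qed (use F in simp)
qed fact

lemma sqint_inner_integrable:
  assumes "sqint \<Omega> F" "sqint \<Omega> G" shows "integrable (lebesgue_on \<Omega>) (\<lambda>x. F x \<bullet> G x)"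
proof (rule Bochner_Integration.integrable_bound)
  show "integrable (lebesgue_on \<Omega>) (\<lambda>x. (norm (F x))\<^sup>2 + (norm (G x))\<^sup>2)"
    using assms by (auto simp: sqint_def)
  show "(\<lambda>x. F x \<bullet> G x) \<in> borel_measurable (lebesgue_on \<Omega>)"
    using assms by (auto simp: sqint_def)
  have "\<bar>F x \<bullet> G x\<bar> \<le> (norm (F x))\<^sup>2 + (norm (G x))\<^sup>2" for x
  proof -
    have "\<bar>F x \<bullet> G x\<bar> \<le> norm (F x) * norm (G x)" by (rule Cauchy_Schwarz_ineq2)
    moreover have "2 * (norm (F x) * norm (G x)) \<le> (norm (F x))\<^sup>2 + (norm (G x))\<^sup>2"
      using sum_squares_bound[of "norm (F x)" "norm (G x)"] by (simp add: mult.assoc)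
    moreover have "0 \<le> norm (F x) * norm (G x)" by simp
    ultimately show ?thesis by linarith
  qed
  then show "AE x in lebesgue_on \<Omega>. norm (F x \<bullet> G x) \<le> norm ((norm (F x))\<^sup>2 + (norm (G x))\<^sup>2)" by simp
qed

lemma sqint_add: assumes "sqint \<Omega> F" "sqint \<Omega> G" shows "sqint \<Omega> (\<lambda>x. F x + G x)"
  unfolding sqint_def
proof
  show "(\<lambda>x. F x + G x) \<in> borel_measurable (lebesgue_on \<Omega>)" using assms by (auto simp: sqint_def)
  have "(\<lambda>x. (norm (F x + G x))\<^sup>2) = (\<lambda>x. (norm (F x))\<^sup>2 + (norm (G x))\<^sup>2 + 2 * (F x \<bullet> G x))"
    by (auto simp: power2_norm_eq_inner inner_add inner_commute)
  then show "integrable (lebesgue_on \<Omega>) (\<lambda>x. (norm (F x + G x))\<^sup>2)"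
    using assms sqint_inner_integrable[OF assms] by (auto simp: sqint_def)
qed

lemma sqint_scale: assumes "sqint \<Omega> F" shows "sqint \<Omega> (\<lambda>x. c *\<^sub>R F x)"
  using assms by (auto simp: sqint_def power_mult_distrib)

lemma sqint_zero: "sqint \<Omega> (\<lambda>x. 0)" by (simp add: sqint_def)

lemma sqint_diff: assumes "sqint \<Omega> F" "sqint \<Omega> G" shows "sqint \<Omega> (\<lambda>x. F x - G x)"
  using sqint_add[OF assms(1) sqint_scale[OF assms(2), of "-1"]] by simp

lemma semi_inner_L2: "semi_inner {F. sqint \<Omega> F} (L2_inner \<Omega>)"
proof
  show "subspace {F. sqint \<Omega> F}"
    unfolding subspace_def using sqint_zero sqint_add sqint_scale by (auto simp: fun_ops)
next
  fix x y z :: "'a \<Rightarrow> 'b" and c :: real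
  assume x: "x \<in> {F. sqint \<Omega> F}"
  show "0 \<le> L2_inner \<Omega> x x" by (simp add: L2_inner_def)
  assume z: "z \<in> {F. sqint \<Omega> F}"
  then show "L2_inner \<Omega> x z = L2_inner \<Omega> z x" by (simp add: L2_inner_def inner_commute)
  show "L2_inner \<Omega> (c *\<^sub>R x) z = c * L2_inner \<Omega> x z" by (simp add: L2_inner_def fun_ops)
  assume y: "y \<in> {F. sqint \<Omega> F}"
  show "L2_inner \<Omega> (x + y) z = L2_inner \<Omega> x z + L2_inner \<Omega> y z"
    using sqint_inner_integrable[of \<Omega> x z] sqint_inner_integrable[of \<Omega> y z] x y z
    by (simp add: L2_inner_def fun_ops inner_add)
qed

interpretation L2: semi_inner "{F :: 'a::euclidean_space \<Rightarrow> 'b::euclidean_space. sqint \<Omega> F}" "L2_inner \<Omega>"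
  for \<Omega> by (rule semi_inner_L2)

lemma L2_nrm: "L2.nrm \<Omega> F = L2_norm \<Omega> F"
  by (simp add: L2.nrm_def L2_norm_def)

lemma L2_norm_nonneg [simp]: "0 \<le> L2_norm \<Omega> F"
  by (simp add: L2_norm_def L2_inner_def)

lemma L2_norm_sq: "(L2_norm \<Omega> F)\<^sup>2 = L2_inner \<Omega> F F"
  by (simp add: L2_norm_def L2_inner_def)

lemma L2_cauchy_schwarz: "sqint \<Omega> F \<Longrightarrow> sqint \<Omega> G \<Longrightarrow> \<bar>L2_inner \<Omega> F G\<bar> \<le> L2_norm \<Omega> F * L2_norm \<Omega> G"
  using L2.cauchy_schwarz[of F \<Omega> G] by (simp add: L2_nrm)

lemma L2_inner_cong_AE:
  assumes "sqint \<Omega> F" "sqint \<Omega> F'" "sqint \<Omega> G" "sqint \<Omega> G'"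
    "AE x in lebesgue_on \<Omega>. F x = F' x" "AE x in lebesgue_on \<Omega>. G x = G' x"
  shows "L2_inner \<Omega> F G = L2_inner \<Omega> F' G'"
  unfolding L2_inner_def
proof (rule integral_cong_AE)
  show "AE x in lebesgue_on \<Omega>. F x \<bullet> G x = F' x \<bullet> G' x" using assms(5,6) by eventually_elim simp
qed (use assms in \<open>auto simp: sqint_def\<close>)

lemma L2_norm_cong_AE:
  assumes "sqint \<Omega> F" "sqint \<Omega> F'" "AE x in lebesgue_on \<Omega>. F x = F' x"
  shows "L2_norm \<Omega> F = L2_norm \<Omega> F'"
  unfolding L2_norm_def using L2_inner_cong_AE[of \<Omega> F F' F F'] assms by simp

lemma L2_norm_le:
  fixes F :: "'a::euclidean_space \<Rightarrow> 'b::euclidean_space" and G :: "'a \<Rightarrow> 'c::euclidean_space"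
  assumes F: "sqint \<Omega> F" and G: "sqint \<Omega> G" and c: "0 \<le> c"
    and le: "AE x in lebesgue_on \<Omega>. norm (F x) \<le> c * norm (G x)"
  shows "L2_norm \<Omega> F \<le> c * L2_norm \<Omega> G"
proof -
  have "L2_inner \<Omega> F F \<le> (LINT x|lebesgue_on \<Omega>. c\<^sup>2 * (G x \<bullet> G x))"
    unfolding L2_inner_def
  proof (rule integral_mono_AE)
    show "AE x in lebesgue_on \<Omega>. F x \<bullet> F x \<le> c\<^sup>2 * (G x \<bullet> G x)"
      using le
    proof eventually_elim
      case (elim x)
      then have "(norm (F x))\<^sup>2 \<le> (c * norm (G x))\<^sup>2" by (intro power_mono) auto
      then show ?case by (simp add: power_mult_distrib power2_norm_eq_inner)
    qed
  qed (use sqint_inner_integrable F G in auto)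
  also have "\<dots> = c\<^sup>2 * L2_inner \<Omega> G G" by (simp add: L2_inner_def)
  finally have "L2_norm \<Omega> F \<le> sqrt (c\<^sup>2 * L2_inner \<Omega> G G)"
    unfolding L2_norm_def by (rule real_sqrt_le_mono)
  then show ?thesis using c by (simp add: real_sqrt_mult L2_norm_def)
qed

lemma finite_lebesgue_on: assumes "bounded \<Omega>" "open \<Omega>" shows "finite_measure (lebesgue_on \<Omega>)"
proof
  have "\<Omega> \<in> lmeasurable" using assms by (intro lmeasurable_open)
  then have "\<Omega> \<in> sets lebesgue" "emeasure lebesgue \<Omega> \<noteq> \<infinity>"
    using fmeasurableD2[of \<Omega> lebesgue] by (auto simp del: emeasure_completion)
  then show "emeasure (lebesgue_on \<Omega>) (space (lebesgue_on \<Omega>)) \<noteq> \<infinity>"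
    by (simp add: emeasure_restrict_space del: emeasure_completion)
qed

lemma sqint_bounded:
  fixes F :: "'a::euclidean_space \<Rightarrow> 'b::euclidean_space"
  assumes \<Omega>: "bounded \<Omega>" "open \<Omega>" and F: "F \<in> borel_measurable (lebesgue_on \<Omega>)"
    and le: "AE x in lebesgue_on \<Omega>. norm (F x) \<le> c"
  shows "sqint \<Omega> F"
proof (rule sqint_bound[OF F, of "\<lambda>x. 1::real" c])
  interpret finite_measure "lebesgue_on \<Omega>" using finite_lebesgue_on \<Omega> by blast
  show "sqint \<Omega> (\<lambda>x. 1::real)" by (simp add: sqint_def)
qed (use le in simp)

text \<open>Boxes are a generator of the Borel sets that is stable under intersections, and a Lebesgue set differs
  from a Borel set by a null set.\<close>

lemma borel_integral_zero:
  fixes f :: "'a::euclidean_space \<Rightarrow> real"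
  assumes f: "integrable lebesgue f" and 0: "\<And>a b. (LINT x|lebesgue. indicator (box a b) x * f x) = 0"
  shows "AE x in lebesgue. f x = 0"
proof -
  have [measurable]: "f \<in> borel_measurable lebesgue" using f by auto
  have int: "integrable lebesgue (\<lambda>x. indicator A x * f x)" if "A \<in> sets lebesgue" for A
    using integrable_mult_indicator[OF that f] by simp
  have UN: "(LINT x|lebesgue. indicator (\<Union>i. A i) x * f x) = 0"
    if A: "\<And>i::nat. A i \<in> sets lebesgue" and lim: "incseq A"
      and z: "\<And>i. (LINT x|lebesgue. indicator (A i) x * f x) = 0" for A
  proof -
    have "(\<lambda>i. LINT x|lebesgue. indicator (A i) x * f x) \<longlonglongrightarrow> (LINT x|lebesgue. indicator (\<Union>i. A i) x * f x)"
    proof (rule integral_dominated_convergence[where w = "\<lambda>x. \<bar>f x\<bar>"])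
      show "AE x in lebesgue. (\<lambda>i. indicator (A i) x * f x) \<longlonglongrightarrow> indicator (\<Union>i. A i) x * f x"
        by (intro AE_I2 tendsto_mult_right LIMSEQ_indicator_incseq lim)
      show "AE x in lebesgue. norm (indicator (A i) x * f x) \<le> \<bar>f x\<bar>" for i
        by (intro AE_I2) (auto simp: indicator_def)
    qed (use f A in auto)
    then have "(\<lambda>i::nat. 0::real) \<longlonglongrightarrow> (LINT x|lebesgue. indicator (\<Union>i. A i) x * f x)"
      by (simp only: z)
    then show ?thesis by (simp add: LIMSEQ_const_iff)
  qed
  have tot: "(LINT x|lebesgue. f x) = 0"
  proof -
    have "(\<Union>i::nat. box (- (real i *\<^sub>R One)) (real i *\<^sub>R One)) = (UNIV :: 'a set)"
      by (rule UN_box_eq_UNIV)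
    moreover have "incseq (\<lambda>i::nat. box (- (real i *\<^sub>R One)) (real i *\<^sub>R One) :: 'a set)"
      by (intro incseq_SucI) (auto simp: subset_box)
    ultimately show ?thesis using UN[of "\<lambda>i. box (- (real i *\<^sub>R One)) (real i *\<^sub>R One)"] 0 by simp
  qed
  have borel: "(LINT x|lebesgue. indicator A x * f x) = 0" if A: "A \<in> sets borel" for A
  proof -
    have bl: "B \<in> sets lebesgue" if "B \<in> sigma_sets UNIV (range (\<lambda>(a, b). box a b))" for B :: "'a set"
    proof -
      have "B \<in> sets borel" using that by (simp add: borel_eq_box)
      then show ?thesis by simp
    qed
    have st: "Int_stable (range (\<lambda>(a, b). box a b) :: 'a set set)"
      by (auto simp: Int_stable_def box_Int_box)
    have A': "A \<in> sigma_sets UNIV (range (\<lambda>(a, b). box a b))" using A by (simp add: borel_eq_box)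
    show ?thesis
    proof (rule sigma_sets_induct_disjoint[OF st _ A', where P = "\<lambda>A. (LINT x|lebesgue. indicator A x * f x) = 0"])
      fix B :: "'a set" assume "B \<in> range (\<lambda>(a, b). box a b)"
      then obtain a b where "B = box a b" by auto
      then show "(LINT x|lebesgue. indicator B x * f x) = 0" using 0 by simp
    next
      fix B :: "'a set" assume B: "B \<in> sigma_sets UNIV (range (\<lambda>(a, b). box a b))"
        and IH: "(LINT x|lebesgue. indicator B x * f x) = 0"
      have "(LINT x|lebesgue. indicator (UNIV - B) x * f x) = (LINT x|lebesgue. f x - indicator B x * f x)"
        by (intro Bochner_Integration.integral_cong) (auto simp: indicator_def)
      also have "\<dots> = (LINT x|lebesgue. f x) - (LINT x|lebesgue. indicator B x * f x)"
        by (rule Bochner_Integration.integral_diff[OF f int[OF bl[OF B]]])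
      finally show "(LINT x|lebesgue. indicator (UNIV - B) x * f x) = 0" using IH tot by simp
    next
      fix B :: "nat \<Rightarrow> 'a set" assume dis: "disjoint_family B"
        and "range B \<subseteq> sigma_sets UNIV (range (\<lambda>(a, b). box a b))"
        and IH: "\<And>i. (LINT x|lebesgue. indicator (B i) x * f x) = 0"
      then have B: "B i \<in> sets lebesgue" for i using bl by (meson range_subsetD)
      have UB: "(\<Union>i<n. B i) \<in> sets lebesgue" for n using B by (intro sets.finite_UN) auto
      have z: "(LINT x|lebesgue. indicator (\<Union>i<n. B i) x * f x) = 0" for n
      proof (induction n)
        case (Suc n)
        have "B i \<inter> B n = {}" if "i < n" for i
          using dis that unfolding disjoint_family_on_def by simp
        then have "(\<Union>i<n. B i) \<inter> B n = {}" by auto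
        moreover have "(\<Union>i<Suc n. B i) = (\<Union>i<n. B i) \<union> B n" by (auto simp: less_Suc_eq)
        ultimately have "indicator (\<Union>i<Suc n. B i) x * f x = indicator (\<Union>i<n. B i) x * f x + indicator (B n) x * f x" for x
          by (auto simp: indicator_def)
        then have "(LINT x|lebesgue. indicator (\<Union>i<Suc n. B i) x * f x)
            = (LINT x|lebesgue. indicator (\<Union>i<n. B i) x * f x) + (LINT x|lebesgue. indicator (B n) x * f x)"
          using Bochner_Integration.integral_add[OF int[OF UB] int[OF B]] by simp
        then show ?case using Suc IH by simp
      qed simp
      have "(\<Union>i. B i) = (\<Union>n. \<Union>i<n. B i)" by (auto intro: lessI)
      moreover have "incseq (\<lambda>n. \<Union>i<n. B i)" unfolding incseq_def
        by (auto intro: less_le_trans)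
      ultimately show "(LINT x|lebesgue. indicator (\<Union>i. B i) x * f x) = 0"
        using UN[OF UB _ z] by simp
    qed auto
  qed
  interpret sf: sigma_finite_measure "lebesgue :: 'a measure"
  proof
    obtain A :: "'a set set" where A: "countable A" "A \<subseteq> sets lborel" "\<Union>A = space lborel"
        "\<forall>a\<in>A. emeasure lborel a \<noteq> \<infinity>"
      using lborel.sigma_finite_countable by metis
    have "emeasure lebesgue a \<noteq> \<infinity>" if "a \<in> A" for a
      using A(2,4) that emeasure_completion[of a lborel] main_part_sets[of a lborel] by auto
    moreover have "A \<subseteq> sets lebesgue" using A(2) by auto
    ultimately show "\<exists>A::'a set set. countable A \<and> A \<subseteq> sets lebesgue \<and> \<Union>A = space lebesgue \<and>
        (\<forall>a\<in>A. emeasure lebesgue a \<noteq> \<infinity>)"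
      using A(1,3) by (intro exI[of _ A]) auto
  qed
  show ?thesis
  proof (rule sf.density_zero[OF f])
    fix A :: "'a set" assume "A \<in> sets lebesgue"
    then obtain S N N' where SN: "A = S \<union> N" "N \<subseteq> N'" "N' \<in> null_sets lborel" "S \<in> sets lborel"
      by (rule sets_completionE)
    have "N' \<in> null_sets lebesgue" using SN(3) by (rule null_sets_completionI)
    then have N: "AE x in lebesgue. x \<notin> N'" by (rule AE_not_in)
    have "(LINT x|lebesgue. indicator A x * f x) = (LINT x|lebesgue. indicator S x * f x)"
    proof (rule integral_cong_AE)
      show "AE x in lebesgue. indicator A x * f x = indicator S x * f x"
        using N
      proof eventually_elim
        case (elim x)
        then show ?case using SN(1,2) by (auto simp: indicator_def)
      qed
    qed (use \<open>A \<in> sets lebesgue\<close> SN(4) f in \<open>auto intro!: borel_measurable_times borel_measurable_indicator\<close>)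
    then show "(LINT x:A|lebesgue. f x) = 0" using borel[of S] SN(4) by (simp add: set_lebesgue_integral_def)
  qed
qed

lemma test_fun_iter_deriv_continuous:
  "\<phi> \<in> test_fun \<Omega> \<Longrightarrow> set bs \<subseteq> Basis \<Longrightarrow> continuous_on UNIV (iter_deriv bs \<phi>)"
  unfolding test_fun_def smooth_open_def using differentiable_imp_continuous_on by auto

lemma test_fun_measurable: "\<phi> \<in> test_fun \<Omega> \<Longrightarrow> \<phi> \<in> borel_measurable lebesgue"
  using test_fun_iter_deriv_continuous[of \<phi> \<Omega> "[]"]
  by (intro measurable_completion) (simp add: borel_measurable_continuous_onI)

lemma compact_support_sqint:
  fixes f :: "'a::euclidean_space \<Rightarrow> real"
  assumes \<Omega>: "bounded \<Omega>" "open \<Omega>" and f: "continuous_on UNIV f" and K: "compact K" "\<And>x. x \<notin> K \<Longrightarrow> f x = 0"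
  shows "sqint \<Omega> f"
proof -
  have "compact (f ` K)" using K(1) continuous_on_subset[OF f] by (intro compact_continuous_image) auto
  then obtain B where B: "\<And>x. x \<in> K \<Longrightarrow> norm (f x) \<le> B"
    using compact_imp_bounded bounded_iff by (metis imageI)
  have "norm (f x) \<le> \<bar>B\<bar>" for x using B[of x] K(2)[of x] by (cases "x \<in> K") auto
  moreover have "f \<in> borel_measurable (lebesgue_on \<Omega>)"
    by (intro measurable_restrict_space1 measurable_completion) (simp add: borel_measurable_continuous_onI f)
  ultimately show ?thesis using \<Omega> by (intro sqint_bounded[of _ _ "\<bar>B\<bar>"]) auto
qed

lemma test_fun_sqint:
  fixes \<phi> :: "'a::euclidean_space \<Rightarrow> real"
  assumes \<Omega>: "bounded \<Omega>" "open \<Omega>" and \<phi>: "\<phi> \<in> test_fun \<Omega>"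
  shows "sqint \<Omega> \<phi>" "b \<in> Basis \<Longrightarrow> sqint \<Omega> (iter_deriv [b] \<phi>)"
proof -
  define K where "K = closure {x. \<phi> x \<noteq> 0}"
  have K: "compact K" using \<phi> by (auto simp: K_def test_fun_def)
  have out: "\<phi> x = 0" if "x \<notin> K" for x using that closure_subset[of "{x. \<phi> x \<noteq> 0}"] by (auto simp: K_def)
  show "sqint \<Omega> \<phi>"
    using test_fun_iter_deriv_continuous[OF \<phi>, of "[]"] compact_support_sqint[OF \<Omega> _ K out] by simp
  assume b: "b \<in> Basis"
  show "sqint \<Omega> (iter_deriv [b] \<phi>)"
  proof (rule compact_support_sqint[OF \<Omega> _ K])
    show "continuous_on UNIV (iter_deriv [b] \<phi>)"
      using test_fun_iter_deriv_continuous[OF \<phi>, of "[b]"] b by simp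
    fix x assume x: "x \<notin> K"
    have "((\<lambda>x. 0::real) has_derivative (\<lambda>h. 0)) (at x)" by simp
    then have "(\<phi> has_derivative (\<lambda>h. 0)) (at x)"
      by (rule has_derivative_transform_within_open[where s = "- K"])
        (use x out K in \<open>auto simp: compact_imp_closed open_Compl\<close>)
    then have "frechet_derivative \<phi> (at x) = (\<lambda>h. 0)" using frechet_derivative_at by metis
    then show "iter_deriv [b] \<phi> x = 0" by simp
  qed
qed

text \<open>The fundamental lemma of the calculus of variations.\<close>

lemma test_fun_zero_AE:
  fixes w :: "'a::euclidean_space \<Rightarrow> real"
  assumes \<Omega>: "bounded \<Omega>" "open \<Omega>" and w: "sqint \<Omega> w"
    and 0: "\<And>\<phi>. \<phi> \<in> test_fun \<Omega> \<Longrightarrow> L2_inner \<Omega> w \<phi> = 0"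
  shows "AE x in lebesgue_on \<Omega>. w x = 0"
proof -
  have [measurable]: "\<Omega> \<in> sets lebesgue" using \<Omega> by auto
  interpret fin: finite_measure "lebesgue_on \<Omega>" using finite_lebesgue_on \<Omega> by blast
  have one: "sqint \<Omega> (\<lambda>x. 1::real)" by (simp add: sqint_def)
  have wint: "integrable (lebesgue_on \<Omega>) w" using sqint_inner_integrable[OF w one] by simp
  define w1 where "w1 x = indicator \<Omega> x * w x" for x
  have w1int: "integrable lebesgue w1"
    using wint integrable_restrict_space[of \<Omega> lebesgue w] by (simp add: w1_def[abs_def])
  have box0: "(LINT x|lebesgue. indicator (box a b) x * w1 x) = 0" if ab: "cbox a b \<subseteq> \<Omega>" for a b
  proof -
    have "(\<lambda>n. LINT x|lebesgue. bump n a b x * w1 x) \<longlonglongrightarrow> (LINT x|lebesgue. indicator (box a b) x * w1 x)"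
    proof (rule integral_dominated_convergence[where w = "\<lambda>x. \<bar>w1 x\<bar>"])
      show "AE x in lebesgue. (\<lambda>n. bump n a b x * w1 x) \<longlonglongrightarrow> indicator (box a b) x * w1 x"
        by (intro AE_I2 tendsto_mult_right bump_tendsto)
      show "AE x in lebesgue. norm (bump n a b x * w1 x) \<le> \<bar>w1 x\<bar>" for n
        using bump_bounds[of n a b] by (intro AE_I2) (auto simp: abs_mult intro!: mult_left_le_one_le)
      have w1m: "w1 \<in> borel_measurable lebesgue" using w1int by (rule borel_measurable_integrable)
      then show "(\<lambda>x. indicator (box a b) x * w1 x) \<in> borel_measurable lebesgue"
        by (intro borel_measurable_times borel_measurable_indicator) auto
      have "bump n a b \<in> borel_measurable lebesgue" for n
        using test_fun_measurable[OF bump_test_fun[OF ab]] .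
      then show "(\<lambda>x. bump n a b x * w1 x) \<in> borel_measurable lebesgue" for n
        using w1m by (intro borel_measurable_times)
    qed (use w1int in auto)
    moreover have "(LINT x|lebesgue. bump n a b x * w1 x) = L2_inner \<Omega> w (bump n a b)" for n
      by (simp add: L2_inner_def integral_restrict_space w1_def ac_simps)
    ultimately have "(\<lambda>n::nat. 0::real) \<longlonglongrightarrow> (LINT x|lebesgue. indicator (box a b) x * w1 x)"
      using 0 bump_test_fun[OF ab] by simp
    then show ?thesis by (simp add: LIMSEQ_const_iff)
  qed
  \<comment> \<open>A box that reaches beyond the domain need not be a limit of test functions; hence localisation to
    the boxes of a countable cover.\<close>
  have loc: "AE x in lebesgue. x \<in> box c d \<longrightarrow> w1 x = 0" if cd: "cbox c d \<subseteq> \<Omega>" for c d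
  proof -
    have "AE x in lebesgue. indicator (box c d) x * w1 x = 0"
    proof (rule borel_integral_zero)
      show "integrable lebesgue (\<lambda>x. indicator (box c d) x * w1 x)"
        using integrable_mult_indicator[OF _ w1int, of "box c d"] by simp
      fix a b :: 'a
      obtain a' b' where "box a b \<inter> box c d = box a' b'" "cbox a' b' \<subseteq> cbox c d"
        using box_Int_box[of a b c d] Int_interval[of a b c d] by (metis Int_lower2)
      then show "(LINT x|lebesgue. indicator (box a b) x * (indicator (box c d) x * w1 x)) = 0"
        using box0[of a' b'] cd by (simp add: indicator_inter_arith[symmetric] mult.assoc[symmetric])
    qed
    then show ?thesis by eventually_elim (auto simp: indicator_def)
  qed
  have cloc: "AE x in lebesgue. x \<in> cbox c d \<longrightarrow> w1 x = 0" if cd: "cbox c d \<subseteq> \<Omega>" for c d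
  proof -
    have "cbox c d - box c d \<in> null_sets lebesgue"
      using negligible_frontier_interval[of c d] by (simp add: negligible_iff_null_sets)
    then have "AE x in lebesgue. x \<notin> cbox c d - box c d" by (rule AE_not_in)
    then show ?thesis using loc[OF cd] by eventually_elim auto
  qed
  obtain \<D> where D: "countable \<D>" "\<D> \<subseteq> Pow \<Omega>" "\<And>B. B \<in> \<D> \<Longrightarrow> \<exists>c d. B = cbox c d" "\<Union>\<D> = \<Omega>"
    using open_countable_Union_open_cbox[OF \<Omega>(2)] by metis
  have "AE x in lebesgue. \<forall>B\<in>\<D>. x \<in> B \<longrightarrow> w1 x = 0"
    using D(1)
  proof (subst AE_ball_countable, safe)
    fix B assume "B \<in> \<D>"
    then show "AE x in lebesgue. x \<in> B \<longrightarrow> w1 x = 0" using D(2,3) cloc by blast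
  qed
  then have "AE x in lebesgue. x \<in> \<Omega> \<longrightarrow> w x = 0"
  proof eventually_elim
    case (elim x)
    then show ?case using D(4) by (cases "x \<in> \<Omega>") (auto simp: w1_def)
  qed
  then show ?thesis by (subst AE_restrict_space_iff) auto
qed

lemma weak_deriv_unique:
  assumes \<Omega>: "bounded \<Omega>" "open \<Omega>" and u: "has_weak_deriv \<Omega> bs u w" "has_weak_deriv \<Omega> bs u w'"
  shows "AE x in lebesgue_on \<Omega>. w x = w' x"
proof -
  have s: "sqint \<Omega> w" "sqint \<Omega> w'" using u by (auto simp: has_weak_deriv_def L2_space_sqint)
  have "AE x in lebesgue_on \<Omega>. w x - w' x = 0"
  proof (rule test_fun_zero_AE[OF \<Omega>])
    show "sqint \<Omega> (\<lambda>x. w x - w' x)" using s by (rule sqint_diff)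
    fix \<phi> assume \<phi>: "\<phi> \<in> test_fun \<Omega>"
    have sq: "sqint \<Omega> \<phi>" using test_fun_sqint[OF \<Omega> \<phi>] by simp
    have "(-1) ^ length bs * L2_inner \<Omega> w \<phi> = (-1) ^ length bs * L2_inner \<Omega> w' \<phi>"
      using u \<phi> by (auto simp: has_weak_deriv_def)
    then have "L2_inner \<Omega> w \<phi> = L2_inner \<Omega> w' \<phi>" by simp
    then show "L2_inner \<Omega> (\<lambda>x. w x - w' x) \<phi> = 0"
      using L2.minus_left[of w \<Omega> w' \<phi>] s sq by (simp add: fun_diff_def)
  qed
  then show ?thesis by simp
qed

section \<open>The first order Sobolev space\<close>

lemma weak_deriv_has:
  assumes "\<exists>w. has_weak_deriv \<Omega> bs u w" shows "has_weak_deriv \<Omega> bs u (weak_deriv \<Omega> bs u)"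
  using someI_ex[OF assms] by (simp add: weak_deriv_def)

lemma H1_space_iff:
  "u \<in> Hs_space \<Omega> 1 \<longleftrightarrow> sqint \<Omega> u \<and> (\<forall>b\<in>Basis. \<exists>w. has_weak_deriv \<Omega> [b] u w)"
proof
  assume u: "u \<in> Hs_space \<Omega> 1"
  have "[b] \<in> dirs 1" if "b \<in> Basis" for b :: 'a using that by simp
  then show "sqint \<Omega> u \<and> (\<forall>b\<in>Basis. \<exists>w. has_weak_deriv \<Omega> [b] u w)"
    using u unfolding Hs_space_def L2_space_sqint by auto
next
  assume u: "sqint \<Omega> u \<and> (\<forall>b\<in>Basis. \<exists>w. has_weak_deriv \<Omega> [b] u w)"
  have "\<exists>w. has_weak_deriv \<Omega> bs u w" if "k \<le> 1" "bs \<in> dirs k" for k bs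
  proof (cases bs)
    case Nil
    have "has_weak_deriv \<Omega> [] u u" using u by (auto simp: has_weak_deriv_def L2_space_sqint)
    then show ?thesis using Nil by blast
  next
    case (Cons b bs')
    then have "bs = [b]" "b \<in> Basis" using that by auto
    then show ?thesis using u by blast
  qed
  then show "u \<in> Hs_space \<Omega> 1" using u unfolding Hs_space_def L2_space_sqint by auto
qed

lemma axis_Basis: "b \<in> (Basis :: (real^'n) set) \<longleftrightarrow> (\<exists>i. b = axis i 1)"
  by (auto simp: Basis_vec_def)

lemma weak_grad_nth: "weak_grad \<Omega> u x $ i = weak_deriv \<Omega> [axis i 1] u x"
  by (simp add: weak_grad_def)

lemma sqint_vec:
  fixes F :: "'a::euclidean_space \<Rightarrow> real^'n"
  assumes "\<And>i. sqint \<Omega> (\<lambda>x. F x $ i)" shows "sqint \<Omega> F"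
proof -
  have "F \<in> borel_measurable (lebesgue_on \<Omega>)"
  proof (subst borel_measurable_euclidean_space, intro ballI)
    fix b :: "real^'n" assume "b \<in> Basis"
    then obtain i where "b = axis i 1" using axis_Basis by blast
    then show "(\<lambda>x. F x \<bullet> b) \<in> borel_measurable (lebesgue_on \<Omega>)"
      using assms[of i] by (simp add: inner_axis sqint_def)
  qed
  moreover have "(\<lambda>x. (norm (F x))\<^sup>2) = (\<lambda>x. \<Sum>i\<in>UNIV. (F x $ i)\<^sup>2)"
    by (simp only: power2_norm_eq_inner inner_vec_def) (simp add: power2_eq_square)
  ultimately show ?thesis using assms by (auto simp: sqint_def)
qed

text \<open>Bounded open sets.\<close>

locale domain =
  fixes \<Omega> :: "(real^'n) set"
  assumes bounded_domain: "bounded \<Omega>" and open_domain: "open \<Omega>"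
begin

abbreviation H1 :: "(real^'n \<Rightarrow> real) set" where "H1 \<equiv> Hs_space \<Omega> 1"

lemma H1_sqint: "u \<in> H1 \<Longrightarrow> sqint \<Omega> u"
  by (simp add: H1_space_iff)

lemma H1_deriv: "u \<in> H1 \<Longrightarrow> has_weak_deriv \<Omega> [axis i 1] u (weak_deriv \<Omega> [axis i 1] u)"
  using axis_Basis by (intro weak_deriv_has) (auto simp: H1_space_iff)

lemma grad_sqint: assumes "u \<in> H1" shows "sqint \<Omega> (weak_grad \<Omega> u)"
proof (rule sqint_vec)
  show "sqint \<Omega> (\<lambda>x. weak_grad \<Omega> u x $ i)" for i
    using H1_deriv[OF assms, of i] by (simp add: weak_grad_nth has_weak_deriv_def L2_space_sqint)
qed

lemma has_weak_deriv_lin: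
  assumes u: "has_weak_deriv \<Omega> [b] u w" "has_weak_deriv \<Omega> [b] u' w'" and b: "b \<in> Basis"
  shows "has_weak_deriv \<Omega> [b] (u + c *\<^sub>R u') (w + c *\<^sub>R w')"
proof -
  have s: "sqint \<Omega> u" "sqint \<Omega> w" "sqint \<Omega> u'" "sqint \<Omega> w'"
    using u by (auto simp: has_weak_deriv_def L2_space_sqint)
  have lin: "L2_inner \<Omega> (x + c *\<^sub>R x') \<psi> = L2_inner \<Omega> x \<psi> + c * L2_inner \<Omega> x' \<psi>"
    if "sqint \<Omega> x" "sqint \<Omega> x'" "sqint \<Omega> \<psi>" for x x' \<psi> :: "real^'n \<Rightarrow> real"
    using that L2.mem_intros(3)[of x' \<Omega> c] by (simp add: L2.add_left L2.scale_left)
  have sq: "sqint \<Omega> (x + c *\<^sub>R x')" if "sqint \<Omega> x" "sqint \<Omega> x'" for x x' :: "real^'n \<Rightarrow> real"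
    using L2.mem_intros(1)[of x \<Omega> "c *\<^sub>R x'"] L2.mem_intros(3)[of x' \<Omega> c] that by simp
  show ?thesis unfolding has_weak_deriv_def L2_space_sqint
  proof (intro conjI ballI sq s)
    fix \<phi> assume \<phi>: "\<phi> \<in> test_fun \<Omega>"
    note t = test_fun_sqint[OF bounded_domain open_domain \<phi>]
    have "L2_inner \<Omega> u (iter_deriv [b] \<phi>) = - L2_inner \<Omega> w \<phi>"
      "L2_inner \<Omega> u' (iter_deriv [b] \<phi>) = - L2_inner \<Omega> w' \<phi>"
      using u \<phi> by (auto simp: has_weak_deriv_def)
    then show "L2_inner \<Omega> (u + c *\<^sub>R u') (iter_deriv [b] \<phi>)
        = (- 1) ^ length [b] * L2_inner \<Omega> (w + c *\<^sub>R w') \<phi>"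
      using lin[OF s(1,3) t(2)[OF b]] lin[OF s(2,4) t(1)] by (simp add: algebra_simps)
  qed
qed

lemma H1_lin: assumes "u \<in> H1" "v \<in> H1" shows "u + c *\<^sub>R v \<in> H1"
proof -
  have "\<exists>w. has_weak_deriv \<Omega> [b] (u + c *\<^sub>R v) w" if "b \<in> Basis" for b
    using assms has_weak_deriv_lin that unfolding H1_space_iff by blast
  moreover have "sqint \<Omega> (u + c *\<^sub>R v)"
    using L2.mem_intros(1)[of u \<Omega> "c *\<^sub>R v"] L2.mem_intros(3)[of v \<Omega> c] assms H1_sqint by simp
  ultimately show ?thesis by (simp add: H1_space_iff)
qed

lemma H1_zero: "0 \<in> H1"
proof -
  have "has_weak_deriv \<Omega> [b] 0 0" for b
    using L2.zero_left by (auto simp: has_weak_deriv_def L2_space_sqint sqint_zero zero_fun_def L2_inner_def)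
  then show ?thesis by (auto simp: H1_space_iff zero_fun_def sqint_zero)
qed

lemma H1_subspace: "subspace H1"
  unfolding subspace_def using H1_zero H1_lin[of _ _ 1] H1_lin[OF H1_zero] by auto

lemma H1_diff: "u \<in> H1 \<Longrightarrow> v \<in> H1 \<Longrightarrow> u - v \<in> H1"
  by (rule subspace_diff[OF H1_subspace])

lemma grad_lin:
  assumes "u \<in> H1" "v \<in> H1"
  shows "AE x in lebesgue_on \<Omega>. weak_grad \<Omega> (u + c *\<^sub>R v) x = weak_grad \<Omega> u x + c *\<^sub>R weak_grad \<Omega> v x"
proof -
  have "AE x in lebesgue_on \<Omega>. weak_deriv \<Omega> [axis i 1] (u + c *\<^sub>R v) x
      = weak_deriv \<Omega> [axis i 1] u x + c * weak_deriv \<Omega> [axis i 1] v x" for i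
    using weak_deriv_unique[OF bounded_domain open_domain H1_deriv[OF H1_lin[OF assms, of c], of i]
        has_weak_deriv_lin[OF H1_deriv[OF assms(1), of i] H1_deriv[OF assms(2), of i]]]
    by (simp add: fun_ops axis_in_Basis_iff)
  then have "AE x in lebesgue_on \<Omega>. \<forall>i. weak_deriv \<Omega> [axis i 1] (u + c *\<^sub>R v) x
      = weak_deriv \<Omega> [axis i 1] u x + c * weak_deriv \<Omega> [axis i 1] v x"
    by (subst AE_all_countable) auto
  then show ?thesis by eventually_elim (simp add: vec_eq_iff weak_grad_nth)
qed

lemma grad_diff:
  assumes "u \<in> H1" "v \<in> H1"
  shows "AE x in lebesgue_on \<Omega>. weak_grad \<Omega> (u - v) x = weak_grad \<Omega> u x - weak_grad \<Omega> v x"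
  using grad_lin[OF assms, of "-1"] by simp

text \<open>The L2 pairing of gradients with a fixed field is linear although the gradient itself is only
  linear almost everywhere.\<close>

lemma grad_inner_lin:
  assumes "u \<in> H1" "v \<in> H1" "sqint \<Omega> G"
  shows "L2_inner \<Omega> (weak_grad \<Omega> (u + c *\<^sub>R v)) G
    = L2_inner \<Omega> (weak_grad \<Omega> u) G + c * L2_inner \<Omega> (weak_grad \<Omega> v) G"
proof -
  have s: "sqint \<Omega> (weak_grad \<Omega> u)" "sqint \<Omega> (weak_grad \<Omega> v)" "sqint \<Omega> (weak_grad \<Omega> (u + c *\<^sub>R v))"
    using assms H1_lin by (auto intro: grad_sqint)
  have "L2_inner \<Omega> (weak_grad \<Omega> (u + c *\<^sub>R v)) G = L2_inner \<Omega> (weak_grad \<Omega> u + c *\<^sub>R weak_grad \<Omega> v) G"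
  proof (rule L2_inner_cong_AE)
    show "sqint \<Omega> (weak_grad \<Omega> u + c *\<^sub>R weak_grad \<Omega> v)"
      using sqint_add[OF s(1) sqint_scale[OF s(2)]] by (simp add: fun_ops)
    show "AE x in lebesgue_on \<Omega>. weak_grad \<Omega> (u + c *\<^sub>R v) x = (weak_grad \<Omega> u + c *\<^sub>R weak_grad \<Omega> v) x"
      using grad_lin[OF assms(1,2), of c] by (simp add: fun_ops)
  qed (use s assms in auto)
  then show ?thesis
    using s assms L2.mem_intros(3)[of "weak_grad \<Omega> v" \<Omega> c] by (simp add: L2.add_left L2.scale_left)
qed

lemma semi_inner_grad: "semi_inner H1 (\<lambda>u v. L2_inner \<Omega> (weak_grad \<Omega> u) (weak_grad \<Omega> v))"
proof
  show "subspace H1" by (rule H1_subspace)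
next
  fix x y z and c :: real
  assume x: "x \<in> H1"
  show "0 \<le> L2_inner \<Omega> (weak_grad \<Omega> x) (weak_grad \<Omega> x)" by (simp add: L2_inner_def)
  assume z: "z \<in> H1"
  show "L2_inner \<Omega> (weak_grad \<Omega> x) (weak_grad \<Omega> z) = L2_inner \<Omega> (weak_grad \<Omega> z) (weak_grad \<Omega> x)"
    by (simp add: L2_inner_def inner_commute)
  show "L2_inner \<Omega> (weak_grad \<Omega> (c *\<^sub>R x)) (weak_grad \<Omega> z) = c * L2_inner \<Omega> (weak_grad \<Omega> x) (weak_grad \<Omega> z)"
    using grad_inner_lin[OF x x grad_sqint[OF z], of "c - 1"] by (simp add: algebra_simps)
  assume y: "y \<in> H1"
  show "L2_inner \<Omega> (weak_grad \<Omega> (x + y)) (weak_grad \<Omega> z)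
      = L2_inner \<Omega> (weak_grad \<Omega> x) (weak_grad \<Omega> z) + L2_inner \<Omega> (weak_grad \<Omega> y) (weak_grad \<Omega> z)"
    using grad_inner_lin[OF x y grad_sqint[OF z], of 1] by simp
qed

text \<open>The inner product that induces the norm of the Sobolev space of order one.\<close>

definition H1_inner :: "(real^'n \<Rightarrow> real) \<Rightarrow> (real^'n \<Rightarrow> real) \<Rightarrow> real" where
  "H1_inner u v = L2_inner \<Omega> u v + L2_inner \<Omega> (weak_grad \<Omega> u) (weak_grad \<Omega> v)"

lemma semi_inner_H1: "semi_inner H1 H1_inner"
proof -
  interpret g: semi_inner H1 "\<lambda>u v. L2_inner \<Omega> (weak_grad \<Omega> u) (weak_grad \<Omega> v)" by (rule semi_inner_grad)
  show ?thesis
  proof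
    show "subspace H1" by (rule H1_subspace)
  next
    fix x y z and c :: real
    assume x: "x \<in> H1"
    show "0 \<le> H1_inner x x" by (simp add: H1_inner_def L2_inner_def)
    assume z: "z \<in> H1"
    show "H1_inner x z = H1_inner z x" by (simp add: H1_inner_def L2_inner_def inner_commute mult.commute)
    show "H1_inner (c *\<^sub>R x) z = c * H1_inner x z"
      using x z H1_sqint by (simp add: H1_inner_def g.scale_left L2.scale_left algebra_simps)
    assume y: "y \<in> H1"
    show "H1_inner (x + y) z = H1_inner x z + H1_inner y z"
      using x y z H1_sqint by (simp add: H1_inner_def g.add_left L2.add_left algebra_simps)
  qed
qed

sublocale H1: semi_inner H1 H1_inner by (rule semi_inner_H1)

lemma H1_nrm: "H1.nrm u = H1_norm \<Omega> u"
  by (simp add: H1.nrm_def H1_inner_def H1_norm_def L2_norm_sq)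

lemma H1_norm_nonneg [simp]: "0 \<le> H1_norm \<Omega> u" by (simp add: H1_norm_def)

lemma L2_le_H1: "L2_norm \<Omega> u \<le> H1_norm \<Omega> u"
  unfolding H1_norm_def by (rule real_le_rsqrt) simp

lemma grad_le_H1: "L2_norm \<Omega> (weak_grad \<Omega> u) \<le> H1_norm \<Omega> u"
  unfolding H1_norm_def by (rule real_le_rsqrt) simp

lemma H10_sub_H1: "u \<in> H10_space \<Omega> \<Longrightarrow> u \<in> H1" by (simp add: H10_space_def)

text \<open>Elements vanishing almost everywhere have vanishing gradient.\<close>

lemma grad_null:
  assumes u: "u \<in> H1" and 0: "L2_norm \<Omega> u = 0" shows "L2_norm \<Omega> (weak_grad \<Omega> u) = 0"
proof -
  have s: "sqint \<Omega> u" using u by (rule H1_sqint)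
  have z: "sqint \<Omega> (\<lambda>x. 0::real)" by (rule sqint_zero)
  have L0: "L2_inner \<Omega> u \<phi> = 0" if "sqint \<Omega> \<phi>" for \<phi>
    using L2_cauchy_schwarz[OF s that] 0 by simp
  have "has_weak_deriv \<Omega> [axis i 1] u (\<lambda>x. 0)" for i
    unfolding has_weak_deriv_def L2_space_sqint
    using s z L0 test_fun_sqint(2)[OF bounded_domain open_domain] axis_Basis by (auto simp: L2_inner_def)
  then have "AE x in lebesgue_on \<Omega>. weak_deriv \<Omega> [axis i 1] u x = 0" for i
    using weak_deriv_unique[OF bounded_domain open_domain H1_deriv[OF u]] by blast
  then have "AE x in lebesgue_on \<Omega>. \<forall>i. weak_deriv \<Omega> [axis i 1] u x = 0"
    by (subst AE_all_countable) auto
  then have "AE x in lebesgue_on \<Omega>. weak_grad \<Omega> u x = 0"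
    by eventually_elim (simp add: vec_eq_iff weak_grad_nth)
  then have "L2_norm \<Omega> (weak_grad \<Omega> u) = L2_norm \<Omega> (\<lambda>x. 0 :: real^'n)"
    by (intro L2_norm_cong_AE grad_sqint u sqint_zero)
  then show ?thesis by (simp add: L2_norm_def L2_inner_def)
qed

end

section \<open>Coefficients\<close>

lemma norm_matrix_vector_mult: "norm (A *v x) \<le> norm A * norm (x :: real^'n)" for A :: "real^'n^'m"
proof -
  have "norm (A *v x) \<le> L2_set (\<lambda>i. norm (A $ i) * norm x) UNIV"
    unfolding norm_vec_def[of "A *v x"]
    by (intro L2_set_mono) (auto simp: matrix_vector_mul_component intro: Cauchy_Schwarz_ineq2)
  also have "\<dots> = norm A * norm x" by (simp add: norm_vec_def[of A] L2_set_left_distrib)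
  finally show ?thesis .
qed

lemma bounded_bilinear_matrix_vector_mult: "bounded_bilinear (\<lambda>(A :: real^'n^'m) x. A *v x)"
proof
  show "\<exists>K. \<forall>(A :: real^'n^'m) x. norm (A *v x) \<le> norm A * norm x * K"
    by (intro exI[of _ 1]) (simp add: norm_matrix_vector_mult)
qed (auto simp: matrix_vector_mult_add_rdistrib matrix_vector_right_distrib
    scaleR_matrix_vector_assoc matrix_vector_mult_scaleR)

lemma measurable_matrix_vector_mult:
  fixes M :: "'a \<Rightarrow> real^'n^'m"
  assumes "M \<in> borel_measurable N" "F \<in> borel_measurable N"
  shows "(\<lambda>x. M x *v F x) \<in> borel_measurable N"
  using assms
proof (rule borel_measurable_continuous_Pair)
  show "continuous_on UNIV (\<lambda>x. fst x *v snd x :: real^'m)"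
    by (intro bounded_bilinear.continuous_on[OF bounded_bilinear_matrix_vector_mult] continuous_intros)
qed

text \<open>A bound on the last partial derivative is a Lipschitz constant in the last coordinate.  That coordinate is
  the value of the solution for the coefficients of \<open>B\<close>, and time for those of \<open>A\<close>.\<close>

lemma lipschitz_last_coord:
  fixes f :: "'a::euclidean_space \<times> real \<Rightarrow> 'b::real_normed_vector"
  assumes W: "open W" and f: "f differentiable_on W" and I: "convex I"
    and sub: "\<And>t. t \<in> I \<Longrightarrow> (x, t) \<in> W"
    and bd: "\<And>t. t \<in> I \<Longrightarrow> norm (frechet_derivative f (at (x, t)) (0, 1)) \<le> C"
    and st: "s \<in> I" "t \<in> I"
  shows "norm (f (x, t) - f (x, s)) \<le> C * \<bar>t - s\<bar>"
proof -
  have "norm (f (x, t) - f (x, s)) \<le> C * norm (t - s)"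
  proof (rule differentiable_bound[OF I])
    fix \<tau> assume \<tau>: "\<tau> \<in> I"
    define d where "d = frechet_derivative f (at (x, \<tau>))"
    have "f differentiable (at (x, \<tau>))"
      using f sub[OF \<tau>] at_within_open[OF sub[OF \<tau>] W] unfolding differentiable_on_def by metis
    then have "(f has_derivative d) (at (x, \<tau>))" unfolding d_def by (simp add: frechet_derivative_works)
    moreover have "((\<lambda>t. (x, t)) has_derivative (\<lambda>h. (0, h))) (at \<tau> within I)"
      by (rule has_derivative_Pair[OF has_derivative_const has_derivative_ident])
    ultimately have D: "((\<lambda>t. f (x, t)) has_derivative (\<lambda>h. d (0, h))) (at \<tau> within I)"
      by (rule has_derivative_compose[rotated])
    have "(\<lambda>h. d (0, h)) = (\<lambda>h. h *\<^sub>R d (0, 1))"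
    proof
      show "d (0, h) = h *\<^sub>R d (0, 1)" for h
        using linear_scale[OF has_derivative_linear[OF \<open>(f has_derivative d) (at (x, \<tau>))\<close>], of h "(0, 1)"]
        by (simp only: scaleR_Pair scaleR_zero_right real_scaleR_def mult_1_right)
    qed
    then show "((\<lambda>t. f (x, t)) has_derivative (\<lambda>h. h *\<^sub>R d (0, 1))) (at \<tau> within I)" using D by (simp only:)
    show "onorm (\<lambda>h. h *\<^sub>R d (0, 1)) \<le> C"
    proof (rule onorm_le)
      show "norm (h *\<^sub>R d (0, 1)) \<le> C * norm h" for h
        using mult_right_mono[OF bd[OF \<tau>], of "\<bar>h\<bar>"] by (simp add: d_def mult.commute)
    qed
  qed (use st in auto)
  then show ?thesis by simp
qed

lemma basis_last: "(0, 1) \<in> (Basis :: ('a::euclidean_space \<times> real) set)"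
  by (simp add: Basis_prod_def)

lemma smooth_open_diff:
  assumes "smooth_open W (f :: 'a::euclidean_space \<times> real \<Rightarrow> 'b::real_normed_vector)"
  shows "f differentiable_on W" "(\<lambda>z. frechet_derivative f (at z) (0, 1)) differentiable_on W"
proof -
  from assms have *: "iter_deriv bs f differentiable_on W" if "set bs \<subseteq> Basis" for bs
    using that unfolding smooth_open_def by blast
  show "f differentiable_on W" using *[of "[]"] by simp
  have "set [(0 :: 'a, 1 :: real)] \<subseteq> Basis" using basis_last by simp
  from *[OF this] show "(\<lambda>z. frechet_derivative f (at z) (0, 1)) differentiable_on W"
    by (simp only: iter_deriv.simps)
qed

context domain
begin

text \<open>Coefficients that are continuous, bounded, and Lipschitz continuous in the value of the solution, with
  one constant for both bounds.\<close>

definition lip_coeff :: "real \<Rightarrow> (real^'n \<Rightarrow> real \<Rightarrow> 'b::euclidean_space) \<Rightarrow> bool" where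
  "lip_coeff C f \<longleftrightarrow> 0 \<le> C \<and> continuous_on (\<Omega> \<times> UNIV) (\<lambda>(x, w). f x w) \<and>
     (\<forall>x\<in>\<Omega>. \<forall>w. norm (f x w) \<le> C) \<and> (\<forall>x\<in>\<Omega>. \<forall>w w'. norm (f x w - f x w') \<le> C * \<bar>w - w'\<bar>)"

lemma lip_coeff_mono:
  assumes "lip_coeff C f" "C \<le> C'" shows "lip_coeff C' f"
proof -
  have "C * \<bar>d\<bar> \<le> C' * \<bar>d\<bar>" for d :: real using assms(2) by (intro mult_right_mono) auto
  then have "norm (f x w - f x w') \<le> C' * \<bar>w - w'\<bar>" if "x \<in> \<Omega>" for x w w'
    using assms(1) that unfolding lip_coeff_def by (meson order_trans)
  moreover have "norm (f x w) \<le> C'" if "x \<in> \<Omega>" for x w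
    using assms that unfolding lip_coeff_def by (meson order_trans)
  ultimately show ?thesis using assms unfolding lip_coeff_def by auto
qed

lemma smooth_bounded_lip_coeff:
  fixes f :: "real^'n \<Rightarrow> real \<Rightarrow> 'b::euclidean_space"
  assumes "smooth_bounded (\<Omega> \<times> UNIV) (\<lambda>(x, w). f x w)"
  shows "\<exists>C. lip_coeff C f"
proof -
  define F where "F = (\<lambda>(x, w). f x w)"
  have sm: "smooth_open (\<Omega> \<times> UNIV) F" and bd: "\<And>bs. set bs \<subseteq> Basis \<Longrightarrow> bounded (iter_deriv bs F ` (\<Omega> \<times> UNIV))"
    using assms by (auto simp: smooth_bounded_def F_def)
  have op: "open (\<Omega> \<times> (UNIV :: real set))" using open_domain by (simp add: open_Times)
  obtain C1 where C1: "\<And>z. z \<in> \<Omega> \<times> UNIV \<Longrightarrow> norm (F z) \<le> C1"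
    using bd[of "[]"] by (auto simp: bounded_iff)
  obtain C2 where C2: "\<And>z. z \<in> \<Omega> \<times> UNIV \<Longrightarrow> norm (frechet_derivative F (at z) (0, 1)) \<le> C2"
    using bd[of "[(0, 1)]"] by (auto simp: bounded_iff basis_last)
  define C where "C = \<bar>C1\<bar> + \<bar>C2\<bar>"
  have "norm (f x w - f x w') \<le> C * \<bar>w - w'\<bar>" if "x \<in> \<Omega>" for x w w'
  proof -
    have "norm (F (x, w) - F (x, w')) \<le> C * \<bar>w - w'\<bar>"
    proof (rule lipschitz_last_coord[OF op smooth_open_diff(1)[OF sm], of UNIV])
      fix t :: real
      show "norm (frechet_derivative F (at (x, t)) (0, 1)) \<le> C" using C2[of "(x, t)"] that by (auto simp: C_def)
    qed (use that in auto)
    then show ?thesis by (simp add: F_def)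
  qed
  moreover have "norm (f x w) \<le> C" if "x \<in> \<Omega>" for x w using C1[of "(x, w)"] that by (auto simp: C_def F_def)
  moreover have "continuous_on (\<Omega> \<times> UNIV) F"
    using smooth_open_diff(1)[OF sm] by (rule differentiable_imp_continuous_on)
  ultimately have "lip_coeff C f" by (auto simp: lip_coeff_def F_def C_def)
  then show ?thesis ..
qed

lemma measurable_comp_continuous:
  fixes f :: "real^'n \<Rightarrow> real \<Rightarrow> 'b::euclidean_space"
  assumes f: "continuous_on (\<Omega> \<times> UNIV) (\<lambda>(x, w). f x w)" and w: "w \<in> borel_measurable (lebesgue_on \<Omega>)"
  shows "(\<lambda>x. f x (w x)) \<in> borel_measurable (lebesgue_on \<Omega>)"
proof -
  have "\<Omega> \<times> (UNIV :: real set) \<in> sets borel" using open_domain by (intro borel_open) (simp add: open_Times)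
  then have m: "(\<lambda>z. indicator (\<Omega> \<times> (UNIV :: real set)) z *\<^sub>R (\<lambda>(x, w). f x w) z) \<in> borel_measurable borel"
    using f by (rule borel_measurable_continuous_on_indicator)
  have "(\<lambda>x. x) \<in> borel_measurable (lebesgue_on \<Omega>)"
    by (intro measurable_restrict_space1 measurable_completion) simp
  then have "(\<lambda>x. (x, w x)) \<in> borel_measurable (lebesgue_on \<Omega>)" using w by (rule borel_measurable_Pair)
  from measurable_compose[OF this m]
  have "(\<lambda>x. indicator (\<Omega> \<times> (UNIV :: real set)) (x, w x) *\<^sub>R f x (w x)) \<in> borel_measurable (lebesgue_on \<Omega>)"
    by simp
  then show ?thesis by (rule measurable_cong[THEN iffD1, rotated]) (simp add: indicator_def)
qed

lemma AE_domain: "(\<And>x. x \<in> \<Omega> \<Longrightarrow> P x) \<Longrightarrow> AE x in lebesgue_on \<Omega>. P x"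
  by (rule AE_I2) simp

lemma sqint_mult:
  fixes M :: "real^'n \<Rightarrow> real^'n^'n"
  assumes M: "M \<in> borel_measurable (lebesgue_on \<Omega>)" "\<And>x. x \<in> \<Omega> \<Longrightarrow> norm (M x) \<le> C" and F: "sqint \<Omega> F" and C: "0 \<le> C"
  shows "sqint \<Omega> (\<lambda>x. M x *v F x)" "L2_norm \<Omega> (\<lambda>x. M x *v F x) \<le> C * L2_norm \<Omega> F"
proof -
  have le: "AE x in lebesgue_on \<Omega>. norm (M x *v F x) \<le> C * norm (F x)"
    by (rule AE_domain) (meson M(2) mult_right_mono norm_ge_zero norm_matrix_vector_mult order_trans)
  show s: "sqint \<Omega> (\<lambda>x. M x *v F x)"
    using sqint_bound[OF measurable_matrix_vector_mult[OF M(1)] F le] F by (simp add: sqint_def)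
  show "L2_norm \<Omega> (\<lambda>x. M x *v F x) \<le> C * L2_norm \<Omega> F" using L2_norm_le[OF s F C le] .
qed

lemma sqint_inner_mult:
  fixes M :: "real^'n \<Rightarrow> 'b::euclidean_space"
  assumes M: "M \<in> borel_measurable (lebesgue_on \<Omega>)" "\<And>x. x \<in> \<Omega> \<Longrightarrow> norm (M x) \<le> C" and F: "sqint \<Omega> F" and C: "0 \<le> C"
  shows "sqint \<Omega> (\<lambda>x. M x \<bullet> F x)" "L2_norm \<Omega> (\<lambda>x. M x \<bullet> F x) \<le> C * L2_norm \<Omega> F"
proof -
  have le: "AE x in lebesgue_on \<Omega>. norm (M x \<bullet> F x) \<le> C * norm (F x)"
    by (rule AE_domain) (metis M(2) mult_right_mono norm_ge_zero real_norm_def Cauchy_Schwarz_ineq2 order_trans)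
  show s: "sqint \<Omega> (\<lambda>x. M x \<bullet> F x)"
    using M(1) F by (intro sqint_bound[OF _ F le]) (auto simp: sqint_def)
  show "L2_norm \<Omega> (\<lambda>x. M x \<bullet> F x) \<le> C * L2_norm \<Omega> F" using L2_norm_le[OF s F C le] .
qed

section \<open>Functionals given by a flux and a density\<close>

text \<open>The functional that maps \<open>v\<close> to \<open>(F, \<nabla>v) + (G, v)\<close>, with flux \<open>F\<close> and density \<open>G\<close>.  The forms of \<open>A\<close> and \<open>B\<close>
  are of this kind in their last argument.\<close>

definition pairing :: "(real^'n \<Rightarrow> real^'n) \<Rightarrow> (real^'n \<Rightarrow> real) \<Rightarrow> (real^'n \<Rightarrow> real) \<Rightarrow> real" where
  "pairing F G v = L2_inner \<Omega> F (weak_grad \<Omega> v) + L2_inner \<Omega> G v"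

lemma sqint_one: "sqint \<Omega> (\<lambda>x. 1::real)"
proof -
  interpret finite_measure "lebesgue_on \<Omega>" using finite_lebesgue_on[OF bounded_domain open_domain] .
  show ?thesis by (simp add: sqint_def)
qed

lemma pairing_lin:
  assumes "sqint \<Omega> F" "sqint \<Omega> G" "u \<in> H1" "v \<in> H1"
  shows "pairing F G (u + c *\<^sub>R v) = pairing F G u + c * pairing F G v"
proof -
  have "L2_inner \<Omega> F (weak_grad \<Omega> (u + c *\<^sub>R v)) = L2_inner \<Omega> F (weak_grad \<Omega> u) + c * L2_inner \<Omega> F (weak_grad \<Omega> v)"
    using grad_inner_lin[OF assms(3,4,1), of c] by (simp add: L2_inner_def inner_commute)
  moreover have "L2_inner \<Omega> G (u + c *\<^sub>R v) = L2_inner \<Omega> G u + c * L2_inner \<Omega> G v"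
    using assms H1_sqint L2.mem_intros(3)[of v \<Omega> c] by (simp add: L2.add_right L2.scale_right)
  ultimately show ?thesis by (simp add: pairing_def algebra_simps)
qed

lemma pairing_diff:
  assumes "sqint \<Omega> F" "sqint \<Omega> G" "sqint \<Omega> F'" "sqint \<Omega> G'" "v \<in> H1"
  shows "pairing (\<lambda>x. F x - F' x) (\<lambda>x. G x - G' x) v = pairing F G v - pairing F' G' v"
  using L2.minus_left[of F \<Omega> F' "weak_grad \<Omega> v"] L2.minus_left[of G \<Omega> G' v] assms H1_sqint grad_sqint
  by (simp add: pairing_def fun_diff_def)

lemma pairing_bound:
  assumes "sqint \<Omega> F" "sqint \<Omega> G" "v \<in> H1" "L2_norm \<Omega> F + L2_norm \<Omega> G \<le> c"
  shows "\<bar>pairing F G v\<bar> \<le> c * H1_norm \<Omega> v"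
proof -
  have "\<bar>pairing F G v\<bar> \<le> L2_norm \<Omega> F * L2_norm \<Omega> (weak_grad \<Omega> v) + L2_norm \<Omega> G * L2_norm \<Omega> v"
    unfolding pairing_def using assms L2_cauchy_schwarz[of \<Omega> F "weak_grad \<Omega> v"] L2_cauchy_schwarz[of \<Omega> G v]
      H1_sqint grad_sqint by (smt (verit))
  also have "\<dots> \<le> L2_norm \<Omega> F * H1_norm \<Omega> v + L2_norm \<Omega> G * H1_norm \<Omega> v"
    by (intro add_mono mult_left_mono L2_le_H1 grad_le_H1) auto
  also have "\<dots> \<le> c * H1_norm \<Omega> v"
    using mult_right_mono[OF assms(4), of "H1_norm \<Omega> v"] by (simp add: algebra_simps)
  finally show ?thesis .
qed

lemma pairing_cong_AE:
  assumes "sqint \<Omega> F" "sqint \<Omega> G" "sqint \<Omega> F'" "sqint \<Omega> G'" "v \<in> H1"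
    "AE x in lebesgue_on \<Omega>. F x = F' x" "AE x in lebesgue_on \<Omega>. G x = G' x"
  shows "pairing F G v = pairing F' G' v"
proof -
  have "L2_inner \<Omega> F (weak_grad \<Omega> v) = L2_inner \<Omega> F' (weak_grad \<Omega> v)"
    by (rule L2_inner_cong_AE) (use assms grad_sqint in auto)
  moreover have "L2_inner \<Omega> G v = L2_inner \<Omega> G' v"
    by (rule L2_inner_cong_AE) (use assms H1_sqint in auto)
  ultimately show ?thesis by (simp add: pairing_def)
qed

end

text \<open>The data of the nonlinear operator \<open>B\<close>; the constant \<open>C\<close> serves for all coefficients.\<close>

locale nonlinear_op = domain \<Omega> for \<Omega> :: "(real^'n) set" +
  fixes \<alpha> :: "real^'n \<Rightarrow> real \<Rightarrow> real^'n^'n" and \<beta> \<gamma> :: "real^'n \<Rightarrow> real \<Rightarrow> real^'n"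
    and g :: "real^'n \<Rightarrow> real \<Rightarrow> real" and C :: real
  assumes lip: "lip_coeff C \<alpha>" "lip_coeff C \<beta>" "lip_coeff C \<gamma>" "lip_coeff C g"
begin

abbreviation Bt where "Bt \<equiv> B_tilde \<Omega> \<alpha> \<beta> \<gamma> g"
abbreviation B1 where "B1 \<equiv> B1_form \<Omega> \<alpha> \<gamma>"

lemma C_nonneg: "0 \<le> C" using lip(1) by (simp add: lip_coeff_def)

lemma coeff_measurable:
  fixes f :: "real^'n \<Rightarrow> real \<Rightarrow> 'b::euclidean_space"
  assumes "lip_coeff C f" "sqint \<Omega> w" shows "(\<lambda>x. f x (w x)) \<in> borel_measurable (lebesgue_on \<Omega>)"
  by (rule measurable_comp_continuous) (use assms in \<open>auto simp: lip_coeff_def sqint_def\<close>)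

lemma coeff_sqint:
  fixes f :: "real^'n \<Rightarrow> real \<Rightarrow> 'b::euclidean_space"
  assumes "lip_coeff C f" "sqint \<Omega> w" shows "sqint \<Omega> (\<lambda>x. f x (w x))"
proof (rule sqint_bounded[OF bounded_domain open_domain coeff_measurable[OF assms]])
  show "AE x in lebesgue_on \<Omega>. norm (f x (w x)) \<le> C"
    by (rule AE_domain) (use assms(1) in \<open>auto simp: lip_coeff_def\<close>)
qed

lemma lin_flux_sqint:
  assumes w: "sqint \<Omega> w" and F: "sqint \<Omega> F"
  shows "sqint \<Omega> (\<lambda>x. \<alpha> x (w x) *v F x)" "L2_norm \<Omega> (\<lambda>x. \<alpha> x (w x) *v F x) \<le> C * L2_norm \<Omega> F"
    "sqint \<Omega> (\<lambda>x. \<gamma> x (w x) \<bullet> F x)" "L2_norm \<Omega> (\<lambda>x. \<gamma> x (w x) \<bullet> F x) \<le> C * L2_norm \<Omega> F"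
proof -
  have "norm (\<alpha> x (w x)) \<le> C" "norm (\<gamma> x (w x)) \<le> C" if "x \<in> \<Omega>" for x
    using lip(1,3) that by (auto simp: lip_coeff_def)
  note * = sqint_mult[OF coeff_measurable[OF lip(1) w] this(1) F C_nonneg]
    sqint_inner_mult[OF coeff_measurable[OF lip(3) w] this(2) F C_nonneg]
  show "sqint \<Omega> (\<lambda>x. \<alpha> x (w x) *v F x)" by (rule *(1))
  show "L2_norm \<Omega> (\<lambda>x. \<alpha> x (w x) *v F x) \<le> C * L2_norm \<Omega> F" by (rule *(2))
  show "sqint \<Omega> (\<lambda>x. \<gamma> x (w x) \<bullet> F x)" by (rule *(3))
  show "L2_norm \<Omega> (\<lambda>x. \<gamma> x (w x) \<bullet> F x) \<le> C * L2_norm \<Omega> F" by (rule *(4))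
qed

lemma flux_sqint:
  assumes w: "sqint \<Omega> w" and F: "sqint \<Omega> F"
  shows "sqint \<Omega> (\<lambda>x. \<alpha> x (w x) *v F x + \<beta> x (w x))" "sqint \<Omega> (\<lambda>x. \<gamma> x (w x) \<bullet> F x + g x (w x))"
  using lin_flux_sqint[OF w F] coeff_sqint[OF lip(2) w] coeff_sqint[OF lip(4) w] by (auto intro: sqint_add)

lemma B1_pairing: "B1 w u v = pairing (\<lambda>x. \<alpha> x (w x) *v weak_grad \<Omega> u x) (\<lambda>x. \<gamma> x (w x) \<bullet> weak_grad \<Omega> u x) v"
  by (simp add: B1_form_def pairing_def)

lemma Bt_pairing: "Bt w u v = pairing (\<lambda>x. \<alpha> x (w x) *v weak_grad \<Omega> u x + \<beta> x (w x))
    (\<lambda>x. \<gamma> x (w x) \<bullet> weak_grad \<Omega> u x + g x (w x)) v"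
  by (simp add: B_tilde_def pairing_def)

lemma B1_bound:
  assumes "sqint \<Omega> w" "u \<in> H1" "v \<in> H1"
  shows "\<bar>B1 w u v\<bar> \<le> 2 * C * H1_norm \<Omega> u * H1_norm \<Omega> v"
  unfolding B1_pairing
proof (rule pairing_bound)
  have "C * L2_norm \<Omega> (weak_grad \<Omega> u) \<le> C * H1_norm \<Omega> u" using C_nonneg grad_le_H1 by (rule mult_left_mono[rotated])
  then show "L2_norm \<Omega> (\<lambda>x. \<alpha> x (w x) *v weak_grad \<Omega> u x) + L2_norm \<Omega> (\<lambda>x. \<gamma> x (w x) \<bullet> weak_grad \<Omega> u x)
      \<le> 2 * C * H1_norm \<Omega> u"
    using lin_flux_sqint(2,4)[OF assms(1) grad_sqint[OF assms(2)]] by linarith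
qed (use assms lin_flux_sqint grad_sqint in auto)

lemma Bt_lin:
  assumes "sqint \<Omega> w" "u \<in> H1" "v \<in> H1" "v' \<in> H1"
  shows "Bt w u (v + c *\<^sub>R v') = Bt w u v + c * Bt w u v'"
  unfolding Bt_pairing by (rule pairing_lin[OF flux_sqint[OF assms(1) grad_sqint[OF assms(2)]] assms(3,4)])

text \<open>The terms without gradient do not depend on the second argument and cancel.\<close>

lemma Bt_diff:
  assumes w: "sqint \<Omega> w" and u: "u \<in> H1" "u' \<in> H1" and v: "v \<in> H1"
  shows "Bt w u v - Bt w u' v = B1 w (u - u') v"
proof -
  note s = grad_sqint[OF u(1)] grad_sqint[OF u(2)] grad_sqint[OF H1_diff[OF u]]
  note f = flux_sqint[OF w s(1)] flux_sqint[OF w s(2)]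
  note lf = lin_flux_sqint(1,3)[OF w s(3)]
  have "Bt w u v - Bt w u' v = pairing
      (\<lambda>x. (\<alpha> x (w x) *v weak_grad \<Omega> u x + \<beta> x (w x)) - (\<alpha> x (w x) *v weak_grad \<Omega> u' x + \<beta> x (w x)))
      (\<lambda>x. (\<gamma> x (w x) \<bullet> weak_grad \<Omega> u x + g x (w x)) - (\<gamma> x (w x) \<bullet> weak_grad \<Omega> u' x + g x (w x))) v"
    unfolding Bt_pairing using f v by (intro pairing_diff[symmetric])
  also have "\<dots> = B1 w (u - u') v"
    unfolding B1_pairing
  proof (rule pairing_cong_AE[OF sqint_diff[OF f(1,3)] sqint_diff[OF f(2,4)] lf v])
    show "AE x in lebesgue_on \<Omega>. (\<alpha> x (w x) *v weak_grad \<Omega> u x + \<beta> x (w x)) - (\<alpha> x (w x) *v weak_grad \<Omega> u' x + \<beta> x (w x))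
        = \<alpha> x (w x) *v weak_grad \<Omega> (u - u') x"
      using grad_diff[OF u] by eventually_elim (simp add: matrix_vector_mult_diff_distrib)
    show "AE x in lebesgue_on \<Omega>. (\<gamma> x (w x) \<bullet> weak_grad \<Omega> u x + g x (w x)) - (\<gamma> x (w x) \<bullet> weak_grad \<Omega> u' x + g x (w x))
        = \<gamma> x (w x) \<bullet> weak_grad \<Omega> (u - u') x"
      using grad_diff[OF u] by eventually_elim (simp add: inner_diff_right)
  qed
  finally show ?thesis .
qed

text \<open>Lipschitz dependence on the frozen argument needs a bounded gradient of the second one.\<close>

lemma Bt_lipschitz:
  assumes w: "sqint \<Omega> w" "sqint \<Omega> w'" and u: "u \<in> H1" "grad_bounded_by \<Omega> u M" and v: "v \<in> H1" and M: "0 \<le> M"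
  shows "\<bar>Bt w u v - Bt w' u v\<bar> \<le> 2 * C * (M + 1) * L2_norm \<Omega> (w - w') * H1_norm \<Omega> v"
proof -
  let ?F = "\<lambda>w x. \<alpha> x (w x) *v weak_grad \<Omega> u x + \<beta> x (w x)"
  let ?G = "\<lambda>w x. \<gamma> x (w x) \<bullet> weak_grad \<Omega> u x + g x (w x)"
  note s = grad_sqint[OF u(1)]
  note f = flux_sqint[OF w(1) s] flux_sqint[OF w(2) s]
  have dw: "sqint \<Omega> (w - w')" using sqint_diff[OF w] by (simp add: fun_diff_def)
  have ae: "AE x in lebesgue_on \<Omega>. x \<in> \<Omega> \<and> norm (weak_grad \<Omega> u x) \<le> M"
    by (rule AE_conjI[OF AE_domain u(2)[unfolded grad_bounded_by_def]])
  have C: "0 \<le> C * (M + 1)" using C_nonneg M by simp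
  have l: "norm (f x (w x) - f x (w' x)) \<le> C * \<bar>w x - w' x\<bar>" if "lip_coeff C f" "x \<in> \<Omega>"
    for x and f :: "real^'n \<Rightarrow> real \<Rightarrow> 'b::euclidean_space"
    using that by (simp add: lip_coeff_def)
  have "L2_norm \<Omega> (\<lambda>x. ?F w x - ?F w' x) \<le> (C * (M + 1)) * L2_norm \<Omega> (w - w')"
  proof (rule L2_norm_le[OF sqint_diff[OF f(1,3)] dw C])
    show "AE x in lebesgue_on \<Omega>. norm (?F w x - ?F w' x) \<le> (C * (M + 1)) * norm ((w - w') x)"
      using ae
    proof eventually_elim
      case (elim x)
      have "norm (?F w x - ?F w' x) = norm ((\<alpha> x (w x) - \<alpha> x (w' x)) *v weak_grad \<Omega> u x + (\<beta> x (w x) - \<beta> x (w' x)))"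
        by (simp add: matrix_vector_mult_diff_rdistrib algebra_simps)
      also have "\<dots> \<le> norm (\<alpha> x (w x) - \<alpha> x (w' x)) * norm (weak_grad \<Omega> u x) + norm (\<beta> x (w x) - \<beta> x (w' x))"
        by (rule order_trans[OF norm_triangle_ineq]) (simp add: norm_matrix_vector_mult)
      also have "\<dots> \<le> (C * \<bar>w x - w' x\<bar>) * M + C * \<bar>w x - w' x\<bar>"
        using elim l[OF lip(1)] l[OF lip(2)] C_nonneg by (intro add_mono mult_mono) auto
      finally show ?case by (simp add: fun_diff_def algebra_simps)
    qed
  qed
  moreover have "L2_norm \<Omega> (\<lambda>x. ?G w x - ?G w' x) \<le> (C * (M + 1)) * L2_norm \<Omega> (w - w')"
  proof (rule L2_norm_le[OF sqint_diff[OF f(2,4)] dw C])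
    show "AE x in lebesgue_on \<Omega>. norm (?G w x - ?G w' x) \<le> (C * (M + 1)) * norm ((w - w') x)"
      using ae
    proof eventually_elim
      case (elim x)
      have "norm (?G w x - ?G w' x) = norm ((\<gamma> x (w x) - \<gamma> x (w' x)) \<bullet> weak_grad \<Omega> u x + (g x (w x) - g x (w' x)))"
        by (simp add: inner_diff_left algebra_simps)
      also have "\<dots> \<le> norm (\<gamma> x (w x) - \<gamma> x (w' x)) * norm (weak_grad \<Omega> u x) + norm (g x (w x) - g x (w' x))"
        by (rule order_trans[OF norm_triangle_ineq]) (simp add: Cauchy_Schwarz_ineq2)
      also have "\<dots> \<le> (C * \<bar>w x - w' x\<bar>) * M + C * \<bar>w x - w' x\<bar>"
        using elim l[OF lip(3)] l[OF lip(4)] C_nonneg by (intro add_mono mult_mono) auto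
      finally show ?case by (simp add: fun_diff_def algebra_simps)
    qed
  qed
  ultimately have "L2_norm \<Omega> (\<lambda>x. ?F w x - ?F w' x) + L2_norm \<Omega> (\<lambda>x. ?G w x - ?G w' x)
      \<le> 2 * C * (M + 1) * L2_norm \<Omega> (w - w')" by simp
  then have "\<bar>pairing (\<lambda>x. ?F w x - ?F w' x) (\<lambda>x. ?G w x - ?G w' x) v\<bar> \<le> 2 * C * (M + 1) * L2_norm \<Omega> (w - w') * H1_norm \<Omega> v"
    using f v by (intro pairing_bound sqint_diff)
  then show ?thesis unfolding Bt_pairing using pairing_diff[OF f(1,2) f(3,4) v] by simp
qed

lemma Bt_bound:
  assumes w: "sqint \<Omega> w" and u: "u \<in> H1" and v: "v \<in> H1"
  shows "\<bar>Bt w u v\<bar> \<le> 2 * C * (H1_norm \<Omega> u + L2_norm \<Omega> (\<lambda>x. 1::real)) * H1_norm \<Omega> v"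
proof -
  note s = grad_sqint[OF u]
  have one: "sqint \<Omega> (\<lambda>x. 1::real)" by (rule sqint_one)
  have c: "L2_norm \<Omega> (\<lambda>x. f x (w x)) \<le> C * L2_norm \<Omega> (\<lambda>x. 1::real)" if "lip_coeff C f"
    for f :: "real^'n \<Rightarrow> real \<Rightarrow> 'b::euclidean_space"
  proof -
    have ae: "AE x in lebesgue_on \<Omega>. norm (f x (w x)) \<le> C * norm (1::real)"
    proof (rule AE_domain)
      fix x assume "x \<in> \<Omega>"
      then show "norm (f x (w x)) \<le> C * norm (1::real)" using that unfolding lip_coeff_def by auto
    qed
    show ?thesis
      by (rule L2_norm_le[where G = "\<lambda>x. 1::real", OF coeff_sqint[OF that w] one C_nonneg ae])
  qed
  have n: "L2_norm \<Omega> (\<lambda>x. F x + G x) \<le> L2_norm \<Omega> F + L2_norm \<Omega> G" if "sqint \<Omega> F" "sqint \<Omega> G"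
    for F G :: "real^'n \<Rightarrow> 'b::euclidean_space"
    using L2.nrm_triangle[of F \<Omega> G] that unfolding L2_nrm plus_fun_def by blast
  have g: "C * L2_norm \<Omega> (weak_grad \<Omega> u) \<le> C * H1_norm \<Omega> u" using C_nonneg grad_le_H1 by (rule mult_left_mono[rotated])
  have "L2_norm \<Omega> (\<lambda>x. \<alpha> x (w x) *v weak_grad \<Omega> u x + \<beta> x (w x))
      + L2_norm \<Omega> (\<lambda>x. \<gamma> x (w x) \<bullet> weak_grad \<Omega> u x + g x (w x))
      \<le> 2 * (C * H1_norm \<Omega> u + C * L2_norm \<Omega> (\<lambda>x. 1::real))"
    unfolding mult_2
    by (rule add_mono[OF
      order_trans[OF n[OF lin_flux_sqint(1)[OF w s] coeff_sqint[OF lip(2) w]]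
        add_mono[OF order_trans[OF lin_flux_sqint(2)[OF w s] g] c[OF lip(2)]]]
      order_trans[OF n[OF lin_flux_sqint(3)[OF w s] coeff_sqint[OF lip(4) w]]
        add_mono[OF order_trans[OF lin_flux_sqint(4)[OF w s] g] c[OF lip(4)]]]])
  also have "\<dots> = 2 * C * (H1_norm \<Omega> u + L2_norm \<Omega> (\<lambda>x. 1::real))" by (simp add: algebra_simps)
  finally show ?thesis unfolding Bt_pairing by (rule pairing_bound[OF flux_sqint[OF w s] v])
qed

end

section \<open>Time derivatives\<close>

text \<open>Differentiability in norm implies that of all scalar products; conversely, scalar products suffice
  for a Lipschitz bound in norm, by the mean value theorem.\<close>

lemma (in semi_inner) weak_deriv_of_norm_limit:
  assumes F: "\<And>s. s \<in> I \<Longrightarrow> F s \<in> S" "F' \<in> S" and t: "t \<in> I" and w: "w \<in> S"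
    and lim: "((\<lambda>s. nrm ((1 / (s - t)) *\<^sub>R (F s - F t) - F')) \<longlongrightarrow> 0) (at t within I)"
  shows "((\<lambda>s. b (F s) w) has_real_derivative b F' w) (at t within I)"
proof -
  have "((\<lambda>s. (b (F s) w - b (F t) w) / (s - t) - b F' w) \<longlongrightarrow> 0) (at t within I)"
  proof (rule Lim_null_comparison)
    show "\<forall>\<^sub>F s in at t within I. norm ((b (F s) w - b (F t) w) / (s - t) - b F' w)
        \<le> nrm ((1 / (s - t)) *\<^sub>R (F s - F t) - F') * nrm w"
      unfolding eventually_at_topological
    proof (intro exI[of _ UNIV] conjI ballI impI open_UNIV UNIV_I)
      fix s assume "s \<in> I"
      have m: "F s - F t \<in> S" using F t \<open>s \<in> I\<close> by auto
      have "(b (F s) w - b (F t) w) / (s - t) - b F' w = b ((1 / (s - t)) *\<^sub>R (F s - F t) - F') w"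
        using F t w m \<open>s \<in> I\<close> mem_intros(3)[OF m, of "1 / (s - t)"]
        by (simp add: minus_left[of _ F'] scale_left minus_left[of "F s"])
      then show "norm ((b (F s) w - b (F t) w) / (s - t) - b F' w)
          \<le> nrm ((1 / (s - t)) *\<^sub>R (F s - F t) - F') * nrm w"
        using cauchy_schwarz[of "(1 / (s - t)) *\<^sub>R (F s - F t) - F'" w] m F(2) w mem_intros(3)[OF m, of "1 / (s - t)"]
        by auto
    qed
    show "((\<lambda>s. nrm ((1 / (s - t)) *\<^sub>R (F s - F t) - F') * nrm w) \<longlongrightarrow> 0) (at t within I)"
      using tendsto_mult_left_zero[OF lim] .
  qed
  then show ?thesis unfolding has_field_derivative_iff by (rule Lim_null[THEN iffD2])
qed

lemma (in semi_inner) lipschitz_of_weak_deriv: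
  assumes F: "\<And>s. s \<in> I \<Longrightarrow> F s \<in> S" "\<And>s. s \<in> I \<Longrightarrow> F' s \<in> S" and I: "convex I"
    and d: "\<And>t w. t \<in> I \<Longrightarrow> w \<in> S \<Longrightarrow> ((\<lambda>s. b (F s) w) has_real_derivative b (F' t) w) (at t within I)"
    and M: "\<And>t. t \<in> I \<Longrightarrow> nrm (F' t) \<le> M" and st: "s \<in> I" "t \<in> I"
  shows "nrm (F t - F s) \<le> M * \<bar>t - s\<bar>"
proof -
  define w where "w = F t - F s"
  have w: "w \<in> S" using F st by (auto simp: w_def)
  have M0: "0 \<le> M" using M[OF st(1)] nrm_nonneg[OF F(2)[OF st(1)]] by linarith
  have "norm (b (F t) w - b (F s) w) \<le> (M * nrm w) * norm (t - s)"
  proof (rule field_differentiable_bound[OF I _ _ st(2) st(1)])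
    fix z assume z: "z \<in> I"
    show "((\<lambda>s. b (F s) w) has_real_derivative b (F' z) w) (at z within I)" using d[OF z w] .
    have "\<bar>b (F' z) w\<bar> \<le> nrm (F' z) * nrm w" using cauchy_schwarz F(2)[OF z] w by blast
    also have "\<dots> \<le> M * nrm w" using M[OF z] w by (intro mult_right_mono) auto
    finally show "norm (b (F' z) w) \<le> M * nrm w" by simp
  qed
  moreover have "b (F t) w - b (F s) w = b w w"
    using minus_left[of "F t" "F s" w] F st w by (simp add: w_def)
  ultimately have "nrm w * nrm w \<le> (M * \<bar>t - s\<bar>) * nrm w"
    using nrm_sq[OF w] nonneg[OF w] by (simp add: power2_eq_square algebra_simps)
  then have "nrm w \<le> M * \<bar>t - s\<bar>"
  proof (cases "nrm w = 0")
    case False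
    then have "0 < nrm w" using nrm_nonneg[OF w] by linarith
    with \<open>nrm w * nrm w \<le> (M * \<bar>t - s\<bar>) * nrm w\<close> show ?thesis by simp
  qed (use M0 in simp)
  then show ?thesis by (simp add: w_def)
qed

lemma L2_time_deriv_limit:
  assumes d: "has_L2_time_deriv \<Omega> T F F'" and t: "t \<in> {0..T}"
  shows "((\<lambda>s. L2_norm \<Omega> ((1 / (s - t)) *\<^sub>R (F s - F t) - F' t)) \<longlongrightarrow> 0) (at t within {0..T})"
proof -
  have "(\<lambda>x. (F s x - F t x) / (s - t) - F' t x) = (1 / (s - t)) *\<^sub>R (F s - F t) - F' t" for s
    by (auto simp: fun_ops)
  moreover have "((\<lambda>s. L2_norm \<Omega> (\<lambda>x. (F s x - F t x) / (s - t) - F' t x)) \<longlongrightarrow> 0) (at t within {0..T})"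
    using d t unfolding has_L2_time_deriv_def by blast
  ultimately show ?thesis by (simp only:)
qed

lemma L2_time_deriv_sqint:
  assumes "has_L2_time_deriv \<Omega> T F F'" "t \<in> {0..T}" shows "sqint \<Omega> (F t)" "sqint \<Omega> (F' t)"
  using assms by (auto simp: has_L2_time_deriv_def L2_space_sqint)

lemma L2_time_deriv_weak:
  assumes d: "has_L2_time_deriv \<Omega> T F F'" and t: "t \<in> {0..T}" and w: "sqint \<Omega> w"
  shows "((\<lambda>s. L2_inner \<Omega> (F s) w) has_real_derivative L2_inner \<Omega> (F' t) w) (at t within {0..T})"
proof (rule L2.weak_deriv_of_norm_limit)
  show "((\<lambda>s. L2.nrm \<Omega> ((1 / (s - t)) *\<^sub>R (F s - F t) - F' t)) \<longlongrightarrow> 0) (at t within {0..T})"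
    unfolding L2_nrm by (rule L2_time_deriv_limit[OF d t])
qed (use L2_time_deriv_sqint[OF d] t w in auto)

lemma L2_time_lipschitz:
  fixes F F' :: "real \<Rightarrow> real^'n \<Rightarrow> real"
  assumes d: "has_L2_time_deriv \<Omega> T F F'" and M: "\<And>t. t \<in> {0..T} \<Longrightarrow> L2_norm \<Omega> (F' t) \<le> M"
    and st: "s \<in> {0..T}" "t \<in> {0..T}"
  shows "L2_norm \<Omega> (F t - F s) \<le> M * \<bar>t - s\<bar>"
proof -
  have "L2.nrm \<Omega> (F t - F s) \<le> M * \<bar>t - s\<bar>"
  proof (rule L2.lipschitz_of_weak_deriv[where I = "{0..T}" and F' = F'])
    fix t and w :: "real^'n \<Rightarrow> real" assume "t \<in> {0..T}" "w \<in> {F. sqint \<Omega> F}"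
    then show "((\<lambda>s. L2_inner \<Omega> (F s) w) has_real_derivative L2_inner \<Omega> (F' t) w) (at t within {0..T})"
      using L2_time_deriv_weak[OF d] by blast
  next
    show "L2.nrm \<Omega> (F' t) \<le> M" if "t \<in> {0..T}" for t using M[OF that] by (simp only: L2_nrm)
  qed (use L2_time_deriv_sqint[OF d] st in auto)
  then show ?thesis by (simp only: L2_nrm)
qed

text \<open>First order consistency of the backward difference quotient: the function minus its tangent at \<open>t\<close> has
  a derivative of size at most \<open>M (t - s)\<close> on the interval.\<close>

lemma L2_backward_difference:
  fixes F F' F'' :: "real \<Rightarrow> real^'n \<Rightarrow> real"
  assumes d: "has_L2_time_deriv \<Omega> T F F'" and d': "has_L2_time_deriv \<Omega> T F' F''"
    and M: "\<And>t. t \<in> {0..T} \<Longrightarrow> L2_norm \<Omega> (F'' t) \<le> M" and st: "0 \<le> s" "s \<le> t" "t \<le> T"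
  shows "L2_norm \<Omega> (F t - F s - (t - s) *\<^sub>R F' t) \<le> M * (t - s)\<^sup>2"
proof -
  have sub: "{s..t} \<subseteq> {0..T}" and tT: "t \<in> {0..T}" using st by auto
  note sq = L2_time_deriv_sqint[OF d]
  have mem: "sqint \<Omega> (F z - z *\<^sub>R F' t)" "sqint \<Omega> (F' z - F' t)" if "z \<in> {s..t}" for z
    using L2.mem_intros(2)[of "F z" \<Omega> "z *\<^sub>R F' t"] L2.mem_intros(3)[of "F' t" \<Omega> z]
      L2.mem_intros(2)[of "F' z" \<Omega> "F' t"] sq[of z] sq(2)[OF tT] sub that by auto
  have M0: "0 \<le> M" using M[OF tT] L2_norm_nonneg order_trans by blast
  have "L2.nrm \<Omega> ((F t - t *\<^sub>R F' t) - (F s - s *\<^sub>R F' t)) \<le> (M * (t - s)) * \<bar>t - s\<bar>"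
  proof (rule L2.lipschitz_of_weak_deriv[where I = "{s..t}" and F' = "\<lambda>z. F' z - F' t"])
    fix z assume z: "z \<in> {s..t}"
    show "F z - z *\<^sub>R F' t \<in> {F. sqint \<Omega> F}" "F' z - F' t \<in> {F. sqint \<Omega> F}" using mem[OF z] by auto
    have "L2_norm \<Omega> (F' z - F' t) \<le> M * \<bar>z - t\<bar>" using L2_time_lipschitz[OF d' M] z sub tT by blast
    also have "\<dots> \<le> M * (t - s)" using z M0 by (intro mult_left_mono) auto
    finally show "L2.nrm \<Omega> (F' z - F' t) \<le> M * (t - s)" by (simp add: L2_nrm)
    fix w :: "real^'n \<Rightarrow> real" assume "w \<in> {F. sqint \<Omega> F}"
    then have w: "sqint \<Omega> w" by simp
    have "((\<lambda>s. L2_inner \<Omega> (F s) w) has_real_derivative L2_inner \<Omega> (F' z) w) (at z within {s..t})"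
      using L2_time_deriv_weak[OF d _ w, of z] z sub by (meson has_field_derivative_subset subsetD)
    then have "((\<lambda>s. L2_inner \<Omega> (F s) w - s * L2_inner \<Omega> (F' t) w) has_real_derivative
        L2_inner \<Omega> (F' z) w - L2_inner \<Omega> (F' t) w) (at z within {s..t})"
      by (auto intro!: derivative_eq_intros)
    moreover have "L2_inner \<Omega> (F' z) w - L2_inner \<Omega> (F' t) w = L2_inner \<Omega> (F' z - F' t) w"
      using L2.minus_left[of "F' z" \<Omega> "F' t" w] sq(2)[of z] sq(2)[OF tT] z sub w by auto
    moreover have "L2_inner \<Omega> (F y) w - y * L2_inner \<Omega> (F' t) w = L2_inner \<Omega> (F y - y *\<^sub>R F' t) w"
      if "y \<in> {s..t}" for y
      using L2.minus_left[of "F y" \<Omega> "y *\<^sub>R F' t" w] L2.scale_left[of "F' t" \<Omega> w y]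
        L2.mem_intros(3)[of "F' t" \<Omega> y] sq(1)[of y] sq(2)[OF tT] that sub w by auto
    ultimately show "((\<lambda>s. L2_inner \<Omega> (F s - s *\<^sub>R F' t) w) has_real_derivative
        L2_inner \<Omega> (F' z - F' t) w) (at z within {s..t})"
      using z by (subst has_field_derivative_cong_eventually[symmetric, where f = "\<lambda>s. L2_inner \<Omega> (F s) w - s * L2_inner \<Omega> (F' t) w"])
        (auto simp: eventually_at_topological)
  qed (use st in auto)
  moreover have "(F t - t *\<^sub>R F' t) - (F s - s *\<^sub>R F' t) = F t - F s - (t - s) *\<^sub>R F' t"
    by (simp add: algebra_simps)
  ultimately show ?thesis using st by (simp add: L2_nrm power2_eq_square mult.assoc)
qed

lemma finite_dim_space_span:
  assumes "finite_dim_space S" obtains B where "finite B" "S = span B"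
proof -
  obtain B where B: "finite B" "S = {f. \<exists>c. f = (\<lambda>x. \<Sum>b\<in>B. c b * b x)}"
    using assms by (auto simp: finite_dim_space_def)
  have "(\<lambda>x. \<Sum>b\<in>B. c b * b x) = (\<Sum>b\<in>B. c b *\<^sub>R b)" for c
  proof
    show "(\<Sum>b\<in>B. c b * b x) = (\<Sum>b\<in>B. c b *\<^sub>R b) x" for x
      using B(1) by (induction B rule: finite_induct) (auto simp: fun_ops)
  qed
  then have "S = range (\<lambda>c. \<Sum>b\<in>B. c b *\<^sub>R b)" using B(2) by auto
  also have "\<dots> = span B" by (rule span_finite[OF B(1), symmetric])
  finally show ?thesis using that B(1) by blast
qed

context domain
begin

lemma semi_inner_subset:
  assumes "semi_inner S b" "subspace S'" "S' \<subseteq> S" shows "semi_inner S' b"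
proof -
  interpret s: semi_inner S b by fact
  have m: "x \<in> S" if "x \<in> S'" for x using that assms(3) by blast
  show ?thesis
    by standard (rule assms(2), rule s.sym[OF m m], assumption+, rule s.nonneg[OF m], assumption,
      rule s.add_left[OF m m m], assumption+, rule s.scale_left[OF m m], assumption+)
qed

lemma semi_inner_L2_H1: "semi_inner H1 (L2_inner \<Omega>)"
  using semi_inner_subset[OF semi_inner_L2 H1_subspace] H1_sqint by blast

text \<open>On a finite-dimensional space of Sobolev functions the \<open>L\<^sup>2\<close> norm dominates the norm of the gradient.  The constant
  depends on the space and serves only to pass differentiability in time to the gradient; the final bound does not
  involve it.\<close>

lemma grad_time_lipschitz:
  assumes S: "finite_dim_space S" "S \<subseteq> H1" and d: "has_L2_time_deriv \<Omega> T V Vt"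
    and V: "\<And>t. t \<in> {0..T} \<Longrightarrow> V t \<in> S" "\<And>t. t \<in> {0..T} \<Longrightarrow> Vt t \<in> S"
    and M: "\<And>t. t \<in> {0..T} \<Longrightarrow> L2_norm \<Omega> (weak_grad \<Omega> (Vt t)) \<le> M" and st: "s \<in> {0..T}" "t \<in> {0..T}"
  shows "L2_norm \<Omega> (weak_grad \<Omega> (V t - V s)) \<le> M * \<bar>t - s\<bar>"
proof -
  obtain B where B: "finite B" "S = span B" using finite_dim_space_span S(1) by blast
  have sub: "subspace S" using B by simp
  let ?q = "\<lambda>u v. L2_inner \<Omega> (weak_grad \<Omega> u) (weak_grad \<Omega> v)"
  interpret p: semi_inner S "L2_inner \<Omega>" using semi_inner_subset[OF semi_inner_L2_H1 sub S(2)] .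
  interpret q: semi_inner S ?q using semi_inner_subset[OF semi_inner_grad sub S(2)] .
  have qn: "q.nrm x = L2_norm \<Omega> (weak_grad \<Omega> x)" and pn: "p.nrm x = L2_norm \<Omega> x" for x
    by (simp_all add: q.nrm_def p.nrm_def L2_norm_def)
  have "\<exists>C\<ge>0. \<forall>x\<in>S. sqrt (?q x x) \<le> C * sqrt (L2_inner \<Omega> x x)"
  proof (rule finite_dim_norm_bound[OF p.semi_inner_axioms q.semi_inner_axioms B(2,1)])
    fix x assume "x \<in> S" "L2_inner \<Omega> x x = 0"
    then have "L2_norm \<Omega> (weak_grad \<Omega> x) = 0" using S(2) by (intro grad_null) (auto simp: L2_norm_def)
    then show "?q x x = 0" by (simp flip: L2_norm_sq)
  qed
  then obtain C where C: "\<And>x. x \<in> S \<Longrightarrow> q.nrm x \<le> C * p.nrm x" by (auto simp: q.nrm_def p.nrm_def)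
  have "q.nrm (V t - V s) \<le> M * \<bar>t - s\<bar>"
  proof (rule q.lipschitz_of_weak_deriv[of "{0..T}" V Vt])
    fix \<tau> w assume \<tau>: "\<tau> \<in> {0..T}" and w: "w \<in> S"
    show "((\<lambda>s. ?q (V s) w) has_real_derivative ?q (Vt \<tau>) w) (at \<tau> within {0..T})"
    proof (rule q.weak_deriv_of_norm_limit)
      show "((\<lambda>s. q.nrm ((1 / (s - \<tau>)) *\<^sub>R (V s - V \<tau>) - Vt \<tau>)) \<longlongrightarrow> 0) (at \<tau> within {0..T})"
      proof (rule Lim_null_comparison)
        show "((\<lambda>s. C * p.nrm ((1 / (s - \<tau>)) *\<^sub>R (V s - V \<tau>) - Vt \<tau>)) \<longlongrightarrow> 0) (at \<tau> within {0..T})"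
          using tendsto_mult_right_zero[OF L2_time_deriv_limit[OF d \<tau>]] by (simp add: pn)
        show "\<forall>\<^sub>F s in at \<tau> within {0..T}. norm (q.nrm ((1 / (s - \<tau>)) *\<^sub>R (V s - V \<tau>) - Vt \<tau>))
            \<le> C * p.nrm ((1 / (s - \<tau>)) *\<^sub>R (V s - V \<tau>) - Vt \<tau>)"
          unfolding eventually_at_topological
        proof (intro exI[of _ UNIV] conjI ballI impI open_UNIV UNIV_I)
          fix s assume "s \<in> {0..T}"
          then have "(1 / (s - \<tau>)) *\<^sub>R (V s - V \<tau>) - Vt \<tau> \<in> S"
            using V \<tau> by (intro q.mem_intros) auto
          from C[OF this] q.nrm_nonneg[OF this] show "norm (q.nrm ((1 / (s - \<tau>)) *\<^sub>R (V s - V \<tau>) - Vt \<tau>))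
            \<le> C * p.nrm ((1 / (s - \<tau>)) *\<^sub>R (V s - V \<tau>) - Vt \<tau>)" by simp
        qed
      qed
    qed (use V \<tau> w in auto)
  qed (use V M st in \<open>auto simp: qn\<close>)
  then show ?thesis by (simp add: qn)
qed

lemma grad_bounded_L2:
  assumes u: "u \<in> H1" "grad_bounded_by \<Omega> u M" and M: "0 \<le> M"
  shows "L2_norm \<Omega> (weak_grad \<Omega> u) \<le> M * L2_norm \<Omega> (\<lambda>x. 1::real)"
  using u(2) by (intro L2_norm_le[OF grad_sqint[OF u(1)] sqint_one M]) (simp add: grad_bounded_by_def)

section \<open>The elliptic operator\<close>

lemma elliptic_coeff:
  fixes f :: "real^'n \<Rightarrow> real \<Rightarrow> 'b::euclidean_space"
  assumes W: "open W" "closure \<Omega> \<times> {0..T} \<subseteq> W" "smooth_open W (\<lambda>(x, t). f x t)"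
  shows "\<exists>C\<ge>0. (\<forall>t\<in>{0..T}. (\<lambda>x. f x t) \<in> borel_measurable (lebesgue_on \<Omega>)) \<and>
    (\<forall>x\<in>\<Omega>. \<forall>t\<in>{0..T}. norm (f x t) \<le> C) \<and>
    (\<forall>x\<in>\<Omega>. \<forall>s\<in>{0..T}. \<forall>t\<in>{0..T}. norm (f x t - f x s) \<le> C * \<bar>t - s\<bar>)"
proof -
  define F where "F = (\<lambda>(x, t). f x t)"
  define Q where "Q = closure \<Omega> \<times> {0..T}"
  have sm: "smooth_open W F" using W(3) by (simp add: F_def)
  have Q: "compact Q" "Q \<subseteq> W" using bounded_domain W(2) by (auto simp: Q_def intro!: compact_Times)
  have inQ: "(x, t) \<in> Q" if "x \<in> \<Omega>" "t \<in> {0..T}" for x t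
    using that closure_subset by (auto simp: Q_def)
  have cont: "continuous_on Q F" "continuous_on Q (\<lambda>z. frechet_derivative F (at z) (0, 1))"
    using smooth_open_diff[OF sm] Q(2) by (auto intro: differentiable_imp_continuous_on continuous_on_subset)
  have "bounded (F ` Q)" "bounded ((\<lambda>z. frechet_derivative F (at z) (0, 1)) ` Q)"
    using cont Q(1) by (auto intro!: compact_imp_bounded compact_continuous_image)
  then obtain C1 C2 where C1: "\<And>z. z \<in> Q \<Longrightarrow> norm (F z) \<le> C1"
      and C2: "\<And>z. z \<in> Q \<Longrightarrow> norm (frechet_derivative F (at z) (0, 1)) \<le> C2"
    unfolding bounded_iff by auto
  define C where "C = \<bar>C1\<bar> + \<bar>C2\<bar>"
  have "(\<lambda>x. f x t) \<in> borel_measurable (lebesgue_on \<Omega>)" if t: "t \<in> {0..T}" for t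
  proof -
    have "continuous_on \<Omega> (\<lambda>x. F (x, t))"
      by (rule continuous_on_compose2[OF cont(1)]) (use inQ t in \<open>auto intro!: continuous_intros\<close>)
    then show ?thesis using open_domain
      by (intro continuous_imp_measurable_on_sets_lebesgue) (auto simp: F_def)
  qed
  moreover have "norm (f x t) \<le> C" if "x \<in> \<Omega>" "t \<in> {0..T}" for x t
    using C1[OF inQ[OF that]] by (simp add: F_def C_def)
  moreover have "norm (f x t - f x s) \<le> C * \<bar>t - s\<bar>" if x: "x \<in> \<Omega>" "s \<in> {0..T}" "t \<in> {0..T}" for x s t
  proof -
    have "norm (F (x, t) - F (x, s)) \<le> C * \<bar>t - s\<bar>"
    proof (rule lipschitz_last_coord[OF W(1) smooth_open_diff(1)[OF sm], of "{0..T}"])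
      fix t assume t: "t \<in> {0..T}"
      show "(x, t) \<in> W" using inQ[OF x(1) t] Q(2) by auto
      show "norm (frechet_derivative F (at (x, t)) (0, 1)) \<le> C" using C2[OF inQ[OF x(1) t]] by (simp add: C_def)
    qed (use x in auto)
    then show ?thesis by (simp add: F_def)
  qed
  ultimately show ?thesis by (intro exI[of _ C]) (auto simp: C_def)
qed

end

text \<open>The data of the elliptic operator on the time interval: \<open>CA\<close> bounds the coefficients and their Lipschitz
  constants in time, and \<open>\<nu>0\<close> is the coercivity constant.\<close>

locale elliptic = domain \<Omega> for \<Omega> :: "(real^'n) set" +
  fixes a :: "real^'n \<Rightarrow> real \<Rightarrow> real^'n^'n" and a0 :: "real^'n \<Rightarrow> real \<Rightarrow> real" and T CA \<nu>0 :: real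
  assumes CA: "0 \<le> CA" and nu: "0 < \<nu>0"
    and a_meas: "t \<in> {0..T} \<Longrightarrow> (\<lambda>x. a x t) \<in> borel_measurable (lebesgue_on \<Omega>)"
      "t \<in> {0..T} \<Longrightarrow> (\<lambda>x. a0 x t) \<in> borel_measurable (lebesgue_on \<Omega>)"
    and a_bound: "x \<in> \<Omega> \<Longrightarrow> t \<in> {0..T} \<Longrightarrow> norm (a x t) \<le> CA" "x \<in> \<Omega> \<Longrightarrow> t \<in> {0..T} \<Longrightarrow> norm (a0 x t) \<le> CA"
    and a_lip: "x \<in> \<Omega> \<Longrightarrow> s \<in> {0..T} \<Longrightarrow> t \<in> {0..T} \<Longrightarrow> norm (a x t - a x s) \<le> CA * \<bar>t - s\<bar>"
      "x \<in> \<Omega> \<Longrightarrow> s \<in> {0..T} \<Longrightarrow> t \<in> {0..T} \<Longrightarrow> norm (a0 x t - a0 x s) \<le> CA * \<bar>t - s\<bar>"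
    and a_sym: "x \<in> \<Omega> \<Longrightarrow> t \<in> {0..T} \<Longrightarrow> transpose (a x t) = a x t"
    and coercive: "t \<in> {0..T} \<Longrightarrow> v \<in> H10_space \<Omega> \<Longrightarrow> \<nu>0 * (H1_norm \<Omega> v)\<^sup>2 \<le> A_form \<Omega> a a0 t v v"

lemma (in domain) elliptic_exists:
  assumes ell: "elliptic_operator \<Omega> T a a0"
  shows "\<exists>CA \<nu>0. elliptic \<Omega> a a0 T CA \<nu>0"
proof -
  obtain W where W: "open W" "closure \<Omega> \<times> {0..T} \<subseteq> W" "smooth_open W (\<lambda>(x, t). a x t)" "smooth_open W (\<lambda>(x, t). a0 x t)"
    using ell unfolding elliptic_operator_def by blast
  obtain \<nu>0 where nu: "\<nu>0 > 0" "\<And>t v. t \<in> {0..T} \<Longrightarrow> v \<in> H10_space \<Omega> \<Longrightarrow> A_form \<Omega> a a0 t v v \<ge> \<nu>0 * (H1_norm \<Omega> v)\<^sup>2"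
    using ell unfolding elliptic_operator_def by blast
  obtain C1 where C1: "C1 \<ge> 0" "\<And>t. t\<in>{0..T} \<Longrightarrow> (\<lambda>x. a x t) \<in> borel_measurable (lebesgue_on \<Omega>)"
      "\<And>x t. x \<in> \<Omega> \<Longrightarrow> t\<in>{0..T} \<Longrightarrow> norm (a x t) \<le> C1"
      "\<And>x s t. x \<in> \<Omega> \<Longrightarrow> s\<in>{0..T} \<Longrightarrow> t\<in>{0..T} \<Longrightarrow> norm (a x t - a x s) \<le> C1 * \<bar>t - s\<bar>"
    using elliptic_coeff[OF W(1,2,3)] by blast
  obtain C2 where C2: "C2 \<ge> 0" "\<And>t. t\<in>{0..T} \<Longrightarrow> (\<lambda>x. a0 x t) \<in> borel_measurable (lebesgue_on \<Omega>)"
      "\<And>x t. x \<in> \<Omega> \<Longrightarrow> t\<in>{0..T} \<Longrightarrow> norm (a0 x t) \<le> C2"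
      "\<And>x s t. x \<in> \<Omega> \<Longrightarrow> s\<in>{0..T} \<Longrightarrow> t\<in>{0..T} \<Longrightarrow> norm (a0 x t - a0 x s) \<le> C2 * \<bar>t - s\<bar>"
    using elliptic_coeff[OF W(1,2,4)] by blast
  have sym: "transpose (a x t) = a x t" if "x \<in> \<Omega>" "t \<in> {0..T}" for x t
    using ell that closure_subset[of \<Omega>] unfolding elliptic_operator_def by blast
  have le: "C1 * \<bar>d\<bar> \<le> (C1 + C2) * \<bar>d\<bar>" "C2 * \<bar>d\<bar> \<le> (C1 + C2) * \<bar>d\<bar>" for d :: real
    using C1(1) C2(1) by (auto intro!: mult_right_mono)
  have "elliptic \<Omega> a a0 T (C1 + C2) \<nu>0"
  proof
    show "norm (a x t) \<le> C1 + C2" "norm (a0 x t) \<le> C1 + C2" if "x \<in> \<Omega>" "t \<in> {0..T}" for x t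
      using C1(1) C1(3)[OF that] C2(1) C2(3)[OF that] by linarith+
    show "norm (a x t - a x s) \<le> (C1 + C2) * \<bar>t - s\<bar>" "norm (a0 x t - a0 x s) \<le> (C1 + C2) * \<bar>t - s\<bar>"
      if "x \<in> \<Omega>" "s \<in> {0..T}" "t \<in> {0..T}" for x s t
      using order_trans[OF C1(4)[OF that] le(1)] order_trans[OF C2(4)[OF that] le(2)] by auto
  qed (use C1 C2 nu sym in auto)
  then show ?thesis by blast
qed

context elliptic
begin

abbreviation A where "A \<equiv> A_form \<Omega> a a0"

lemma A_pairing: "A t u v = pairing (\<lambda>x. a x t *v weak_grad \<Omega> u x) (\<lambda>x. a0 x t * u x) v"
  by (simp add: A_form_def pairing_def)

lemma A_flux_sqint:
  assumes t: "t \<in> {0..T}" and u: "u \<in> H1"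
  shows "sqint \<Omega> (\<lambda>x. a x t *v weak_grad \<Omega> u x)" "sqint \<Omega> (\<lambda>x. a0 x t * u x)"
  using sqint_mult(1)[OF a_meas(1)[OF t] a_bound(1)[OF _ t] grad_sqint[OF u] CA]
    sqint_inner_mult(1)[OF a_meas(2)[OF t] a_bound(2)[OF _ t] H1_sqint[OF u] CA] by simp_all

lemma A_sym:
  assumes t: "t \<in> {0..T}" shows "A t u v = A t v u"
proof -
  have "L2_inner \<Omega> (\<lambda>x. a x t *v weak_grad \<Omega> u x) (weak_grad \<Omega> v) = L2_inner \<Omega> (\<lambda>x. a x t *v weak_grad \<Omega> v x) (weak_grad \<Omega> u)"
    unfolding L2_inner_def
  proof (rule Bochner_Integration.integral_cong)
    fix x assume "x \<in> space (lebesgue_on \<Omega>)"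
    then have s: "transpose (a x t) = a x t" using a_sym t by simp
    have "(a x t *v weak_grad \<Omega> u x) \<bullet> weak_grad \<Omega> v x = weak_grad \<Omega> u x \<bullet> (transpose (a x t) *v weak_grad \<Omega> v x)"
      by (metis dot_lmul_matrix inner_commute transpose_matrix_vector transpose_transpose)
    then show "(a x t *v weak_grad \<Omega> u x) \<bullet> weak_grad \<Omega> v x = (a x t *v weak_grad \<Omega> v x) \<bullet> weak_grad \<Omega> u x"
      using s by (simp add: inner_commute)
  qed simp
  moreover have "L2_inner \<Omega> (\<lambda>x. a0 x t * u x) v = L2_inner \<Omega> (\<lambda>x. a0 x t * v x) u"
    by (simp add: L2_inner_def ac_simps)
  ultimately show ?thesis by (simp add: A_form_def)
qed

lemma A_lin_right:
  assumes "t \<in> {0..T}" "u \<in> H1" "v \<in> H1" "v' \<in> H1"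
  shows "A t u (v + c *\<^sub>R v') = A t u v + c * A t u v'"
  unfolding A_pairing by (rule pairing_lin[OF A_flux_sqint[OF assms(1,2)] assms(3,4)])

lemma A_bound:
  assumes t: "t \<in> {0..T}" and u: "u \<in> H1" and v: "v \<in> H1"
  shows "\<bar>A t u v\<bar> \<le> 2 * CA * H1_norm \<Omega> u * H1_norm \<Omega> v"
  unfolding A_pairing
proof (rule pairing_bound[OF A_flux_sqint[OF t u] v])
  have "L2_norm \<Omega> (\<lambda>x. a x t *v weak_grad \<Omega> u x) \<le> CA * H1_norm \<Omega> u"
    using sqint_mult(2)[OF a_meas(1)[OF t] a_bound(1)[OF _ t] grad_sqint[OF u] CA]
      mult_left_mono[OF grad_le_H1 CA, of u] by linarith
  moreover have "L2_norm \<Omega> (\<lambda>x. a0 x t * u x) \<le> CA * H1_norm \<Omega> u"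
    using sqint_inner_mult(2)[OF a_meas(2)[OF t] a_bound(2)[OF _ t] H1_sqint[OF u] CA]
      mult_left_mono[OF L2_le_H1 CA, of u] by simp
  ultimately show "L2_norm \<Omega> (\<lambda>x. a x t *v weak_grad \<Omega> u x) + L2_norm \<Omega> (\<lambda>x. a0 x t * u x)
      \<le> 2 * CA * H1_norm \<Omega> u" by simp
qed

lemma A_lipschitz:
  assumes st: "s \<in> {0..T}" "t \<in> {0..T}" and u: "u \<in> H1" and v: "v \<in> H1"
  shows "\<bar>A t u v - A s u v\<bar> \<le> 2 * (CA * \<bar>t - s\<bar>) * H1_norm \<Omega> u * H1_norm \<Omega> v"
proof -
  note f = A_flux_sqint[OF st(2) u] A_flux_sqint[OF st(1) u]
  have c: "0 \<le> CA * \<bar>t - s\<bar>" using CA by simp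
  have m: "(\<lambda>x. a x t - a x s) \<in> borel_measurable (lebesgue_on \<Omega>)" "(\<lambda>x. a0 x t - a0 x s) \<in> borel_measurable (lebesgue_on \<Omega>)"
    using a_meas st by auto
  have "A t u v - A s u v = pairing (\<lambda>x. a x t *v weak_grad \<Omega> u x - a x s *v weak_grad \<Omega> u x)
      (\<lambda>x. a0 x t * u x - a0 x s * u x) v"
    unfolding A_pairing by (rule pairing_diff[OF f v, symmetric])
  also have "\<dots> = pairing (\<lambda>x. (a x t - a x s) *v weak_grad \<Omega> u x) (\<lambda>x. (a0 x t - a0 x s) \<bullet> u x) v"
    by (simp add: matrix_vector_mult_diff_rdistrib algebra_simps)
  finally have eq: "A t u v - A s u v = \<dots>" .
  show ?thesis unfolding eq
  proof (rule pairing_bound)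
    note l1 = sqint_mult[OF m(1) a_lip(1)[OF _ st] grad_sqint[OF u] c]
    note l2 = sqint_inner_mult[OF m(2) a_lip(2)[OF _ st] H1_sqint[OF u] c]
    show "sqint \<Omega> (\<lambda>x. (a x t - a x s) *v weak_grad \<Omega> u x)" by (rule l1(1))
    show "sqint \<Omega> (\<lambda>x. (a0 x t - a0 x s) \<bullet> u x)" by (rule l2(1))
    have "L2_norm \<Omega> (\<lambda>x. (a x t - a x s) *v weak_grad \<Omega> u x) \<le> CA * \<bar>t - s\<bar> * H1_norm \<Omega> u"
      using order_trans[OF l1(2) mult_left_mono[OF grad_le_H1 c]] .
    moreover have "L2_norm \<Omega> (\<lambda>x. (a0 x t - a0 x s) \<bullet> u x) \<le> CA * \<bar>t - s\<bar> * H1_norm \<Omega> u"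
      using order_trans[OF l2(2) mult_left_mono[OF L2_le_H1 c]] .
    ultimately show "L2_norm \<Omega> (\<lambda>x. (a x t - a x s) *v weak_grad \<Omega> u x) + L2_norm \<Omega> (\<lambda>x. (a0 x t - a0 x s) \<bullet> u x)
        \<le> 2 * (CA * \<bar>t - s\<bar>) * H1_norm \<Omega> u" by simp
  qed (rule v)
qed

lemma semi_inner_A:
  assumes S: "subspace S" "S \<subseteq> H10_space \<Omega>" and t: "t \<in> {0..T}"
  shows "semi_inner S (A t)"
proof
  fix x y z and c :: real
  assume x: "x \<in> S"
  have H: "v \<in> H1" if "v \<in> S" for v using that S(2) H10_sub_H1 by auto
  have "0 \<le> \<nu>0 * (H1_norm \<Omega> x)\<^sup>2" using nu by simp
  then show "0 \<le> A t x x" using coercive[OF t, of x] x S(2) by auto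
  assume z: "z \<in> S"
  show "A t x z = A t z x" by (rule A_sym[OF t])
  show "A t (c *\<^sub>R x) z = c * A t x z"
    using A_lin_right[OF t H[OF z] H[OF x] H[OF x], of "c - 1"] A_sym[OF t]
    by (simp add: algebra_simps)
  assume y: "y \<in> S"
  show "A t (x + y) z = A t x z + A t y z"
    using A_lin_right[OF t H[OF z] H[OF x] H[OF y], of 1] A_sym[OF t, of z] by simp
qed (rule S(1))

end

section \<open>The memory kernel and its quadrature\<close>

text \<open>A monotone and continuously differentiable quadratic spline that is 0 to the left of 0 and 1 to the right of
  1, with its derivative.\<close>

definition ramp :: "real \<Rightarrow> real" where
  "ramp y = 2 * ((max 0 y)\<^sup>2 - 2 * (max 0 (y - 1/2))\<^sup>2 + (max 0 (y - 1))\<^sup>2)"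

definition ramp' :: "real \<Rightarrow> real" where
  "ramp' y = 4 * (max 0 y - 2 * max 0 (y - 1/2) + max 0 (y - 1))"

lemma ramp_values:
  "y \<le> 0 \<Longrightarrow> ramp y = 0" "1 \<le> y \<Longrightarrow> ramp y = 1"
  by (auto simp: ramp_def max_def power2_eq_square algebra_simps)

lemma ramp'_nonneg: "0 \<le> ramp' y"
  by (auto simp: ramp'_def max_def)

lemma max_square_deriv: "((\<lambda>y. (max 0 (y - c))\<^sup>2) has_real_derivative 2 * max 0 (y - c)) (at (y::real))"
proof -
  consider "y > c" | "y < c" | "y = c" by linarith
  then show ?thesis
  proof cases
    case 1
    have "((\<lambda>y. (y - c)\<^sup>2) has_real_derivative 2 * (y - c)) (at y)"
      by (auto intro!: derivative_eq_intros)
    then have "((\<lambda>y. (max 0 (y - c))\<^sup>2) has_real_derivative 2 * (y - c)) (at y)"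
      by (rule has_field_derivative_transform_within_open[where S = "{c<..}"]) (use 1 in auto)
    then show ?thesis using 1 by (simp add: max_def)
  next
    case 2
    have "((\<lambda>y. 0) has_real_derivative 0) (at y)" by simp
    then have "((\<lambda>y. (max 0 (y - c))\<^sup>2) has_real_derivative 0) (at y)"
      by (rule has_field_derivative_transform_within_open[where S = "{..<c}"]) (use 2 in auto)
    then show ?thesis using 2 by (simp add: max_def)
  next
    case 3
    have "((\<lambda>h::real. (max 0 h)\<^sup>2 / h) \<longlongrightarrow> 0) (at 0)"
    proof (rule Lim_null_comparison)
      show "\<forall>\<^sub>F h in at 0. norm ((max 0 h)\<^sup>2 / h) \<le> \<bar>h::real\<bar>"
        by (intro always_eventually) (auto simp: max_def power2_eq_square)
      show "((\<lambda>h::real. \<bar>h\<bar>) \<longlongrightarrow> 0) (at 0)" by (intro tendsto_rabs_zero tendsto_ident_at)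
    qed
    then show ?thesis using 3 by (simp add: DERIV_def)
  qed
qed

lemma ramp_deriv: "(ramp has_real_derivative ramp' y) (at y)"
proof -
  note * = DERIV_cmult[OF DERIV_add[OF DERIV_diff[OF max_square_deriv[of 0 y]
      DERIV_cmult[OF max_square_deriv[of "1/2" y], of 2]] max_square_deriv[of 1 y]], of 2]
  have "(\<lambda>y. 2 * ((max 0 (y - 0))\<^sup>2 - 2 * (max 0 (y - 1 / 2))\<^sup>2 + (max 0 (y - 1))\<^sup>2)) = ramp"
    by (auto simp: ramp_def)
  moreover have "2 * (2 * max 0 (y - 0) - 2 * (2 * max 0 (y - 1 / 2)) + 2 * max 0 (y - 1)) = ramp' y"
    by (simp add: ramp'_def algebra_simps)
  ultimately show ?thesis using * by simp
qed

lemma ramp_bounds: "0 \<le> ramp y" "ramp y \<le> 1"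
proof -
  have mono: "ramp x \<le> ramp z" if "x \<le> z" for x z
    using that by (rule DERIV_nonneg_imp_nondecreasing) (use ramp_deriv ramp'_nonneg in blast)
  show "0 \<le> ramp y" using mono[of "min y 0" y] ramp_values(1)[of "min y 0"] by simp
  show "ramp y \<le> 1" using mono[of y "max y 1"] ramp_values(2)[of "max y 1"] by simp
qed

lemma sum_cells:
  fixes f :: "real \<Rightarrow> real"
  assumes k: "0 \<le> k" and f: "f integrable_on {0..real n * k}"
  shows "integral {0..real n * k} f = (\<Sum>i=1..n. integral {(real i - 1) * k..real i * k} f)"
  using f
proof (induction n)
  case (Suc n)
  have le: "real n * k \<le> real (Suc n) * k" using k by (intro mult_right_mono) auto
  have "f integrable_on {0..real n * k}"
    using Suc.prems by (rule integrable_on_subinterval) (use le in auto)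
  then have "integral {0..real n * k} f = (\<Sum>i=1..n. integral {(real i - 1) * k..real i * k} f)" by (rule Suc.IH)
  moreover have "integral {0..real n * k} f + integral {real n * k..real (Suc n) * k} f = integral {0..real (Suc n) * k} f"
    using k le Suc.prems by (intro Henstock_Kurzweil_Integration.integral_combine) auto
  ultimately show ?case by simp
qed simp

lemma abel_summation:
  fixes d \<phi> :: "nat \<Rightarrow> real"
  shows "(\<Sum>i=1..n. d i * \<phi> i) = (\<Sum>i=1..n. d i) * \<phi> 1
    + (\<Sum>i\<in>{1..<n}. ((\<Sum>l=1..n. d l) - (\<Sum>l=1..i. d l)) * (\<phi> (Suc i) - \<phi> i))"
proof (induction n)
  case (Suc n)
  have tele: "(\<Sum>i\<in>{1..<Suc n}. \<phi> (Suc i) - \<phi> i) = \<phi> (Suc n) - \<phi> 1"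
    by (induction n) auto
  have "(\<Sum>i\<in>{1..<Suc n}. ((\<Sum>l=1..Suc n. d l) - (\<Sum>l=1..i. d l)) * (\<phi> (Suc i) - \<phi> i))
      = (\<Sum>i\<in>{1..<Suc n}. ((\<Sum>l=1..n. d l) - (\<Sum>l=1..i. d l)) * (\<phi> (Suc i) - \<phi> i) + d (Suc n) * (\<phi> (Suc i) - \<phi> i))"
    by (intro sum.cong) (auto simp: algebra_simps)
  also have "\<dots> = (\<Sum>i\<in>{1..<Suc n}. ((\<Sum>l=1..n. d l) - (\<Sum>l=1..i. d l)) * (\<phi> (Suc i) - \<phi> i))
      + d (Suc n) * (\<phi> (Suc n) - \<phi> 1)"
    by (simp only: sum.distrib sum_distrib_left[symmetric] tele)
  also have "(\<Sum>i\<in>{1..<Suc n}. ((\<Sum>l=1..n. d l) - (\<Sum>l=1..i. d l)) * (\<phi> (Suc i) - \<phi> i))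
      = (\<Sum>i\<in>{1..<n}. ((\<Sum>l=1..n. d l) - (\<Sum>l=1..i. d l)) * (\<phi> (Suc i) - \<phi> i))"
    by (cases n) auto
  finally show ?case using Suc by (simp add: algebra_simps)
qed simp

text \<open>The memory kernel and a quadrature rule for it: \<open>K1\<close> bounds the weights, and \<open>Cq\<close> is the constant of first
  order accuracy.\<close>

locale kernel =
  fixes T :: real and K :: "real \<Rightarrow> real" and \<omega> :: "nat \<Rightarrow> nat \<Rightarrow> nat \<Rightarrow> real" and K1 Cq :: real
  assumes T_pos: "0 < T" and K_int: "K absolutely_integrable_on {0..T}"
    and K1: "0 \<le> K1" and Cq: "0 \<le> Cq"
    and weight_bound: "1 \<le> i \<Longrightarrow> i \<le> n \<Longrightarrow> n \<le> N \<Longrightarrow> \<bar>\<omega> N n i\<bar> \<le> K1"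
    and quad: "1 \<le> n \<Longrightarrow> n \<le> N \<Longrightarrow> continuous_on {0..tgrid T N n} \<phi>' \<Longrightarrow>
      (\<And>s. s \<in> {0..tgrid T N n} \<Longrightarrow> \<bar>\<phi> s\<bar> \<le> M) \<Longrightarrow>
      (\<And>s. s \<in> {0..tgrid T N n} \<Longrightarrow> (\<phi> has_real_derivative \<phi>' s) (at s within {0..tgrid T N n})) \<Longrightarrow>
      \<bar>quad_error T K \<omega> N n \<phi>\<bar> \<le> Cq * (T / real N) * (M + integral {0..tgrid T N n} (\<lambda>s. \<bar>\<phi>' s\<bar>))"

lemma kernel_exists:
  assumes "0 < T" "K absolutely_integrable_on {0..T}" "first_order_weights T K \<omega>"
  shows "\<exists>K1 Cq. kernel T K \<omega> K1 Cq"
proof -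
  note w = assms(3)[unfolded first_order_weights_def]
  obtain K1 where K1: "\<forall>N n i. 1 \<le> i \<and> i \<le> n \<and> n \<le> N \<longrightarrow> \<bar>\<omega> N n i\<bar> \<le> K1"
    using conjunct1[OF w] ..
  obtain C where C: "\<forall>N n \<phi> \<phi>' M. 1 \<le> n \<and> n \<le> N \<and> continuous_on {0..tgrid T N n} \<phi>' \<and>
        (\<forall>s\<in>{0..tgrid T N n}. \<bar>\<phi> s\<bar> \<le> M \<and>
           (\<phi> has_real_derivative \<phi>' s) (at s within {0..tgrid T N n})) \<longrightarrow>
        \<bar>quad_error T K \<omega> N n \<phi>\<bar> \<le> C * (T / real N) * (M + integral {0..tgrid T N n} (\<lambda>s. \<bar>\<phi>' s\<bar>))"
    using conjunct2[OF conjunct2[OF w]] ..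
  have "kernel T K \<omega> \<bar>K1\<bar> \<bar>C\<bar>"
  proof
    fix N n :: nat and \<phi> \<phi>' :: "real \<Rightarrow> real" and M
    assume n: "1 \<le> n" "n \<le> N" and cont: "continuous_on {0..tgrid T N n} \<phi>'"
      and bd: "\<And>s. s \<in> {0..tgrid T N n} \<Longrightarrow> \<bar>\<phi> s\<bar> \<le> M"
      and d: "\<And>s. s \<in> {0..tgrid T N n} \<Longrightarrow> (\<phi> has_real_derivative \<phi>' s) (at s within {0..tgrid T N n})"
    have t0: "0 \<le> tgrid T N n" using assms(1) by (simp add: tgrid_def)
    have "0 \<le> M" using bd[of 0] t0 abs_ge_zero[of "\<phi> 0"] by force
    moreover have "0 \<le> integral {0..tgrid T N n} (\<lambda>s. \<bar>\<phi>' s\<bar>)"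
      using cont by (intro integral_nonneg integrable_continuous_real continuous_intros) auto
    ultimately have p: "0 \<le> (T / real N) * (M + integral {0..tgrid T N n} (\<lambda>s. \<bar>\<phi>' s\<bar>))" using assms(1) by simp
    have "\<bar>quad_error T K \<omega> N n \<phi>\<bar> \<le> C * (T / real N) * (M + integral {0..tgrid T N n} (\<lambda>s. \<bar>\<phi>' s\<bar>))"
      using n cont bd d by (intro C[rule_format]) auto
    also have "\<dots> \<le> \<bar>C\<bar> * (T / real N) * (M + integral {0..tgrid T N n} (\<lambda>s. \<bar>\<phi>' s\<bar>))"
      using mult_right_mono[OF abs_ge_self[of C] p] by (simp add: mult.assoc)
    finally show "\<bar>quad_error T K \<omega> N n \<phi>\<bar> \<le> \<bar>C\<bar> * (T / real N) * (M + integral {0..tgrid T N n} (\<lambda>s. \<bar>\<phi>' s\<bar>))" .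
  next
    fix i n N :: nat assume "1 \<le> i" "i \<le> n" "n \<le> N"
    with K1 have "\<bar>\<omega> N n i\<bar> \<le> K1" by blast
    then show "\<bar>\<omega> N n i\<bar> \<le> \<bar>K1\<bar>" by linarith
  qed (use assms in auto)
  then show ?thesis by blast
qed

context kernel
begin

lemma kernel_reflect:
  assumes ab: "0 \<le> a" "b \<le> t" "t \<le> T"
  shows "(\<lambda>s. K (t - s)) absolutely_integrable_on {a..b}"
proof (cases "0 \<le> t")
  case True
  have K: "K integrable_on cbox 0 t" "(\<lambda>s. norm (K s)) integrable_on cbox 0 t"
    using absolutely_integrable_on_subinterval[OF K_int, of 0 t] ab True
    by (auto simp: absolutely_integrable_on_def)
  have im: "(\<lambda>x::real. - x + t) ` cbox 0 t = {0..t}"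
    by (auto simp: image_iff intro: bexI[of _ "t - x" for x])
  have "(\<lambda>s. K (t - s)) integrable_on {0..t}" "(\<lambda>s. norm (K (t - s))) integrable_on {0..t}"
    using integrable_affinity[OF K(1), of "-1" t] integrable_affinity[OF K(2), of "-1" t] im by auto
  then have "(\<lambda>s. K (t - s)) absolutely_integrable_on {0..t}" by (simp add: absolutely_integrable_on_def)
  then show ?thesis by (rule absolutely_integrable_on_subinterval) (use ab in auto)
next
  case False
  then have "{a..b} = {}" using ab by auto
  then show ?thesis by simp
qed

lemma kernel_product_lebesgue:
  assumes ab: "0 \<le> a" "b \<le> t" "t \<le> T" and \<phi>: "continuous_on {a..b} \<phi>"
  shows "integrable (lebesgue_on {a..b}) (\<lambda>s. K (t - s) * \<phi> s)"
proof -
  have K: "integrable (lebesgue_on {a..b}) (\<lambda>s. K (t - s))"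
    by (rule absolutely_integrable_imp_integrable[OF kernel_reflect[OF ab]]) simp
  have "compact (\<phi> ` {a..b})" using \<phi> by (intro compact_continuous_image) auto
  then obtain B where B: "\<And>s. s \<in> {a..b} \<Longrightarrow> norm (\<phi> s) \<le> B"
    using compact_imp_bounded bounded_iff by (metis imageI)
  show ?thesis
  proof (rule Bochner_Integration.integrable_bound)
    show "integrable (lebesgue_on {a..b}) (\<lambda>s. B * K (t - s))" using K by simp
    have "\<phi> \<in> borel_measurable (lebesgue_on {a..b})"
      using \<phi> by (intro continuous_imp_measurable_on_sets_lebesgue) auto
    then show "(\<lambda>s. K (t - s) * \<phi> s) \<in> borel_measurable (lebesgue_on {a..b})"
      by (intro borel_measurable_times borel_measurable_integrable[OF K])
    show "AE s in lebesgue_on {a..b}. norm (K (t - s) * \<phi> s) \<le> norm (B * K (t - s))"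
    proof (rule AE_I2)
      fix s assume "s \<in> space (lebesgue_on {a..b})"
      then have "norm (\<phi> s) \<le> \<bar>B\<bar>" using B[of s] by auto
      then show "norm (K (t - s) * \<phi> s) \<le> norm (B * K (t - s))"
        using mult_right_mono[of "\<bar>\<phi> s\<bar>" "\<bar>B\<bar>" "\<bar>K (t - s)\<bar>"] by (simp add: abs_mult mult.commute)
    qed
  qed
qed

lemma kernel_product:
  assumes "0 \<le> a" "b \<le> t" "t \<le> T" "continuous_on {a..b} \<phi>"
  shows "(\<lambda>s. K (t - s) * \<phi> s) integrable_on {a..b}"
  by (rule integrable_on_lebesgue_on[OF kernel_product_lebesgue[OF assms]]) simp

lemma tgrid_bounds:
  assumes "1 \<le> n" "n \<le> N" shows "0 < tgrid T N n \<and> tgrid T N n \<le> T"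
proof -
  have "real n * T \<le> real N * T" using assms T_pos by (intro mult_right_mono) auto
  moreover have "0 < real N" "0 < real n" using assms by auto
  ultimately show ?thesis using T_pos by (simp add: tgrid_def pos_divide_le_eq mult.commute)
qed

lemma tgrid_N: "0 < N \<Longrightarrow> tgrid T N N = T" by (simp add: tgrid_def)

text \<open>The kernel is essentially bounded by the bound \<open>K1\<close> of the weights.  For smooth \<open>\<phi>\<close> the weighted sums
  converge to the integral against the kernel, and they are bounded by \<open>K1\<close> times Riemann sums of \<open>|\<phi>|\<close>.  Polynomial
  approximation extends this to continuous \<open>\<phi>\<close>, and almost everywhere approximation to the sign of the kernel on the
  set where its absolute value exceeds \<open>K1\<close>.\<close>

lemma kernel_smooth_bound:
  assumes d: "\<And>s. (\<phi> has_real_derivative \<phi>' s) (at s)" and c: "continuous_on UNIV \<phi>'"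
  shows "\<bar>integral {0..T} (\<lambda>s. K (T - s) * \<phi> s)\<bar> \<le> K1 * integral {0..T} (\<lambda>s. \<bar>\<phi> s\<bar>)"
proof -
  have cphi: "continuous_on A \<phi>" for A using d by (meson DERIV_isCont continuous_at_imp_continuous_on)
  have "compact (\<phi> ` {0..T})" "compact (\<phi>' ` {0..T})"
    using continuous_on_subset[OF c] cphi by (auto intro!: compact_continuous_image)
  then obtain M M' where M: "\<And>s. s \<in> {0..T} \<Longrightarrow> norm (\<phi> s) \<le> M" and M': "\<And>s. s \<in> {0..T} \<Longrightarrow> norm (\<phi>' s) \<le> M'"
    using compact_imp_bounded bounded_iff by (metis imageI)
  define I where "I = integral {0..T} (\<lambda>s. K (T - s) * \<phi> s)"
  define J where "J = integral {0..T} (\<lambda>s. \<bar>\<phi> s\<bar>)"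
  define V where "V = integral {0..T} (\<lambda>s. \<bar>\<phi>' s\<bar>)"
  have bound: "\<bar>I\<bar> - K1 * J \<le> (Cq * T * (M + V) + K1 * (T * M' * T)) / real N" if N: "0 < N" for N :: nat
  proof -
    define k where "k = T / real N"
    have k: "0 < k" "real N * k = T" using T_pos N by (auto simp: k_def)
    have grid: "tgrid T N i = real i * k" for i by (simp add: tgrid_def k_def)
    have q: "\<bar>quad_error T K \<omega> N N \<phi>\<bar> \<le> Cq * k * (M + V)"
      unfolding k_def V_def
    proof (subst tgrid_N[OF N, symmetric], rule quad)
      show "continuous_on {0..tgrid T N N} \<phi>'" using c continuous_on_subset by blast
    qed (use N M d tgrid_N[OF N] in \<open>auto intro: DERIV_subset\<close>)
    have cell: "k * \<bar>\<phi> (real i * k)\<bar> \<le> integral {(real i - 1) * k..real i * k} (\<lambda>s. \<bar>\<phi> s\<bar>) + M' * k * k"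
      if i: "i \<in> {1..N}" for i
    proof -
      have sub: "{(real i - 1) * k..real i * k} \<subseteq> {0..T}"
      proof -
        have "real i * k \<le> real N * k" using i k by (intro mult_right_mono) auto
        moreover have "0 \<le> (real i - 1) * k" using i k by simp
        ultimately show ?thesis using k by auto
      qed
      have len: "real i * k - (real i - 1) * k = k" "(real i - 1) * k \<le> real i * k" using k by (auto simp: algebra_simps)
      have "integral {(real i - 1) * k..real i * k} (\<lambda>s. \<bar>\<phi> (real i * k)\<bar> - M' * k)
          \<le> integral {(real i - 1) * k..real i * k} (\<lambda>s. \<bar>\<phi> s\<bar>)"
      proof (rule integral_le)
        show "(\<lambda>s. \<bar>\<phi> s\<bar>) integrable_on {(real i - 1) * k..real i * k}"
          using cphi by (intro integrable_continuous_real continuous_intros)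
        show "(\<lambda>s. \<bar>\<phi> (real i * k)\<bar> - M' * k) integrable_on {(real i - 1) * k..real i * k}"
          by (rule integrable_const_ivl)
        fix s assume s: "s \<in> {(real i - 1) * k..real i * k}"
        have "norm (\<phi> (real i * k) - \<phi> s) \<le> M' * norm (real i * k - s)"
          using s sub d M' len
          by (intro field_differentiable_bound[where S = "{(real i - 1) * k..real i * k}"]) (auto intro: DERIV_subset)
        also have "\<dots> \<le> M' * k"
        proof (rule mult_left_mono)
          show "norm (real i * k - s) \<le> k" using s len by auto
          have "norm (\<phi>' 0) \<le> M'" using M'[of 0] T_pos by simp
          then show "0 \<le> M'" using norm_ge_zero[of "\<phi>' 0"] by linarith
        qed
        finally show "\<bar>\<phi> (real i * k)\<bar> - M' * k \<le> \<bar>\<phi> s\<bar>" by simp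
      qed
      moreover have "integral {(real i - 1) * k..real i * k} (\<lambda>s. \<bar>\<phi> (real i * k)\<bar> - M' * k)
          = k * (\<bar>\<phi> (real i * k)\<bar> - M' * k)" using len by simp
      ultimately show ?thesis by (simp add: algebra_simps)
    qed
    have "(\<Sum>i=1..N. k * \<bar>\<phi> (real i * k)\<bar>) \<le> (\<Sum>i=1..N. integral {(real i - 1) * k..real i * k} (\<lambda>s. \<bar>\<phi> s\<bar>) + M' * k * k)"
      by (rule sum_mono) (rule cell)
    also have "\<dots> = J + real N * (M' * k * k)"
      using sum_cells[of k "\<lambda>s. \<bar>\<phi> s\<bar>" N] k cphi
      by (simp add: sum.distrib J_def integrable_continuous_real continuous_intros)
    also have "real N * (M' * k * k) = T * M' * T / real N" using k by (simp add: k_def field_simps)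
    finally have R: "(\<Sum>i=1..N. k * \<bar>\<phi> (real i * k)\<bar>) \<le> J + T * M' * T / real N" .
    have "\<bar>k * (\<Sum>i=1..N. \<omega> N N i * \<phi> (real i * k))\<bar> \<le> (\<Sum>i=1..N. K1 * (k * \<bar>\<phi> (real i * k)\<bar>))"
      unfolding sum_distrib_left
    proof (rule order_trans[OF sum_abs sum_mono])
      fix i assume "i \<in> {1..N}"
      then have "\<bar>\<omega> N N i\<bar> * (k * \<bar>\<phi> (real i * k)\<bar>) \<le> K1 * (k * \<bar>\<phi> (real i * k)\<bar>)"
        using k by (intro mult_right_mono weight_bound) auto
      then show "\<bar>k * (\<omega> N N i * \<phi> (real i * k))\<bar> \<le> K1 * (k * \<bar>\<phi> (real i * k)\<bar>)"
        using k by (simp add: abs_mult algebra_simps)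
    qed
    also have "\<dots> = K1 * (\<Sum>i=1..N. k * \<bar>\<phi> (real i * k)\<bar>)" by (simp add: sum_distrib_left)
    also have "\<dots> \<le> K1 * (J + T * M' * T / real N)" using R K1 by (rule mult_left_mono)
    finally have S: "\<bar>k * (\<Sum>i=1..N. \<omega> N N i * \<phi> (real i * k))\<bar> \<le> K1 * (J + T * M' * T / real N)" .
    have "quad_error T K \<omega> N N \<phi> = k * (\<Sum>i=1..N. \<omega> N N i * \<phi> (real i * k)) - I"
      using N by (simp add: quad_error_def I_def grid tgrid_N k(2) flip: k_def)
    then have "\<bar>I\<bar> \<le> K1 * (J + T * M' * T / real N) + Cq * k * (M + V)" using S q by linarith
    then show ?thesis by (simp add: k_def algebra_simps add_divide_distrib)
  qed
  have "(\<lambda>N. (Cq * T * (M + V) + K1 * (T * M' * T)) / real N) \<longlonglongrightarrow> 0"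
    by (rule lim_const_over_n)
  then have "\<bar>I\<bar> - K1 * J \<le> 0"
    by (rule LIMSEQ_le_const) (use bound in \<open>auto intro!: exI[of _ 1]\<close>)
  then show ?thesis by (simp add: I_def J_def)
qed

lemma kernel_continuous_bound:
  assumes \<phi>: "continuous_on {0..T} \<phi>"
  shows "\<bar>integral {0..T} (\<lambda>s. K (T - s) * \<phi> s)\<bar> \<le> K1 * integral {0..T} (\<lambda>s. \<bar>\<phi> s\<bar>)"
proof -
  define Q where "Q = integral {0..T} (\<lambda>s. \<bar>K (T - s)\<bar>)"
  have Kabs: "(\<lambda>s. \<bar>K (T - s)\<bar>) integrable_on {0..T}" and Kint: "(\<lambda>s. K (T - s)) integrable_on {0..T}"
    using kernel_reflect[of 0 T T] by (auto simp: absolutely_integrable_on_def)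
  have "\<bar>integral {0..T} (\<lambda>s. K (T - s) * \<phi> s)\<bar> \<le> K1 * integral {0..T} (\<lambda>s. \<bar>\<phi> s\<bar>) + e * (Q + K1 * T)"
    if e: "0 < e" for e
  proof -
    obtain p where p: "real_polynomial_function p" "\<And>s. s \<in> {0..T} \<Longrightarrow> \<bar>\<phi> s - p s\<bar> < e"
      using Stone_Weierstrass_real_polynomial_function[of "{0..T}" \<phi> e] \<phi> e by auto
    obtain p' where p': "real_polynomial_function p'" "\<And>s. (p has_real_derivative p' s) (at s)"
      using has_real_derivative_polynomial_function[OF p(1)] by auto
    have cp': "continuous_on UNIV p'"
      using has_real_derivative_polynomial_function[OF p'(1)] by (meson DERIV_isCont continuous_at_imp_continuous_on)
    have cp: "continuous_on A p" for A using p'(2) by (meson DERIV_isCont continuous_at_imp_continuous_on)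
    note pb = kernel_smooth_bound[OF p'(2) cp']
    have i1: "(\<lambda>s. K (T - s) * p s) integrable_on {0..T}" using cp by (intro kernel_product) auto
    have i2: "(\<lambda>s. K (T - s) * (\<phi> s - p s)) integrable_on {0..T}"
      using cp \<phi> by (intro kernel_product continuous_intros) auto
    have "integral {0..T} (\<lambda>s. K (T - s) * \<phi> s)
        = integral {0..T} (\<lambda>s. K (T - s) * p s) + integral {0..T} (\<lambda>s. K (T - s) * (\<phi> s - p s))"
      using Henstock_Kurzweil_Integration.integral_add[OF i1 i2] by (simp add: algebra_simps)
    moreover have "norm (integral {0..T} (\<lambda>s. K (T - s) * (\<phi> s - p s))) \<le> integral {0..T} (\<lambda>s. \<bar>K (T - s)\<bar> * e)"
    proof (rule Henstock_Kurzweil_Integration.integral_norm_bound_integral[OF i2])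
      show "(\<lambda>s. \<bar>K (T - s)\<bar> * e) integrable_on {0..T}" using Kabs by (rule integrable_on_mult_left)
      show "norm (K (T - s) * (\<phi> s - p s)) \<le> \<bar>K (T - s)\<bar> * e" if "s \<in> {0..T}" for s
        using p(2)[OF that] by (simp add: abs_mult mult_left_mono)
    qed
    moreover have "integral {0..T} (\<lambda>s. \<bar>K (T - s)\<bar> * e) = Q * e" by (simp add: Q_def)
    moreover have "integral {0..T} (\<lambda>s. \<bar>p s\<bar>) \<le> integral {0..T} (\<lambda>s. \<bar>\<phi> s\<bar> + e)"
    proof (rule integral_le)
      show "\<bar>p s\<bar> \<le> \<bar>\<phi> s\<bar> + e" if "s \<in> {0..T}" for s using p(2)[OF that] by linarith
    qed (use cp \<phi> in \<open>auto intro!: integrable_continuous_real continuous_intros\<close>)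
    moreover have "integral {0..T} (\<lambda>s. \<bar>\<phi> s\<bar> + e) = integral {0..T} (\<lambda>s. \<bar>\<phi> s\<bar>) + T * e"
      using T_pos \<phi> by (subst Henstock_Kurzweil_Integration.integral_add)
        (auto intro!: integrable_continuous_real continuous_intros)
    ultimately have "\<bar>integral {0..T} (\<lambda>s. K (T - s) * \<phi> s)\<bar>
        \<le> K1 * integral {0..T} (\<lambda>s. \<bar>p s\<bar>) + Q * e" "integral {0..T} (\<lambda>s. \<bar>p s\<bar>) \<le> integral {0..T} (\<lambda>s. \<bar>\<phi> s\<bar>) + T * e"
      using pb by auto
    then show ?thesis using mult_left_mono[OF _ K1, of "integral {0..T} (\<lambda>s. \<bar>p s\<bar>)"]
      by (fastforce simp: algebra_simps)
  qed
  moreover have "((\<lambda>e. K1 * integral {0..T} (\<lambda>s. \<bar>\<phi> s\<bar>) + e * (Q + K1 * T)) \<longlongrightarrow>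
      K1 * integral {0..T} (\<lambda>s. \<bar>\<phi> s\<bar>) + 0 * (Q + K1 * T)) (at_right 0)"
    by (intro tendsto_intros)
  moreover have "\<forall>\<^sub>F e in at_right 0. \<bar>integral {0..T} (\<lambda>s. K (T - s) * \<phi> s)\<bar>
      \<le> K1 * integral {0..T} (\<lambda>s. \<bar>\<phi> s\<bar>) + e * (Q + K1 * T)"
    using eventually_at_right_less[of "0::real"] by eventually_elim (rule calculation)
  ultimately have "\<bar>integral {0..T} (\<lambda>s. K (T - s) * \<phi> s)\<bar>
      \<le> K1 * integral {0..T} (\<lambda>s. \<bar>\<phi> s\<bar>) + 0 * (Q + K1 * T)"
    by (intro tendsto_lowerbound[where F = "at_right (0::real)"]) auto
  then show ?thesis by simp
qed

lemma kernel_ae_bound: "\<exists>Z. negligible Z \<and> (\<forall>s\<in>{0..T} - Z. \<bar>K s\<bar> \<le> K1)"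
proof -
  define M where "M = lebesgue_on {0..T}"
  define h where "h s = K (T - s)" for s
  have hint: "integrable M h"
    using kernel_product_lebesgue[of 0 T T "\<lambda>_. 1"] by (simp add: M_def h_def[abs_def])
  then have [measurable]: "h \<in> borel_measurable M" by (rule borel_measurable_integrable)
  \<comment> \<open>The test function that detects the excess; its continuous approximations are clipped to \<open>[-1, 1]\<close> so
    that dominated convergence applies.\<close>
  define \<psi> where "\<psi> s = (if K1 < h s then 1 else if h s < - K1 then -1 else 0 :: real)" for s
  have psi_meas [measurable]: "\<psi> \<in> borel_measurable M" unfolding \<psi>_def[abs_def] by measurable
  then have "\<psi> measurable_on {0..T}" by (simp add: measurable_on_iff_borel_measurable M_def)
  then obtain N g where N: "negligible N" and g: "\<And>n. continuous_on UNIV (g n)"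
      and lim: "\<And>x. x \<notin> N \<Longrightarrow> (\<lambda>n. g n x) \<longlonglongrightarrow> (if x \<in> {0..T} then \<psi> x else 0)"
    unfolding measurable_on_def by blast
  define G where "G n x = max (-1) (min 1 (g n x))" for n and x :: real
  have Gc: "continuous_on A (G n)" for n A
    unfolding G_def using g continuous_on_subset by (intro continuous_intros) blast
  have Gb: "\<bar>G n x\<bar> \<le> 1" for n x by (auto simp: G_def)
  have "N \<in> null_sets lebesgue" using N by (simp add: negligible_iff_null_sets)
  then have "AE x in lebesgue. x \<notin> N" by (rule AE_not_in)
  then have aeN: "AE x in M. x \<in> {0..T} \<and> x \<notin> N"
    unfolding M_def by (subst AE_restrict_space_iff) auto
  have Glim: "AE x in M. (\<lambda>n. G n x) \<longlonglongrightarrow> \<psi> x"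
    using aeN
  proof eventually_elim
    case (elim x)
    then have "(\<lambda>n. g n x) \<longlonglongrightarrow> \<psi> x" using lim[of x] by auto
    then have "(\<lambda>n. G n x) \<longlonglongrightarrow> max (-1) (min 1 (\<psi> x))"
      unfolding G_def by (intro tendsto_max tendsto_min tendsto_const)
    then show ?case by (simp add: \<psi>_def split: if_splits)
  qed
  have Gi: "integrable M (\<lambda>x. \<bar>G n x\<bar>)" for n
    unfolding M_def using Gc
    by (intro absolutely_integrable_imp_integrable absolutely_integrable_continuous_real continuous_intros) auto
  have Gm: "G n \<in> borel_measurable M" for n
    unfolding M_def using Gc by (intro continuous_imp_measurable_on_sets_lebesgue) auto
  have hG: "integrable M (\<lambda>x. h x * G n x)" for n
    unfolding M_def h_def using Gc by (intro kernel_product_lebesgue) auto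
  have fin: "(LINT x|M. h x * G n x) \<le> K1 * (LINT x|M. \<bar>G n x\<bar>)" for n
    using kernel_continuous_bound[OF Gc, of n] lebesgue_integral_eq_integral[OF hG[unfolded M_def], of n]
      lebesgue_integral_eq_integral[OF Gi[unfolded M_def], of n]
    by (simp add: M_def h_def)
  have L1: "(\<lambda>n. LINT x|M. h x * G n x) \<longlonglongrightarrow> (LINT x|M. h x * \<psi> x)"
  proof (rule integral_dominated_convergence[where w = "\<lambda>x. \<bar>h x\<bar>"])
    show "AE x in M. (\<lambda>n. h x * G n x) \<longlonglongrightarrow> h x * \<psi> x"
      using Glim by eventually_elim (rule tendsto_mult_left)
    show "AE x in M. norm (h x * G n x) \<le> \<bar>h x\<bar>" for n
      using Gb[of n] by (intro AE_I2) (simp add: abs_mult mult_left_le)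
  qed (use hint Gm in auto)
  have one: "integrable M (\<lambda>x. 1::real)"
    unfolding M_def by (intro absolutely_integrable_imp_integrable absolutely_integrable_continuous_real continuous_intros) auto
  have L2: "(\<lambda>n. LINT x|M. \<bar>G n x\<bar>) \<longlonglongrightarrow> (LINT x|M. \<bar>\<psi> x\<bar>)"
  proof (rule integral_dominated_convergence[where w = "\<lambda>x. 1"])
    show "AE x in M. (\<lambda>n. \<bar>G n x\<bar>) \<longlonglongrightarrow> \<bar>\<psi> x\<bar>"
      using Glim by eventually_elim (rule tendsto_rabs)
    show "AE x in M. norm \<bar>G n x\<bar> \<le> 1" for n using Gb[of n] by (intro AE_I2) simp
  qed (use one Gm in auto)
  have le: "(LINT x|M. h x * \<psi> x) \<le> K1 * (LINT x|M. \<bar>\<psi> x\<bar>)"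
    by (rule LIMSEQ_le[OF L1 tendsto_mult_left[OF L2]]) (use fin in auto)
  have psib: "\<bar>\<psi> x\<bar> \<le> 1" for x by (simp add: \<psi>_def)
  have i1: "integrable M (\<lambda>x. h x * \<psi> x)"
    by (rule Bochner_Integration.integrable_bound[OF hint])
      (use psib in \<open>auto simp: abs_mult mult_left_le\<close>)
  have i2: "integrable M (\<lambda>x. \<bar>\<psi> x\<bar>)"
    by (rule Bochner_Integration.integrable_bound[OF one]) (use psib in auto)
  define q where "q x = h x * \<psi> x - K1 * \<bar>\<psi> x\<bar>" for x
  have q0: "0 \<le> q x" for x using K1 by (auto simp: q_def \<psi>_def)
  have qi: "integrable M q" unfolding q_def[abs_def] using i1 i2 by simp
  have "(LINT x|M. q x) \<le> 0" unfolding q_def using le i1 i2 by simp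
  moreover have "0 \<le> (LINT x|M. q x)" using q0 by simp
  ultimately have "(LINT x|M. q x) = 0" by linarith
  then have "AE x in M. q x = 0" using integral_nonneg_eq_0_iff_AE[OF qi] q0 by simp
  then have "AE x in M. \<bar>h x\<bar> \<le> K1"
    by eventually_elim (use K1 in \<open>auto simp: q_def \<psi>_def split: if_splits\<close>)
  then have "AE x in lebesgue. x \<in> {0..T} \<longrightarrow> \<bar>h x\<bar> \<le> K1"
    unfolding M_def by (subst (asm) AE_restrict_space_iff) auto
  then obtain Y where Y: "Y \<in> null_sets lebesgue" "{x. \<not> (x \<in> {0..T} \<longrightarrow> \<bar>h x\<bar> \<le> K1)} \<subseteq> Y"
    unfolding eventually_ae_filter by auto
  have "negligible ((\<lambda>y. T - y) ` Y)"
    using Y(1) by (intro negligible_differentiable_image_negligible)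
      (auto simp: negligible_iff_null_sets intro!: derivative_intros)
  moreover have "\<bar>K s\<bar> \<le> K1" if "s \<in> {0..T} - (\<lambda>y. T - y) ` Y" for s
  proof -
    have "T - s \<notin> Y" using that by (metis DiffD2 diff_diff_eq2 add_diff_cancel_left' image_eqI)
    have "\<bar>h (T - s)\<bar> \<le> K1"
    proof (rule ccontr)
      assume "\<not> \<bar>h (T - s)\<bar> \<le> K1"
      then have "T - s \<in> {x. \<not> (x \<in> {0..T} \<longrightarrow> \<bar>h x\<bar> \<le> K1)}" using that by simp
      with Y(2) show False using \<open>T - s \<notin> Y\<close> by blast
    qed
    then show ?thesis by (simp add: h_def)
  qed
  ultimately show ?thesis by blast
qed

text \<open>The kernel clipped at its essential bound: it is bounded everywhere and has the same integrals.\<close>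

definition Kc :: "real \<Rightarrow> real" where "Kc s = max (- K1) (min K1 (K s))"

lemma Kc_bound: "\<bar>Kc s\<bar> \<le> K1" using K1 by (auto simp: Kc_def)

lemma Kc_spike:
  assumes ab: "0 \<le> a" "b \<le> t" "t \<le> T"
  obtains Z where "negligible Z" "\<And>s. s \<in> {a..b} - Z \<Longrightarrow> Kc (t - s) = K (t - s)"
proof -
  obtain Z where Z: "negligible Z" "\<And>s. s \<in> {0..T} - Z \<Longrightarrow> \<bar>K s\<bar> \<le> K1" using kernel_ae_bound by blast
  have "negligible ((\<lambda>y. t - y) ` Z)"
    using Z(1) by (intro negligible_differentiable_image_negligible) (auto intro!: derivative_intros)
  moreover have "Kc (t - s) = K (t - s)" if "s \<in> {a..b} - (\<lambda>y. t - y) ` Z" for s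
  proof -
    have "t - s \<notin> Z" using that by (metis DiffD2 diff_diff_eq2 add_diff_cancel_left' image_eqI)
    then have "\<bar>K (t - s)\<bar> \<le> K1" using Z(2)[of "t - s"] that ab by auto
    then show ?thesis by (auto simp: Kc_def)
  qed
  ultimately show ?thesis using that by blast
qed

lemma Kc_integral:
  assumes ab: "0 \<le> a" "b \<le> t" "t \<le> T"
  shows "integral {a..b} (\<lambda>s. K (t - s) * \<phi> s) = integral {a..b} (\<lambda>s. Kc (t - s) * \<phi> s)"
proof -
  obtain Z where "negligible Z" "\<And>s. s \<in> {a..b} - Z \<Longrightarrow> Kc (t - s) = K (t - s)"
    by (rule Kc_spike[OF ab]) (rule that)
  then show ?thesis by (intro integral_spike) auto
qed

lemma Kc_integrable:
  assumes ab: "0 \<le> a" "b \<le> t" "t \<le> T" and \<phi>: "continuous_on {a..b} \<phi>"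
  shows "(\<lambda>s. Kc (t - s) * \<phi> s) integrable_on {a..b}"
proof -
  obtain Z where "negligible Z" "\<And>s. s \<in> {a..b} - Z \<Longrightarrow> Kc (t - s) = K (t - s)"
    by (rule Kc_spike[OF ab]) (rule that)
  then show ?thesis by (intro integrable_spike[OF kernel_product[OF ab \<phi>]]) auto
qed

lemma kernel_integral_bound:
  assumes ab: "0 \<le> a" "a \<le> b" "b \<le> t" "t \<le> T" and \<phi>: "continuous_on {a..b} \<phi>" "\<And>s. s \<in> {a..b} \<Longrightarrow> \<bar>\<phi> s\<bar> \<le> B"
  shows "\<bar>integral {a..b} (\<lambda>s. K (t - s) * \<phi> s)\<bar> \<le> K1 * B * (b - a)"
proof -
  have "norm (integral {a..b} (\<lambda>s. Kc (t - s) * \<phi> s)) \<le> integral {a..b} (\<lambda>s. K1 * B)"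
  proof (rule Henstock_Kurzweil_Integration.integral_norm_bound_integral)
    fix s assume "s \<in> {a..b}"
    then have "\<bar>Kc (t - s)\<bar> * \<bar>\<phi> s\<bar> \<le> K1 * B" using \<phi>(2) Kc_bound K1 by (intro mult_mono) auto
    then show "norm (Kc (t - s) * \<phi> s) \<le> K1 * B" by (simp add: abs_mult)
  qed (use Kc_integrable ab \<phi> in auto)
  then show ?thesis using Kc_integral[of a b t \<phi>] ab by (simp add: algebra_simps)
qed

text \<open>The error of the rule at \<open>t\<^sub>n\<close> for the indicator function of the initial segment up to \<open>t\<^sub>i\<close>.\<close>

definition Eq :: "nat \<Rightarrow> nat \<Rightarrow> nat \<Rightarrow> real" where
  "Eq N n i = (T / real N) * (\<Sum>j=1..i. \<omega> N n j) - integral {0..tgrid T N i} (\<lambda>s. K (tgrid T N n - s))"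

text \<open>For \<open>i = n\<close> the integrand is constant.  Otherwise the indicator function is compared with a ramp that falls from 1 to 0 between \<open>t\<^sub>i\<close> and \<open>t\<^bsub>i + 1\<^esub>\<close>.  Both have the same
  values at the grid points and differ on one cell only, where the kernel contributes at most \<open>K1\<close> times its length; the
  total variation of the ramp is at most 1.\<close>

lemma Eq_bound:
  assumes i: "1 \<le> i" "i \<le> n" "n \<le> N"
  shows "\<bar>Eq N n i\<bar> \<le> (2 * Cq + K1) * (T / real N)"
proof -
  define k where "k = T / real N"
  have N: "0 < N" using i by simp
  have k: "0 < k" using T_pos N by (simp add: k_def)
  have grid: "tgrid T N j = real j * k" for j by (simp add: tgrid_def k_def)
  have n1: "1 \<le> n" using i by simp
  note tn = tgrid_bounds[OF n1 i(3)]
  show ?thesis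
  proof (cases "i = n")
    case True
    have "\<bar>quad_error T K \<omega> N n (\<lambda>_. 1)\<bar> \<le> Cq * (T / real N) * (1 + integral {0..tgrid T N n} (\<lambda>s. \<bar>0\<bar>))"
      by (rule quad) (use n1 i in auto)
    moreover have "quad_error T K \<omega> N n (\<lambda>_. 1) = Eq N n i" using True by (simp add: quad_error_def Eq_def)
    moreover have "0 \<le> (Cq + K1) * k" using Cq K1 k by simp
    moreover have "(2 * Cq + K1) * k = Cq * k * 1 + (Cq + K1) * k" by (simp add: algebra_simps)
    ultimately show ?thesis unfolding k_def by simp
  next
    case False
    then have lt: "i < n" using i by simp
    define \<phi> where "\<phi> s = ramp ((real (Suc i) * k - s) / k)" for s
    define \<phi>' where "\<phi>' s = ramp' ((real (Suc i) * k - s) / k) * (- 1 / k)" for s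
    have d: "(\<phi> has_real_derivative \<phi>' s) (at s)" for s
      unfolding \<phi>_def \<phi>'_def using k
      by (intro DERIV_chain2[OF ramp_deriv]) (auto intro!: derivative_eq_intros)
    have c': "continuous_on A \<phi>'" for A
      unfolding \<phi>'_def ramp'_def using k by (intro continuous_intros) auto
    have c: "continuous_on A \<phi>" for A using d by (meson DERIV_isCont continuous_at_imp_continuous_on)
    have b: "\<bar>\<phi> s\<bar> \<le> 1" for s unfolding \<phi>_def using ramp_bounds by simp
    have "(\<phi>' has_integral (\<phi> (tgrid T N n) - \<phi> 0)) {0..tgrid T N n}"
      using tn d by (intro fundamental_theorem_of_calculus)
        (auto simp: has_real_derivative_iff_has_vector_derivative[symmetric] intro: DERIV_subset)
    then have neg: "((\<lambda>s. - \<phi>' s) has_integral - (\<phi> (tgrid T N n) - \<phi> 0)) {0..tgrid T N n}" by (rule has_integral_neg)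
    have "\<bar>\<phi>' s\<bar> = - \<phi>' s" for s using ramp'_nonneg k by (simp add: \<phi>'_def abs_mult)
    then have V: "integral {0..tgrid T N n} (\<lambda>s. \<bar>\<phi>' s\<bar>) = - (\<phi> (tgrid T N n) - \<phi> 0)"
      using integral_unique[OF neg] by (simp only:)
    have V1: "integral {0..tgrid T N n} (\<lambda>s. \<bar>\<phi>' s\<bar>) \<le> 1"
      unfolding V \<phi>_def using ramp_bounds(1)[of "(real (Suc i) * k - tgrid T N n) / k"] ramp_bounds(2)[of "(real (Suc i) * k - 0) / k"]
      by linarith
    have "\<bar>quad_error T K \<omega> N n \<phi>\<bar> \<le> Cq * k * (1 + integral {0..tgrid T N n} (\<lambda>s. \<bar>\<phi>' s\<bar>))"
      unfolding k_def by (rule quad) (use n1 i c' b d in \<open>auto intro: DERIV_subset\<close>)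
    also have "\<dots> \<le> Cq * k * (1 + 1)" using V1 Cq k by (intro mult_left_mono) auto
    finally have qe: "\<bar>quad_error T K \<omega> N n \<phi>\<bar> \<le> 2 * Cq * k" by simp
    have one: "\<phi> s = 1" if "s \<le> real i * k" for s
    proof -
      have "1 * k \<le> real (Suc i) * k - s" using that by (simp add: algebra_simps)
      then have "1 \<le> (real (Suc i) * k - s) / k" using k by (simp add: pos_le_divide_eq)
      then show ?thesis unfolding \<phi>_def by (rule ramp_values(2))
    qed
    have zero: "\<phi> s = 0" if "real (Suc i) * k \<le> s" for s
      unfolding \<phi>_def using that k by (intro ramp_values(1)) (simp add: divide_le_0_iff)
    have "(\<Sum>j=1..n. \<omega> N n j * \<phi> (real j * k)) = (\<Sum>j=1..n. if j \<le> i then \<omega> N n j else 0)"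
    proof (rule sum.cong)
      fix j assume "j \<in> {1..n}"
      show "\<omega> N n j * \<phi> (real j * k) = (if j \<le> i then \<omega> N n j else 0)"
      proof (cases "j \<le> i")
        case True
        then have "real j * k \<le> real i * k" using k by (intro mult_right_mono) auto
        then show ?thesis using one True by simp
      next
        case False
        then have "real (Suc i) * k \<le> real j * k" using k by (intro mult_right_mono) auto
        then show ?thesis using zero False by simp
      qed
    qed simp
    also have "\<dots> = (\<Sum>j=1..i. \<omega> N n j)"
      using lt by (subst sum.inter_filter[symmetric]) (auto intro!: sum.cong)
    finally have s: "(\<Sum>j=1..n. \<omega> N n j * \<phi> (real j * k)) = (\<Sum>j=1..i. \<omega> N n j)" .
    define f where "f s = K (tgrid T N n - s) * \<phi> s" for s
    have le: "0 \<le> real i * k" "real i * k \<le> real (Suc i) * k" "real (Suc i) * k \<le> tgrid T N n"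
      unfolding grid using k lt by (auto intro!: mult_right_mono)
    have fi: "f integrable_on {a..b}" if "0 \<le> a" "b \<le> tgrid T N n" for a b
      unfolding f_def using that tn c by (intro kernel_product) auto
    have "integral {0..tgrid T N n} f = integral {0..real i * k} f + (integral {real i * k..real (Suc i) * k} f
        + integral {real (Suc i) * k..tgrid T N n} f)"
      using le fi by (simp add: Henstock_Kurzweil_Integration.integral_combine)
    moreover have "integral {0..real i * k} f = integral {0..real i * k} (\<lambda>s. K (tgrid T N n - s))"
      by (rule Henstock_Kurzweil_Integration.integral_cong) (auto simp: f_def one)
    moreover have "integral {real (Suc i) * k..tgrid T N n} f = integral {real (Suc i) * k..tgrid T N n} (\<lambda>s. 0)"
      by (rule Henstock_Kurzweil_Integration.integral_cong) (auto simp: f_def zero)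
    moreover have "\<bar>integral {real i * k..real (Suc i) * k} f\<bar> \<le> K1 * 1 * (real (Suc i) * k - real i * k)"
      unfolding f_def using le tn c b by (intro kernel_integral_bound) auto
    ultimately have "\<bar>integral {0..tgrid T N n} f - integral {0..real i * k} (\<lambda>s. K (tgrid T N n - s))\<bar> \<le> K1 * k"
      by (simp add: algebra_simps)
    moreover have "quad_error T K \<omega> N n \<phi> = k * (\<Sum>j=1..i. \<omega> N n j) - integral {0..tgrid T N n} f"
      unfolding quad_error_def f_def[abs_def] grid k_def[symmetric] s by (rule refl)
    moreover have "Eq N n i = k * (\<Sum>j=1..i. \<omega> N n j) - integral {0..real i * k} (\<lambda>s. K (tgrid T N n - s))"
      unfolding Eq_def grid k_def[symmetric] by (rule refl)
    ultimately have "\<bar>Eq N n i\<bar> \<le> 2 * Cq * k + K1 * k" using qe by linarith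
    then show ?thesis by (simp add: k_def algebra_simps)
  qed
qed

text \<open>Abel summation, applied to the differences between the weights and the exact integrals of the kernel over the
  cells.  The partial sums of these differences are the errors on initial segments, and replacing \<open>\<phi>\<close> on each cell by its
  value at the right end point leaves the last sum.\<close>

lemma quad_error_decomposition:
  assumes n: "1 \<le> n" "n \<le> N" and \<phi>: "continuous_on {0..T} \<phi>"
  shows "quad_error T K \<omega> N n \<phi> = Eq N n n * \<phi> (tgrid T N 1)
    + (\<Sum>i\<in>{1..<n}. (Eq N n n - Eq N n i) * (\<phi> (tgrid T N (Suc i)) - \<phi> (tgrid T N i)))
    - (\<Sum>i=1..n. integral {tgrid T N (i - 1)..tgrid T N i} (\<lambda>s. Kc (tgrid T N n - s) * (\<phi> s - \<phi> (tgrid T N i))))"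
proof -
  define k where "k = T / real N"
  have k: "0 < k" using T_pos n by (simp add: k_def)
  have grid: "tgrid T N j = real j * k" for j by (simp add: tgrid_def k_def)
  note tn = tgrid_bounds[OF n]
  define t where "t = tgrid T N n"
  have t: "0 \<le> t" "t \<le> T" "t = real n * k" using tn by (auto simp: t_def grid)
  define c where "c i = {(real i - 1) * k..real i * k}" for i
  define \<kappa> where "\<kappa> i = integral (c i) (\<lambda>s. K (t - s))" for i
  define d where "d i = k * \<omega> N n i - \<kappa> i" for i
  have cell: "0 \<le> (real i - 1) * k" "real i * k \<le> t" "(real i - 1) * k \<le> real i * k" if "i \<in> {1..n}" for i
    using that k by (auto simp: t(3) intro!: mult_right_mono)
  have Ki: "(\<lambda>s. K (t - s)) integrable_on {a..b}" if "0 \<le> a" "b \<le> t" for a b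
    using kernel_product[of a b t "\<lambda>_. 1"] that t by simp
  have cphi: "continuous_on {a..b} \<phi>" if "0 \<le> a" "b \<le> t" for a b
    by (rule continuous_on_subset[OF \<phi>]) (use that t in auto)
  have dsum: "(\<Sum>l=1..i. d l) = Eq N n i" if "i \<le> n" for i
  proof -
    have "real i * k \<le> t" using that k by (auto simp: t(3) intro!: mult_right_mono)
    then have "integral {0..real i * k} (\<lambda>s. K (t - s)) = (\<Sum>l=1..i. \<kappa> l)"
      unfolding \<kappa>_def c_def using k by (intro sum_cells Ki) auto
    then show ?thesis by (simp add: d_def sum_subtractf Eq_def grid t_def sum_distrib_left flip: k_def)
  qed
  have "integral {0..t} (\<lambda>s. K (t - s) * \<phi> s) = (\<Sum>i=1..n. integral (c i) (\<lambda>s. K (t - s) * \<phi> s))"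
    unfolding t(3) c_def using k t kernel_product[of 0 t t \<phi>] cphi[of 0 t] by (intro sum_cells) (auto simp: t(3))
  also have "\<dots> = (\<Sum>i=1..n. \<kappa> i * \<phi> (real i * k) + integral (c i) (\<lambda>s. Kc (t - s) * (\<phi> s - \<phi> (real i * k))))"
  proof (rule sum.cong)
    fix i assume i: "i \<in> {1..n}"
    note ci = cell[OF i]
    have 1: "(\<lambda>s. K (t - s) * \<phi> (real i * k)) integrable_on c i"
      unfolding c_def using Ki[OF ci(1,2)] by (rule integrable_on_mult_left)
    have 2: "(\<lambda>s. K (t - s) * (\<phi> s - \<phi> (real i * k))) integrable_on c i"
      unfolding c_def using ci t cphi by (intro kernel_product continuous_intros) auto
    have "integral (c i) (\<lambda>s. K (t - s) * \<phi> s)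
        = integral (c i) (\<lambda>s. K (t - s) * \<phi> (real i * k)) + integral (c i) (\<lambda>s. K (t - s) * (\<phi> s - \<phi> (real i * k)))"
      using Henstock_Kurzweil_Integration.integral_add[OF 1 2] by (simp add: algebra_simps)
    moreover have "integral (c i) (\<lambda>s. K (t - s) * (\<phi> s - \<phi> (real i * k)))
        = integral (c i) (\<lambda>s. Kc (t - s) * (\<phi> s - \<phi> (real i * k)))"
      unfolding c_def using ci t by (intro Kc_integral)
    ultimately show "integral (c i) (\<lambda>s. K (t - s) * \<phi> s)
        = \<kappa> i * \<phi> (real i * k) + integral (c i) (\<lambda>s. Kc (t - s) * (\<phi> s - \<phi> (real i * k)))"
      by (simp add: \<kappa>_def)
  qed simp
  finally have I: "integral {0..t} (\<lambda>s. K (t - s) * \<phi> s)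
      = (\<Sum>i=1..n. \<kappa> i * \<phi> (real i * k)) + (\<Sum>i=1..n. integral (c i) (\<lambda>s. Kc (t - s) * (\<phi> s - \<phi> (real i * k))))"
    by (simp add: sum.distrib)
  have "quad_error T K \<omega> N n \<phi> = (\<Sum>i=1..n. d i * \<phi> (real i * k))
      - (\<Sum>i=1..n. integral (c i) (\<lambda>s. Kc (t - s) * (\<phi> s - \<phi> (real i * k))))"
    unfolding quad_error_def t_def[symmetric] I
    by (simp add: grid d_def algebra_simps sum_subtractf sum_distrib_left flip: k_def)
  also have "(\<Sum>i=1..n. d i * \<phi> (real i * k)) = Eq N n n * \<phi> (tgrid T N 1)
    + (\<Sum>i\<in>{1..<n}. (Eq N n n - Eq N n i) * (\<phi> (tgrid T N (Suc i)) - \<phi> (tgrid T N i)))"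
    unfolding abel_summation[of d "\<lambda>i. \<phi> (real i * k)"] using dsum by (simp add: grid)
  also have "(\<Sum>i=1..n. integral (c i) (\<lambda>s. Kc (t - s) * (\<phi> s - \<phi> (real i * k))))
      = (\<Sum>i=1..n. integral {tgrid T N (i - 1)..tgrid T N i} (\<lambda>s. Kc (tgrid T N n - s) * (\<phi> s - \<phi> (tgrid T N i))))"
    by (intro sum.cong refl) (simp add: c_def grid t_def of_nat_diff)
  finally show ?thesis .
qed

text \<open>Let \<open>\<Phi>\<close> be a functional that is Lipschitz continuous in time and \<open>y\<close> a sequence of vectors whose linear
  combinations with bounded coefficients are bounded, as assumption \<open>sup\<close> says.  Then the quadrature errors at all times \<open>t\<^sub>j\<close>,
  tested with \<open>y\<^sub>j\<close>, add up to a quantity of first order.  In every part of the decomposition the sum over \<open>j\<close> is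
  carried out first: its coefficients are bounded numbers, and the functional that is left does not depend on \<open>j\<close>.\<close>

lemma quadrature_superposition:
  fixes \<Phi> :: "real \<Rightarrow> 'v::real_vector \<Rightarrow> real"
  assumes b: "semi_inner S b" and m: "1 \<le> m" "m \<le> N" and y: "\<And>j. y j \<in> S"
    and lin: "\<And>s x z c. s \<in> {0..T} \<Longrightarrow> x \<in> S \<Longrightarrow> z \<in> S \<Longrightarrow> \<Phi> s (x + c *\<^sub>R z) = \<Phi> s x + c * \<Phi> s z"
    and bound: "\<And>s x. s \<in> {0..T} \<Longrightarrow> x \<in> S \<Longrightarrow> \<bar>\<Phi> s x\<bar> \<le> M * semi_inner.nrm b x"
    and lip: "\<And>s t x. s \<in> {0..T} \<Longrightarrow> t \<in> {0..T} \<Longrightarrow> x \<in> S \<Longrightarrow> \<bar>\<Phi> s x - \<Phi> t x\<bar> \<le> L * \<bar>s - t\<bar> * semi_inner.nrm b x"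
    and sup: "\<And>c B. 0 \<le> B \<Longrightarrow> (\<And>j. j \<in> {1..m} \<Longrightarrow> \<bar>c j\<bar> \<le> B) \<Longrightarrow> semi_inner.nrm b (\<Sum>j=1..m. c j *\<^sub>R y j) \<le> B * W"
    and nonneg: "0 \<le> M" "0 \<le> L" "0 \<le> W"
  shows "\<bar>\<Sum>j=1..m. quad_error T K \<omega> N j (\<lambda>s. \<Phi> s (y j))\<bar>
    \<le> ((M + 2 * L * T) * (2 * Cq + K1) + L * T * K1) * (T / real N) * W"
proof -
  interpret b: semi_inner S b by fact
  define k where "k = T / real N"
  define CE where "CE = 2 * Cq + K1"
  define Y where "Y c = (\<Sum>j=1..m. c j *\<^sub>R y j)" for c
  have N: "0 < N" using m by simp
  have k: "0 < k" "real N * k = T" using T_pos N by (auto simp: k_def)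
  have CE: "0 \<le> CE" using Cq K1 by (simp add: CE_def)
  have grid: "tgrid T N j = real j * k" for j by (simp add: tgrid_def k_def)
  have gridT: "tgrid T N j \<in> {0..T}" if "j \<le> N" for j
  proof -
    have "real j * k \<le> real N * k" using that k by (intro mult_right_mono) auto
    then show ?thesis using k by (simp add: grid)
  qed
  have YS: "Y c \<in> S" for c unfolding Y_def using y by (intro b.mem_intros) auto
  have Yb: "b.nrm (Y c) \<le> B * W" if "0 \<le> B" "\<And>j. j \<in> {1..m} \<Longrightarrow> \<bar>c j\<bar> \<le> B" for c B
    unfolding Y_def using that by (rule sup)
  have \<Phi>0: "\<Phi> s 0 = 0" if "s \<in> {0..T}" for s
    using lin[OF that b.mem_intros(4) b.mem_intros(4), of 1] by simp
  have \<Phi>Y: "(\<Sum>j=1..m. c j * \<Phi> s (y j)) = \<Phi> s (Y c)" if s: "s \<in> {0..T}" for s c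
  proof -
    have "(\<Sum>j\<in>J. c j * \<Phi> s (y j)) = \<Phi> s (\<Sum>j\<in>J. c j *\<^sub>R y j)" if "finite J" for J
      using that
    proof (induction J rule: finite_induct)
      case (insert j J)
      have "(\<Sum>j\<in>J. c j *\<^sub>R y j) \<in> S" using y by (intro b.mem_intros) auto
      then show ?case using insert lin[OF s _ y, of "\<Sum>j\<in>J. c j *\<^sub>R y j" "c j" j] by (simp add: add.commute)
    qed (simp add: \<Phi>0[OF s])
    then show ?thesis by (simp add: Y_def)
  qed
  have cont: "continuous_on {0..T} (\<lambda>s. \<Phi> s x)" if "x \<in> S" for x
  proof -
    have "(L * b.nrm x)-lipschitz_on {0..T} (\<lambda>s. \<Phi> s x)"
      using lip[OF _ _ that] nonneg that by (intro lipschitz_onI) (auto simp: dist_real_def mult_ac)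
    then show ?thesis by (rule lipschitz_on_continuous_on)
  qed
  define \<Delta> where "\<Delta> i x = \<Phi> (tgrid T N (Suc i)) x - \<Phi> (tgrid T N i) x" for i x
  define R where "R i j = integral {tgrid T N (i - 1)..tgrid T N i}
      (\<lambda>s. Kc (tgrid T N j - s) * (\<Phi> s (y j) - \<Phi> (tgrid T N i) (y j)))" for i j
  have "(\<Sum>j=1..m. quad_error T K \<omega> N j (\<lambda>s. \<Phi> s (y j)))
      = (\<Sum>j=1..m. Eq N j j * \<Phi> (tgrid T N 1) (y j) + (\<Sum>i\<in>{1..<j}. (Eq N j j - Eq N j i) * \<Delta> i (y j)) - (\<Sum>i=1..j. R i j))"
    unfolding \<Delta>_def R_def using m y by (intro sum.cong refl quad_error_decomposition cont) auto
  also have "\<dots> = (\<Sum>j=1..m. Eq N j j * \<Phi> (tgrid T N 1) (y j))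
      + (\<Sum>j=1..m. \<Sum>i\<in>{1..<j}. (Eq N j j - Eq N j i) * \<Delta> i (y j)) - (\<Sum>j=1..m. \<Sum>i=1..j. R i j)"
    by (simp add: sum.distrib sum_subtractf)
  finally have eq: "(\<Sum>j=1..m. quad_error T K \<omega> N j (\<lambda>s. \<Phi> s (y j))) = \<dots>" .
  have EB: "\<bar>Eq N j i\<bar> \<le> CE * k" if "1 \<le> i" "i \<le> j" "j \<le> m" for i j
    using Eq_bound[of i j N] that m by (simp add: CE_def k_def)
  have "\<bar>\<Sum>j=1..m. Eq N j j * \<Phi> (tgrid T N 1) (y j)\<bar> \<le> M * (CE * k * W)"
  proof -
    have "\<bar>\<Phi> (tgrid T N 1) (Y (\<lambda>j. Eq N j j))\<bar> \<le> M * b.nrm (Y (\<lambda>j. Eq N j j))"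
      using gridT[of 1] N by (intro bound YS) auto
    also have "\<dots> \<le> M * (CE * k * W)" using EB CE k nonneg by (intro mult_left_mono Yb) auto
    finally show ?thesis using N by (simp only: \<Phi>Y[OF gridT[of 1]])
  qed
  moreover have "\<bar>\<Sum>j=1..m. \<Sum>i\<in>{1..<j}. (Eq N j j - Eq N j i) * \<Delta> i (y j)\<bar> \<le> T * (L * (2 * (CE * k) * W))"
  proof -
    define c where "c i j = (if i < j then Eq N j j - Eq N j i else 0)" for i j
    have "(\<Sum>j=1..m. \<Sum>i\<in>{1..<j}. (Eq N j j - Eq N j i) * \<Delta> i (y j)) = (\<Sum>j=1..m. \<Sum>i\<in>{1..<m}. c i j * \<Delta> i (y j))"
      by (intro sum.cong[OF refl] sum.mono_neutral_cong_left) (auto simp: c_def)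
    also have "\<dots> = (\<Sum>i\<in>{1..<m}. \<Sum>j=1..m. c i j * \<Delta> i (y j))" by (rule sum.swap)
    also have "\<dots> = (\<Sum>i\<in>{1..<m}. \<Delta> i (Y (c i)))"
    proof (rule sum.cong)
      fix i assume "i \<in> {1..<m}"
      then have "tgrid T N (Suc i) \<in> {0..T}" "tgrid T N i \<in> {0..T}"
        using m gridT[of "Suc i"] gridT[of i] by auto
      then show "(\<Sum>j=1..m. c i j * \<Delta> i (y j)) = \<Delta> i (Y (c i))"
        by (simp add: \<Delta>_def right_diff_distrib sum_subtractf \<Phi>Y del: One_nat_def)
    qed simp
    finally have e: "(\<Sum>j=1..m. \<Sum>i\<in>{1..<j}. (Eq N j j - Eq N j i) * \<Delta> i (y j)) = (\<Sum>i\<in>{1..<m}. \<Delta> i (Y (c i)))" .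
    have "\<bar>\<Delta> i (Y (c i))\<bar> \<le> k * (L * (2 * (CE * k) * W))" if i: "i \<in> {1..<m}" for i
    proof -
      have "\<bar>\<Delta> i (Y (c i))\<bar> \<le> L * \<bar>tgrid T N (Suc i) - tgrid T N i\<bar> * b.nrm (Y (c i))"
        unfolding \<Delta>_def using i m by (intro lip YS gridT) auto
      also have "\<bar>tgrid T N (Suc i) - tgrid T N i\<bar> = k" using k by (simp add: grid algebra_simps)
      finally have l: "\<bar>\<Delta> i (Y (c i))\<bar> \<le> L * k * b.nrm (Y (c i))" .
      have "b.nrm (Y (c i)) \<le> 2 * (CE * k) * W"
      proof (rule Yb)
        fix j assume "j \<in> {1..m}"
        then show "\<bar>c i j\<bar> \<le> 2 * (CE * k)"
          using EB[of j j] EB[of i j] i CE k by (auto simp: c_def)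
      qed (use CE k in simp)
      then have "L * k * b.nrm (Y (c i)) \<le> L * k * (2 * (CE * k) * W)" using k nonneg by (intro mult_left_mono) auto
      with l show ?thesis by (simp add: mult_ac)
    qed
    then have "(\<Sum>i\<in>{1..<m}. \<bar>\<Delta> i (Y (c i))\<bar>) \<le> (\<Sum>i\<in>{1..<m}. k * (L * (2 * (CE * k) * W)))" by (rule sum_mono)
    also have "\<dots> = (real (m - 1) * k) * (L * (2 * (CE * k) * W))" by simp
    also have "\<dots> \<le> T * (L * (2 * (CE * k) * W))"
    proof (rule mult_right_mono)
      have "real (m - 1) * k \<le> real N * k" using m k by (intro mult_right_mono) auto
      then show "real (m - 1) * k \<le> T" using k by simp
    qed (use nonneg CE k in simp)
    finally show ?thesis using e sum_abs[of "\<lambda>i. \<Delta> i (Y (c i))" "{1..<m}"] by linarith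
  qed
  moreover have "\<bar>\<Sum>j=1..m. \<Sum>i=1..j. R i j\<bar> \<le> T * (L * k * (K1 * W))"
  proof -
    define f where "f i j s = (if i \<le> j then Kc (tgrid T N j - s) else 0) * (\<Phi> s (y j) - \<Phi> (tgrid T N i) (y j))" for i j s
    define I where "I i = {tgrid T N (i - 1)..tgrid T N i}" for i
    have Isub: "I i \<subseteq> {0..T}" "I i \<subseteq> {0..tgrid T N i}" if "i \<in> {1..m}" for i
      using gridT[of "i - 1"] gridT[of i] that m by (auto simp: I_def)
    have fi: "f i j integrable_on I i" if ij: "i \<in> {1..m}" "j \<in> {1..m}" for i j
    proof (cases "i \<le> j")
      case True
      have g: "0 \<le> tgrid T N (i - 1)" "tgrid T N i \<le> tgrid T N j" "tgrid T N j \<le> T"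
        using gridT[of "i - 1"] gridT[of j] ij m True k by (auto simp: grid intro!: mult_right_mono)
      have "continuous_on (I i) (\<lambda>s. \<Phi> s (y j) - \<Phi> (tgrid T N i) (y j))"
        using continuous_on_subset[OF cont[OF y] Isub(1)[OF ij(1)]] by (intro continuous_intros)
      then show ?thesis using Kc_integrable[OF g, of "\<lambda>s. \<Phi> s (y j) - \<Phi> (tgrid T N i) (y j)"] True
        by (simp add: f_def[abs_def] I_def)
    qed (simp add: f_def[abs_def] integrable_0)
    have "(\<Sum>j=1..m. \<Sum>i=1..j. R i j) = (\<Sum>j=1..m. \<Sum>i=1..m. integral (I i) (f i j))"
      by (intro sum.cong[OF refl] sum.mono_neutral_cong_left) (auto simp: R_def f_def[abs_def] I_def)
    also have "\<dots> = (\<Sum>i=1..m. \<Sum>j=1..m. integral (I i) (f i j))" by (rule sum.swap)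
    also have "\<dots> = (\<Sum>i=1..m. integral (I i) (\<lambda>s. \<Sum>j=1..m. f i j s))"
      using fi by (intro sum.cong refl integral_sum[symmetric]) auto
    finally have e: "(\<Sum>j=1..m. \<Sum>i=1..j. R i j) = (\<Sum>i=1..m. integral (I i) (\<lambda>s. \<Sum>j=1..m. f i j s))" .
    have cellb: "\<bar>integral (I i) (\<lambda>s. \<Sum>j=1..m. f i j s)\<bar> \<le> k * (L * k * (K1 * W))" if i: "i \<in> {1..m}" for i
    proof -
      have len: "tgrid T N i - tgrid T N (i - 1) = k" using i by (simp add: grid of_nat_diff algebra_simps)
      have "norm (integral (I i) (\<lambda>s. \<Sum>j=1..m. f i j s)) \<le> integral (I i) (\<lambda>s. L * k * (K1 * W))"
      proof (rule Henstock_Kurzweil_Integration.integral_norm_bound_integral)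
        show "(\<lambda>s. \<Sum>j=1..m. f i j s) integrable_on I i" using fi[OF i] by (intro integrable_sum) auto
        show "(\<lambda>s. L * k * (K1 * W)) integrable_on I i" unfolding I_def by (rule integrable_const_ivl)
        fix s assume s: "s \<in> I i"
        define c where "c j = (if i \<le> j then Kc (tgrid T N j - s) else 0)" for j
        have sT: "s \<in> {0..T}" "tgrid T N i \<in> {0..T}" using Isub(1)[OF i] s gridT[of i] i m by auto
        have "(\<Sum>j=1..m. f i j s) = \<Phi> s (Y c) - \<Phi> (tgrid T N i) (Y c)"
          using sT by (simp add: f_def c_def right_diff_distrib sum_subtractf flip: \<Phi>Y)
        moreover have "\<bar>\<Phi> s (Y c) - \<Phi> (tgrid T N i) (Y c)\<bar> \<le> L * \<bar>s - tgrid T N i\<bar> * b.nrm (Y c)"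
          by (rule lip[OF sT YS])
        moreover have "\<bar>s - tgrid T N i\<bar> \<le> k" using s len by (auto simp: I_def)
        moreover have "b.nrm (Y c) \<le> K1 * W" using Kc_bound K1 by (intro Yb) (auto simp: c_def)
        ultimately have "\<bar>\<Sum>j=1..m. f i j s\<bar> \<le> L * \<bar>s - tgrid T N i\<bar> * b.nrm (Y c)"
          "L * \<bar>s - tgrid T N i\<bar> * b.nrm (Y c) \<le> L * k * (K1 * W)"
          using nonneg YS b.nrm_nonneg[OF YS] k by (auto intro!: mult_mono)
        then show "norm (\<Sum>j=1..m. f i j s) \<le> L * k * (K1 * W)" by simp
      qed
      also have "\<dots> = k * (L * k * (K1 * W))" using len k by (simp add: I_def)
      finally show ?thesis by simp
    qed
    have "(\<Sum>i=1..m. \<bar>integral (I i) (\<lambda>s. \<Sum>j=1..m. f i j s)\<bar>) \<le> (\<Sum>i=1..m. k * (L * k * (K1 * W)))"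
      using cellb by (rule sum_mono)
    also have "\<dots> = (real m * k) * (L * k * (K1 * W))" by simp
    also have "\<dots> \<le> T * (L * k * (K1 * W))"
    proof (rule mult_right_mono)
      have "real m * k \<le> real N * k" using m k by (intro mult_right_mono) auto
      then show "real m * k \<le> T" using k by simp
    qed (use nonneg K1 k in simp)
    finally show ?thesis using e sum_abs[of "\<lambda>i. integral (I i) (\<lambda>s. \<Sum>j=1..m. f i j s)" "{1..m}"] by linarith
  qed
  ultimately have "\<bar>\<Sum>j=1..m. quad_error T K \<omega> N j (\<lambda>s. \<Phi> s (y j))\<bar>
      \<le> M * (CE * k * W) + T * (L * (2 * (CE * k) * W)) + T * (L * k * (K1 * W))"
    unfolding eq by linarith
  also have "\<dots> = ((M + 2 * L * T) * CE + L * T * K1) * k * W" by (simp add: algebra_simps)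
  finally show ?thesis by (simp add: CE_def k_def)
qed

end

section \<open>Consistency of the scheme\<close>

text \<open>The continuous problem, its solution and the Ritz-Volterra projections on a family of finite element spaces.  The
  single constant \<open>Q\<close> dominates the second time derivative of the solution, the projection error, and the gradients of the
  projection and of its time derivative.\<close>

locale discretisation =
  nonlinear_op \<Omega> \<alpha> \<beta> \<gamma> g C + elliptic \<Omega> a a0 T CA \<nu>0 + kernel T K \<omega> K1 Cq
  for \<Omega> :: "(real^'n) set" and \<alpha> \<beta> \<gamma> g C a a0 T CA \<nu>0 K \<omega> K1 Cq +
  fixes f :: "real \<Rightarrow> real^'n \<Rightarrow> real" and u ut utt :: "real \<Rightarrow> real^'n \<Rightarrow> real"
    and S :: "real \<Rightarrow> (real^'n \<Rightarrow> real) set" and V Vt :: "real \<Rightarrow> real \<Rightarrow> real^'n \<Rightarrow> real"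
    and r Q :: real
  assumes Q: "0 \<le> Q" and r: "1 < r"
    and u_mem: "t \<in> {0..T} \<Longrightarrow> u t \<in> H10_space \<Omega>"
    and u_deriv: "has_L2_time_deriv \<Omega> T u ut" "has_L2_time_deriv \<Omega> T ut utt"
    and utt_bound: "t \<in> {0..T} \<Longrightarrow> L2_norm \<Omega> (utt t) \<le> Q"
    and weak: "t \<in> {0<..T} \<Longrightarrow> v \<in> H10_space \<Omega> \<Longrightarrow>
        L2_inner \<Omega> (ut t) v + A_form \<Omega> a a0 t (u t) v
          + integral {0..t} (\<lambda>s. K (t - s) * B_tilde \<Omega> \<alpha> \<beta> \<gamma> g (u s) (u s) v) = L2_inner \<Omega> (f t) v"
    and S_space: "h \<in> {0<..1} \<Longrightarrow> finite_dim_space (S h)" "h \<in> {0<..1} \<Longrightarrow> S h \<subseteq> H10_space \<Omega>"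
    and V_mem: "h \<in> {0<..1} \<Longrightarrow> t \<in> {0..T} \<Longrightarrow> V h t \<in> S h"
    and ritz: "h \<in> {0<..1} \<Longrightarrow> t \<in> {0..T} \<Longrightarrow> v \<in> S h \<Longrightarrow>
        A_form \<Omega> a a0 t (u t - V h t) v
          + integral {0..t} (\<lambda>s. K (t - s) * B1_form \<Omega> \<alpha> \<gamma> (u s) (u s - V h s) v) = 0"
    and V_deriv: "h \<in> {0<..1} \<Longrightarrow> has_L2_time_deriv \<Omega> T (V h) (Vt h)"
      "h \<in> {0<..1} \<Longrightarrow> t \<in> {0..T} \<Longrightarrow> Vt h t \<in> S h"
    and rho: "h \<in> {0<..1} \<Longrightarrow> t \<in> {0..T} \<Longrightarrow>
        L2_norm \<Omega> (u t - V h t) + h * H1_norm \<Omega> (u t - V h t) + L2_norm \<Omega> (ut t - Vt h t) \<le> Q * h powr r"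
    and V_grad: "h \<in> {0<..1} \<Longrightarrow> t \<in> {0..T} \<Longrightarrow> grad_bounded_by \<Omega> (V h t) Q"
      "h \<in> {0<..1} \<Longrightarrow> t \<in> {0..T} \<Longrightarrow> grad_bounded_by \<Omega> (Vt h t) Q"
begin

abbreviation vol :: real where "vol \<equiv> L2_norm \<Omega> (\<lambda>x. 1::real)"

lemma S_subspace: assumes "h \<in> {0<..1}" shows "subspace (S h)"
  using finite_dim_space_span[OF S_space(1)[OF assms]] subspace_span by metis

lemma S_H1: "h \<in> {0<..1} \<Longrightarrow> x \<in> S h \<Longrightarrow> x \<in> H1"
  using S_space(2) H10_sub_H1 by blast

lemma u_H1: "t \<in> {0..T} \<Longrightarrow> u t \<in> H1" using u_mem H10_sub_H1 by blast
lemma u_sqint: "t \<in> {0..T} \<Longrightarrow> sqint \<Omega> (u t)" using u_H1 H1_sqint by blast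
lemma V_H1: "h \<in> {0<..1} \<Longrightarrow> t \<in> {0..T} \<Longrightarrow> V h t \<in> H1" using S_H1 V_mem by blast

lemma L2_triangle:
  "x \<in> H1 \<Longrightarrow> y \<in> H1 \<Longrightarrow> L2_norm \<Omega> (x + y) \<le> L2_norm \<Omega> x + L2_norm \<Omega> y"
  using L2.nrm_triangle[of x \<Omega> y] H1_sqint by (simp add: L2_nrm)

lemma H1_triangle:
  "x \<in> H1 \<Longrightarrow> y \<in> H1 \<Longrightarrow> H1_norm \<Omega> (x + y) \<le> H1_norm \<Omega> x + H1_norm \<Omega> y"
  using H1.nrm_triangle[of x y] by (simp only: H1_nrm)

lemma H1_le: "H1_norm \<Omega> x \<le> L2_norm \<Omega> x + L2_norm \<Omega> (weak_grad \<Omega> x)"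
  unfolding H1_norm_def by (rule sqrt_sum_squares_le_sum) auto

lemma H1_minus: "x \<in> H1 \<Longrightarrow> y \<in> H1 \<Longrightarrow> H1_norm \<Omega> (x - y) = H1_norm \<Omega> (y - x)"
  using H1.nrm_minus_commute[of x y] by (simp only: H1_nrm)

lemma powr_le_1: "h \<in> {0<..1} \<Longrightarrow> h powr r \<le> 1"
  using powr_mono2[of r h 1] r by auto

lemma rho_parts:
  assumes "h \<in> {0<..1}" "t \<in> {0..T}"
  shows "L2_norm \<Omega> (u t - V h t) \<le> Q * h powr r" "L2_norm \<Omega> (ut t - Vt h t) \<le> Q * h powr r"
    "H1_norm \<Omega> (u t - V h t) \<le> Q * h powr (r - 1)"
proof -
  have h: "0 < h" using assms by simp
  have n: "0 \<le> h * H1_norm \<Omega> (u t - V h t)" using h by simp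
  show "L2_norm \<Omega> (u t - V h t) \<le> Q * h powr r" "L2_norm \<Omega> (ut t - Vt h t) \<le> Q * h powr r"
    using rho[OF assms] n L2_norm_nonneg[of \<Omega> "u t - V h t"] L2_norm_nonneg[of \<Omega> "ut t - Vt h t"] by linarith+
  have "h * H1_norm \<Omega> (u t - V h t) \<le> Q * h powr r"
    using rho[OF assms] L2_norm_nonneg[of \<Omega> "u t - V h t"] L2_norm_nonneg[of \<Omega> "ut t - Vt h t"] by linarith
  also have "Q * h powr r = h * (Q * h powr (r - 1))" using h by (simp add: powr_diff)
  finally show "H1_norm \<Omega> (u t - V h t) \<le> Q * h powr (r - 1)" using h by simp
qed

text \<open>A Lipschitz constant of the solution in time; like all constants below, it depends neither on the time nor on the
  mesh size.\<close>

definition Lu :: real where "Lu = L2_norm \<Omega> (ut 0) + Q * T"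

lemma zero_in: "0 \<in> {0..T}" using T_pos by simp

lemma ut_sqint: "t \<in> {0..T} \<Longrightarrow> sqint \<Omega> (ut t)" using L2_time_deriv_sqint(2)[OF u_deriv(1)] .

lemma Vt_sqint: "h \<in> {0<..1} \<Longrightarrow> t \<in> {0..T} \<Longrightarrow> sqint \<Omega> (Vt h t)"
  using V_deriv(2) S_H1 H1_sqint by blast

lemma Lu_nonneg: "0 \<le> Lu" using Q T_pos by (simp add: Lu_def)

lemma ut_bound: assumes t: "t \<in> {0..T}" shows "L2_norm \<Omega> (ut t) \<le> Lu"
proof -
  have s: "sqint \<Omega> (ut t - ut 0)"
    using sqint_diff[OF ut_sqint[OF t] ut_sqint[OF zero_in]] by (simp add: fun_diff_def)
  have "L2_norm \<Omega> (ut t) \<le> L2_norm \<Omega> (ut t - ut 0) + L2_norm \<Omega> (ut 0)"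
    using L2.nrm_triangle[of "ut t - ut 0" \<Omega> "ut 0"] s ut_sqint[OF zero_in] by (simp add: L2_nrm)
  moreover have "L2_norm \<Omega> (ut t - ut 0) \<le> Q * \<bar>t - 0\<bar>"
    by (rule L2_time_lipschitz[OF u_deriv(2) utt_bound zero_in t])
  moreover have "Q * \<bar>t - 0\<bar> \<le> Q * T" using t Q by (intro mult_left_mono) auto
  ultimately show ?thesis by (simp add: Lu_def)
qed

lemma u_lipschitz: "s \<in> {0..T} \<Longrightarrow> t \<in> {0..T} \<Longrightarrow> L2_norm \<Omega> (u t - u s) \<le> Lu * \<bar>t - s\<bar>"
  by (rule L2_time_lipschitz[OF u_deriv(1) ut_bound])

lemma V_lipschitz:
  assumes h: "h \<in> {0<..1}" and st: "s \<in> {0..T}" "t \<in> {0..T}"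
  shows "H1_norm \<Omega> (V h t - V h s) \<le> (Lu + Q + Q * vol) * \<bar>t - s\<bar>"
proof -
  have vt: "L2_norm \<Omega> (Vt h t) \<le> Lu + Q" if t: "t \<in> {0..T}" for t
  proof -
    have s: "sqint \<Omega> (ut t - Vt h t)"
      using sqint_diff[OF ut_sqint[OF t] Vt_sqint[OF h t]] by (simp add: fun_diff_def)
    have "Vt h t = ut t - (ut t - Vt h t)" by simp
    then have "L2_norm \<Omega> (Vt h t) \<le> L2_norm \<Omega> (ut t) + L2_norm \<Omega> (ut t - Vt h t)"
      using L2.nrm_triangle_minus[of "ut t" \<Omega> "ut t - Vt h t"] s ut_sqint[OF t] by (simp add: L2_nrm)
    moreover have "Q * h powr r \<le> Q * 1" using powr_le_1[OF h] Q by (rule mult_left_mono)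
    ultimately show ?thesis using ut_bound[OF t] rho_parts(2)[OF h t] by linarith
  qed
  have gt: "L2_norm \<Omega> (weak_grad \<Omega> (Vt h t)) \<le> Q * vol" if "t \<in> {0..T}" for t
    using grad_bounded_L2[OF _ V_grad(2)[OF h that] Q] V_deriv(2)[OF h that] S_H1[OF h] by blast
  have "L2_norm \<Omega> (V h t - V h s) \<le> (Lu + Q) * \<bar>t - s\<bar>"
    by (rule L2_time_lipschitz[OF V_deriv(1)[OF h] vt st])
  moreover have "L2_norm \<Omega> (weak_grad \<Omega> (V h t - V h s)) \<le> (Q * vol) * \<bar>t - s\<bar>"
    by (rule grad_time_lipschitz[OF S_space(1)[OF h] _ V_deriv(1)[OF h] V_mem[OF h] V_deriv(2)[OF h] gt st])
      (use S_H1[OF h] in blast)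
  ultimately show ?thesis using H1_le[of "V h t - V h s"] by (simp add: algebra_simps)
qed

lemma V_bound:
  assumes h: "h \<in> {0<..1}" and t: "t \<in> {0..T}"
  shows "H1_norm \<Omega> (V h t) \<le> L2_norm \<Omega> (u 0) + Lu * T + Q + Q * vol"
proof -
  have H: "u t - u 0 \<in> H1" "u 0 \<in> H1" "u t \<in> H1" "u t - V h t \<in> H1"
    using u_H1 t zero_in V_H1[OF h t] H1_diff by auto
  have "L2_norm \<Omega> (u t) \<le> L2_norm \<Omega> (u t - u 0) + L2_norm \<Omega> (u 0)" using L2_triangle[OF H(1,2)] by simp
  moreover have "L2_norm \<Omega> (u t - u 0) \<le> Lu * \<bar>t - 0\<bar>" by (rule u_lipschitz[OF zero_in t])
  moreover have "Lu * \<bar>t - 0\<bar> \<le> Lu * T" using t Lu_nonneg by (intro mult_left_mono) auto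
  moreover have "L2_norm \<Omega> (V h t) \<le> L2_norm \<Omega> (u t) + L2_norm \<Omega> (u t - V h t)"
    using L2.nrm_triangle_minus[of "u t" \<Omega> "u t - V h t"] H1_sqint[OF H(3)] H1_sqint[OF H(4)] by (simp add: L2_nrm)
  moreover have "Q * h powr r \<le> Q * 1" using powr_le_1[OF h] Q by (rule mult_left_mono)
  moreover have "L2_norm \<Omega> (weak_grad \<Omega> (V h t)) \<le> Q * vol"
    by (rule grad_bounded_L2[OF V_H1[OF h t] V_grad(1)[OF h t] Q])
  ultimately show ?thesis using rho_parts(1)[OF h t] H1_le[of "V h t"] by linarith
qed

text \<open>A bound and a Lipschitz constant in time for the functional that maps \<open>v\<close> to \<open>B(u(s); V\<^sub>h(s), v)\<close>.\<close>

definition M\<Phi> :: real where "M\<Phi> = 2 * C * (L2_norm \<Omega> (u 0) + Lu * T + Q + Q * vol + vol)"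
definition L\<Phi> :: real where "L\<Phi> = 2 * C * (Q + 1) * Lu + 2 * C * (Lu + Q + Q * vol)"

lemma M\<Phi>_nonneg: "0 \<le> M\<Phi>" and L\<Phi>_nonneg: "0 \<le> L\<Phi>"
  using C_nonneg Q Lu_nonneg T_pos by (simp_all add: M\<Phi>_def L\<Phi>_def)

lemma \<Phi>_bound:
  assumes h: "h \<in> {0<..1}" and t: "t \<in> {0..T}" and v: "v \<in> H1"
  shows "\<bar>Bt (u t) (V h t) v\<bar> \<le> M\<Phi> * H1_norm \<Omega> v"
proof -
  have "\<bar>Bt (u t) (V h t) v\<bar> \<le> 2 * C * (H1_norm \<Omega> (V h t) + vol) * H1_norm \<Omega> v"
    by (rule Bt_bound[OF u_sqint[OF t] V_H1[OF h t] v])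
  also have "\<dots> \<le> M\<Phi> * H1_norm \<Omega> v"
    unfolding M\<Phi>_def using V_bound[OF h t] C_nonneg by (intro mult_right_mono mult_left_mono add_right_mono) auto
  finally show ?thesis .
qed

lemma \<Phi>_lipschitz:
  assumes h: "h \<in> {0<..1}" and st: "s \<in> {0..T}" "t \<in> {0..T}" and v: "v \<in> H1"
  shows "\<bar>Bt (u s) (V h s) v - Bt (u t) (V h t) v\<bar> \<le> L\<Phi> * \<bar>s - t\<bar> * H1_norm \<Omega> v"
proof -
  have "\<bar>Bt (u s) (V h s) v - Bt (u t) (V h s) v\<bar> \<le> 2 * C * (Q + 1) * L2_norm \<Omega> (u s - u t) * H1_norm \<Omega> v"
    by (rule Bt_lipschitz[OF u_sqint[OF st(1)] u_sqint[OF st(2)] V_H1[OF h st(1)] V_grad(1)[OF h st(1)] v Q])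
  also have "\<dots> \<le> 2 * C * (Q + 1) * (Lu * \<bar>s - t\<bar>) * H1_norm \<Omega> v"
    using u_lipschitz[OF st(2,1)] C_nonneg Q by (intro mult_right_mono mult_left_mono) auto
  finally have 1: "\<bar>Bt (u s) (V h s) v - Bt (u t) (V h s) v\<bar> \<le> \<dots>" .
  have "\<bar>Bt (u t) (V h s) v - Bt (u t) (V h t) v\<bar> \<le> 2 * C * H1_norm \<Omega> (V h s - V h t) * H1_norm \<Omega> v"
    unfolding Bt_diff[OF u_sqint[OF st(2)] V_H1[OF h st(1)] V_H1[OF h st(2)] v]
    by (rule B1_bound[OF u_sqint[OF st(2)] H1_diff[OF V_H1[OF h st(1)] V_H1[OF h st(2)]] v])
  also have "\<dots> \<le> 2 * C * ((Lu + Q + Q * vol) * \<bar>s - t\<bar>) * H1_norm \<Omega> v"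
    using V_lipschitz[OF h st(2,1)] C_nonneg by (intro mult_right_mono mult_left_mono) auto
  finally have 2: "\<bar>Bt (u t) (V h s) v - Bt (u t) (V h t) v\<bar> \<le> \<dots>" .
  have "L\<Phi> * \<bar>s - t\<bar> * H1_norm \<Omega> v = 2 * C * (Q + 1) * (Lu * \<bar>s - t\<bar>) * H1_norm \<Omega> v
      + 2 * C * ((Lu + Q + Q * vol) * \<bar>s - t\<bar>) * H1_norm \<Omega> v"
    by (simp add: L\<Phi>_def algebra_simps)
  then show ?thesis using 1 2 by linarith
qed

text \<open>The gradient of the solution is not assumed here to be differentiable in time.  The exact memory integrand is
  nevertheless Lipschitz continuous in time, being the limit of the projected ones as the mesh size tends to
  0, and the Lipschitz constant of these is uniform.\<close>

lemma exact_lipschitz: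
  assumes st: "s \<in> {0..T}" "t \<in> {0..T}" and v: "v \<in> H1"
  shows "\<bar>Bt (u s) (u s) v - Bt (u t) (u t) v\<bar> \<le> L\<Phi> * H1_norm \<Omega> v * \<bar>s - t\<bar>"
proof -
  have "\<bar>Bt (u s) (u s) v - Bt (u t) (u t) v\<bar>
      \<le> L\<Phi> * \<bar>s - t\<bar> * H1_norm \<Omega> v + 2 * (2 * C * (Q * h powr (r - 1)) * H1_norm \<Omega> v)" if h: "h \<in> {0<..1}" for h
  proof -
    have "\<bar>Bt (u t) (u t) v - Bt (u t) (V h t) v\<bar> \<le> 2 * C * (Q * h powr (r - 1)) * H1_norm \<Omega> v" if t: "t \<in> {0..T}" for t
    proof -
      have "\<bar>Bt (u t) (u t) v - Bt (u t) (V h t) v\<bar> \<le> 2 * C * H1_norm \<Omega> (u t - V h t) * H1_norm \<Omega> v"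
        unfolding Bt_diff[OF u_sqint[OF t] u_H1[OF t] V_H1[OF h t] v]
        by (rule B1_bound[OF u_sqint[OF t] H1_diff[OF u_H1[OF t] V_H1[OF h t]] v])
      also have "\<dots> \<le> 2 * C * (Q * h powr (r - 1)) * H1_norm \<Omega> v"
        using rho_parts(3)[OF h t] C_nonneg by (intro mult_right_mono mult_left_mono) auto
      finally show ?thesis .
    qed
    from this[OF st(1)] this[OF st(2)] \<Phi>_lipschitz[OF h st v] show ?thesis by linarith
  qed
  moreover have "((\<lambda>h. L\<Phi> * \<bar>s - t\<bar> * H1_norm \<Omega> v + 2 * (2 * C * (Q * h powr (r - 1)) * H1_norm \<Omega> v)) \<longlongrightarrow>
      L\<Phi> * \<bar>s - t\<bar> * H1_norm \<Omega> v + 2 * (2 * C * (Q * 0) * H1_norm \<Omega> v)) (at_right 0)"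
  proof (intro tendsto_intros)
    show "((\<lambda>h::real. h powr (r - 1)) \<longlongrightarrow> 0) (at_right 0)"
      using r by (intro tendsto_zero_powrI[where b = "r - 1"]) (auto intro!: tendsto_intros eventually_at_rightI[of 0 1])
  qed
  moreover have "\<forall>\<^sub>F h in at_right 0. (h::real) \<in> {0<..1}"
    by (rule eventually_at_rightI[of 0 1]) auto
  ultimately have "\<bar>Bt (u s) (u s) v - Bt (u t) (u t) v\<bar>
      \<le> L\<Phi> * \<bar>s - t\<bar> * H1_norm \<Omega> v + 2 * (2 * C * (Q * 0) * H1_norm \<Omega> v)"
    by (intro tendsto_lowerbound[where F = "at_right (0::real)"]) (auto elim: eventually_mono)
  then show ?thesis by (simp add: mult_ac)
qed

lemma exact_continuous: assumes v: "v \<in> H1" shows "continuous_on {0..T} (\<lambda>s. Bt (u s) (u s) v)"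
proof -
  have "(L\<Phi> * H1_norm \<Omega> v)-lipschitz_on {0..T} (\<lambda>s. Bt (u s) (u s) v)"
    using exact_lipschitz[OF _ _ v] L\<Phi>_nonneg by (intro lipschitz_onI) (auto simp: dist_real_def)
  then show ?thesis by (rule lipschitz_on_continuous_on)
qed

lemma \<Phi>_continuous:
  assumes h: "h \<in> {0<..1}" and v: "v \<in> H1" shows "continuous_on {0..T} (\<lambda>s. Bt (u s) (V h s) v)"
proof -
  have "(L\<Phi> * H1_norm \<Omega> v)-lipschitz_on {0..T} (\<lambda>s. Bt (u s) (V h s) v)"
    using \<Phi>_lipschitz[OF h _ _ v] L\<Phi>_nonneg by (intro lipschitz_onI) (auto simp: dist_real_def mult_ac)
  then show ?thesis by (rule lipschitz_on_continuous_on)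
qed

text \<open>Subtracting the definition of the Ritz-Volterra projection from the weak form leaves the memory term whose
  coefficients are evaluated at the solution and whose argument is the projection.\<close>

lemma memory_identity:
  assumes h: "h \<in> {0<..1}" and t: "t \<in> {0..T}" and v: "v \<in> H1"
  shows "integral {0..t} (\<lambda>s. K (t - s) * Bt (u s) (u s) v)
    - integral {0..t} (\<lambda>s. K (t - s) * B1 (u s) (u s - V h s) v)
    = integral {0..t} (\<lambda>s. K (t - s) * Bt (u s) (V h s) v)"
proof -
  have sub: "{0..t} \<subseteq> {0..T}" using t by auto
  have i1: "(\<lambda>s. K (t - s) * Bt (u s) (u s) v) integrable_on {0..t}"
    using t continuous_on_subset[OF exact_continuous[OF v] sub] by (intro kernel_product) auto
  have i2: "(\<lambda>s. K (t - s) * Bt (u s) (V h s) v) integrable_on {0..t}"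
    using t continuous_on_subset[OF \<Phi>_continuous[OF h v] sub] by (intro kernel_product) auto
  have "integral {0..t} (\<lambda>s. K (t - s) * B1 (u s) (u s - V h s) v)
      = integral {0..t} (\<lambda>s. K (t - s) * Bt (u s) (u s) v - K (t - s) * Bt (u s) (V h s) v)"
  proof (rule Henstock_Kurzweil_Integration.integral_cong)
    fix s assume "s \<in> {0..t}"
    then have s: "s \<in> {0..T}" using sub by auto
    show "K (t - s) * B1 (u s) (u s - V h s) v = K (t - s) * Bt (u s) (u s) v - K (t - s) * Bt (u s) (V h s) v"
      using Bt_diff[OF u_sqint[OF s] u_H1[OF s] V_H1[OF h s] v] by (simp add: right_diff_distrib[symmetric])
  qed
  also have "\<dots> = integral {0..t} (\<lambda>s. K (t - s) * Bt (u s) (u s) v) - integral {0..t} (\<lambda>s. K (t - s) * Bt (u s) (V h s) v)"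
    by (rule Henstock_Kurzweil_Integration.integral_diff[OF i1 i2])
  finally show ?thesis by simp
qed

text \<open>The consistency error of the time discretisation splits into the truncation error of the difference
  quotient and the difference quotient of the projection error.\<close>

lemma truncation_bound:
  assumes h: "h \<in> {0<..1}" and st: "0 \<le> s" "s < t" "t \<le> T"
  shows "sqint \<Omega> (ut t - (1 / (t - s)) *\<^sub>R (V h t - V h s))"
    "L2_norm \<Omega> (ut t - (1 / (t - s)) *\<^sub>R (V h t - V h s)) \<le> Q * (t - s + h powr r)"
proof -
  define k where "k = t - s"
  have k: "0 < k" using st by (simp add: k_def)
  have ts: "t \<in> {0..T}" "s \<in> {0..T}" using st by auto
  define E where "E = u t - u s - k *\<^sub>R ut t"
  define P where "P = (u t - V h t) - (u s - V h s)"
  have mem: "ut t \<in> {F. sqint \<Omega> F}" "u t \<in> {F. sqint \<Omega> F}" "u s \<in> {F. sqint \<Omega> F}"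
      "V h t \<in> {F. sqint \<Omega> F}" "V h s \<in> {F. sqint \<Omega> F}"
    using ut_sqint u_sqint V_H1[OF h] H1_sqint ts by auto
  have EP: "E \<in> {F. sqint \<Omega> F}" "P \<in> {F. sqint \<Omega> F}"
    unfolding E_def P_def by (intro L2.mem_intros mem)+
  have eq: "ut t - (1 / (t - s)) *\<^sub>R (V h t - V h s) = (1 / k) *\<^sub>R (P - E)"
  proof -
    have "(1 / k) *\<^sub>R (P - E) = (1 / k) *\<^sub>R (k *\<^sub>R ut t) - (1 / k) *\<^sub>R (V h t - V h s)"
      unfolding E_def P_def by (simp only: scaleR_diff_right[symmetric]) (simp add: algebra_simps)
    then show ?thesis using k by (simp add: k_def)
  qed
  have PE: "P - E \<in> {F. sqint \<Omega> F}" using EP by (intro L2.mem_intros)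
  then show "sqint \<Omega> (ut t - (1 / (t - s)) *\<^sub>R (V h t - V h s))"
    unfolding eq using L2.mem_intros(3)[OF PE, of "1 / k"] by simp
  have "L2_norm \<Omega> E \<le> Q * k\<^sup>2"
    unfolding E_def k_def using st by (intro L2_backward_difference[OF u_deriv utt_bound]) auto
  moreover have "L2.nrm \<Omega> P \<le> (Q * h powr r) * \<bar>t - s\<bar>"
    unfolding P_def
  proof (rule L2.lipschitz_of_weak_deriv[where I = "{0..T}" and F = "\<lambda>t. u t - V h t" and F' = "\<lambda>t. ut t - Vt h t"])
    fix \<tau> assume \<tau>: "\<tau> \<in> {0..T}"
    have m: "u \<tau> \<in> {F. sqint \<Omega> F}" "V h \<tau> \<in> {F. sqint \<Omega> F}" "ut \<tau> \<in> {F. sqint \<Omega> F}" "Vt h \<tau> \<in> {F. sqint \<Omega> F}"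
      using ut_sqint u_sqint V_H1[OF h] Vt_sqint[OF h] H1_sqint \<tau> by auto
    show "u \<tau> - V h \<tau> \<in> {F. sqint \<Omega> F}" by (rule L2.mem_intros(2)[OF m(1,2)])
    show "ut \<tau> - Vt h \<tau> \<in> {F. sqint \<Omega> F}" by (rule L2.mem_intros(2)[OF m(3,4)])
    show "L2.nrm \<Omega> (ut \<tau> - Vt h \<tau>) \<le> Q * h powr r" using rho_parts(2)[OF h \<tau>] by (simp only: L2_nrm)
    fix w :: "real^'n \<Rightarrow> real" assume w: "w \<in> {F. sqint \<Omega> F}"
    have "((\<lambda>s. L2_inner \<Omega> (u s) w - L2_inner \<Omega> (V h s) w) has_real_derivative
        L2_inner \<Omega> (ut \<tau>) w - L2_inner \<Omega> (Vt h \<tau>) w) (at \<tau> within {0..T})"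
      using w by (intro DERIV_diff L2_time_deriv_weak[OF u_deriv(1) \<tau>] L2_time_deriv_weak[OF V_deriv(1)[OF h] \<tau>]) auto
    moreover have "L2_inner \<Omega> (ut \<tau>) w - L2_inner \<Omega> (Vt h \<tau>) w = L2_inner \<Omega> (ut \<tau> - Vt h \<tau>) w"
      using L2.minus_left[OF m(3,4) w] by simp
    moreover have "L2_inner \<Omega> (u y) w - L2_inner \<Omega> (V h y) w = L2_inner \<Omega> (u y - V h y) w" if "y \<in> {0..T}" for y
      using L2.minus_left[of "u y" \<Omega> "V h y" w] u_sqint[OF that] H1_sqint[OF V_H1[OF h that]] w by simp
    ultimately show "((\<lambda>s. L2_inner \<Omega> (u s - V h s) w) has_real_derivative L2_inner \<Omega> (ut \<tau> - Vt h \<tau>) w) (at \<tau> within {0..T})"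
      using \<tau> by (subst has_field_derivative_cong_eventually[symmetric, where f = "\<lambda>s. L2_inner \<Omega> (u s) w - L2_inner \<Omega> (V h s) w"])
        (auto simp: eventually_at_topological)
  qed (use ts in auto)
  moreover have "L2_norm \<Omega> ((1 / k) *\<^sub>R (P - E)) = (1 / k) * L2_norm \<Omega> (P - E)"
    using L2.nrm_scale[OF PE, of "1 / k"] k by (simp add: L2_nrm)
  moreover have "L2_norm \<Omega> (P - E) \<le> L2_norm \<Omega> P + L2_norm \<Omega> E"
    using L2.nrm_triangle_minus[OF EP(2,1)] by (simp only: L2_nrm)
  ultimately have "L2_norm \<Omega> ((1 / k) *\<^sub>R (P - E)) \<le> (1 / k) * (Q * h powr r * k + Q * k\<^sup>2)"
    using k by (simp add: L2_nrm k_def divide_right_mono)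
  also have "\<dots> = Q * (t - s + h powr r)" using k by (simp add: power2_eq_square field_simps flip: k_def)
  finally show "L2_norm \<Omega> (ut t - (1 / (t - s)) *\<^sub>R (V h t - V h s)) \<le> Q * (t - s + h powr r)"
    by (simp only: eq)
qed

end

section \<open>Stability and convergence of the scheme\<close>

lemma sum_reverse: "(\<Sum>j=1..m::nat. f (m - j)) = (\<Sum>l<m. f l :: 'a::comm_monoid_add)"
  by (rule sum.reindex_bij_witness[of _ "\<lambda>l. m - l" "\<lambda>j. m - j"]) auto

lemma discrete_gronwall:
  fixes x :: "nat \<Rightarrow> real"
  assumes b: "0 \<le> b" and c: "0 \<le> c" "c \<le> 1 / 2" and x: "\<And>i. 0 \<le> x i"
    and le: "\<And>m. 1 \<le> m \<Longrightarrow> m \<le> N \<Longrightarrow> x m \<le> b + c * (\<Sum>i=1..m. x i)"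
    and m: "1 \<le> m" "m \<le> N"
  shows "x m \<le> 2 * b * exp (2 * c * real N)"
proof -
  have step: "x (Suc n) \<le> 2 * b + 2 * c * (\<Sum>i=1..n. x i)" if "Suc n \<le> N" for n
  proof -
    have s: "0 \<le> b + c * (\<Sum>i=1..n. x i)" using b c x by (simp add: sum_nonneg)
    have "x (Suc n) * (1 - c) \<le> b + c * (\<Sum>i=1..n. x i)"
      using le[of "Suc n"] that by (simp add: algebra_simps)
    then have "x (Suc n) \<le> (b + c * (\<Sum>i=1..n. x i)) / (1 - c)" using c by (simp add: pos_le_divide_eq)
    also have "\<dots> \<le> (b + c * (\<Sum>i=1..n. x i)) / (1 / 2)" using c s by (intro divide_left_mono) auto
    finally show ?thesis by simp
  qed
  have grow: "2 * b + 2 * c * (\<Sum>i=1..n. x i) \<le> 2 * b * (1 + 2 * c) ^ n" if "n \<le> N" for n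
    using that
  proof (induction n)
    case (Suc n)
    have "2 * b + 2 * c * (\<Sum>i=1..Suc n. x i) = (2 * b + 2 * c * (\<Sum>i=1..n. x i)) + 2 * c * x (Suc n)"
      by (simp add: algebra_simps)
    also have "\<dots> \<le> (2 * b + 2 * c * (\<Sum>i=1..n. x i)) + 2 * c * (2 * b + 2 * c * (\<Sum>i=1..n. x i))"
      using step[of n] Suc.prems c by (intro add_left_mono mult_left_mono) auto
    also have "\<dots> = (2 * b + 2 * c * (\<Sum>i=1..n. x i)) * (1 + 2 * c)" by (simp add: algebra_simps)
    also have "\<dots> \<le> 2 * b * (1 + 2 * c) ^ n * (1 + 2 * c)" using Suc c by (intro mult_right_mono) auto
    finally show ?case by (simp add: mult_ac)
  qed simp
  obtain n where n: "m = Suc n" using m by (cases m) auto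
  have "x m \<le> 2 * b * (1 + 2 * c) ^ n" using step[of n] grow[of n] m n by simp
  also have "\<dots> \<le> 2 * b * exp (2 * c) ^ N"
  proof (rule mult_left_mono)
    have "(1 + 2 * c) ^ n \<le> (1 + 2 * c) ^ N" using c m n by (intro power_increasing) auto
    also have "\<dots> \<le> exp (2 * c) ^ N" using c exp_ge_add_one_self[of "2 * c"] by (intro power_mono) auto
    finally show "(1 + 2 * c) ^ n \<le> exp (2 * c) ^ N" .
  qed (use b in simp)
  also have "exp (2 * c) ^ N = exp (2 * c * real N)" by (simp add: exp_of_nat_mult[symmetric] mult.commute)
  finally show ?thesis .
qed

context discretisation
begin

lemma A_minus_left:
  assumes "t \<in> {0..T}" "x \<in> H1" "y \<in> H1" "v \<in> H1"
  shows "A t (x - y) v = A t x v - A t y v"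
  using A_lin_right[OF assms(1,4,2,3), of "-1"] A_sym[OF assms(1)] by simp

lemma scheme_mem:
  assumes "two_grid_step \<Omega> T a a0 \<alpha> \<beta> \<gamma> g f \<omega> N (S h) U0 W U" "j \<le> N" shows "U j \<in> S h"
  using assms by (cases "j = 0") (auto simp: two_grid_step_def)

text \<open>The source consists of the truncation error, the quadrature error, and the error in the nonlinear form.\<close>

lemma error_equation:
  assumes h: "h \<in> {0<..1}" and N: "0 < N"
    and step: "two_grid_step \<Omega> T a a0 \<alpha> \<beta> \<gamma> g f \<omega> N (S h) U0 W U"
    and j: "1 \<le> j" "j \<le> N" and v: "v \<in> S h"
  defines "k \<equiv> T / real N" and "t \<equiv> tgrid T N"
  shows "L2_inner \<Omega> ((U j - V h (t j)) - (U (j - 1) - V h (t (j - 1)))) v + k * A (t j) (U j - V h (t j)) v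
    = k * (L2_inner \<Omega> (ut (t j) - (1 / k) *\<^sub>R (V h (t j) - V h (t (j - 1)))) v
        - quad_error T K \<omega> N j (\<lambda>s. Bt (u s) (V h s) v)
        + k * (\<Sum>i=1..j. \<omega> N j i * (Bt (u (t i)) (V h (t i)) v - Bt (W i) (U i) v)))"
proof -
  have k: "0 < k" using T_pos N by (simp add: k_def)
  have tj: "t j \<in> {0<..T}" "t j \<in> {0..T}" using tgrid_bounds[OF j] by (auto simp: t_def)
  have tj1: "t (j - 1) \<in> {0..T}"
    using tgrid_bounds[of "j - 1" N] j T_pos by (cases "j = 1") (auto simp: t_def tgrid_def)
  have vH: "v \<in> H1" "v \<in> H10_space \<Omega>" using S_H1[OF h v] S_space(2)[OF h] v by auto
  have UH: "U j \<in> H1" "U (j - 1) \<in> H1" using scheme_mem[OF step] S_H1[OF h] j by auto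
  have VH: "V h (t j) \<in> H1" "V h (t (j - 1)) \<in> H1" using V_H1[OF h] tj tj1 by auto
  have sq: "U j \<in> {F. sqint \<Omega> F}" "U (j - 1) \<in> {F. sqint \<Omega> F}" "V h (t j) \<in> {F. sqint \<Omega> F}"
      "V h (t (j - 1)) \<in> {F. sqint \<Omega> F}" "v \<in> {F. sqint \<Omega> F}" "ut (t j) \<in> {F. sqint \<Omega> F}"
    using UH VH vH H1_sqint ut_sqint tj by auto
  define X where "X = L2_inner \<Omega> (U j - U (j - 1)) v"
  define Y where "Y = L2_inner \<Omega> (V h (t j) - V h (t (j - 1))) v"
  define I1 where "I1 = integral {0..t j} (\<lambda>s. K (t j - s) * Bt (u s) (u s) v)"
  define I2 where "I2 = integral {0..t j} (\<lambda>s. K (t j - s) * B1 (u s) (u s - V h s) v)"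
  define I3 where "I3 = integral {0..t j} (\<lambda>s. K (t j - s) * Bt (u s) (V h s) v)"
  define BW where "BW = (\<Sum>i=1..j. \<omega> N j i * Bt (W i) (U i) v)"
  define BV where "BV = (\<Sum>i=1..j. \<omega> N j i * Bt (u (t i)) (V h (t i)) v)"
  have s1: "1 / k * X + A (t j) (U j) v + k * BW = L2_inner \<Omega> (f (t j)) v"
    using step j v unfolding two_grid_step_def k_def t_def X_def BW_def by auto
  have s2: "L2_inner \<Omega> (ut (t j)) v + A (t j) (u (t j)) v + I1 = L2_inner \<Omega> (f (t j)) v"
    unfolding I1_def by (rule weak[OF tj(1) vH(2)])
  have s3: "A (t j) (u (t j)) v - A (t j) (V h (t j)) v + I2 = 0"
    using ritz[OF h tj(2) v] A_minus_left[OF tj(2) u_H1[OF tj(2)] VH(1) vH(1)] unfolding I2_def by simp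
  have s4: "I1 - I2 = I3" unfolding I1_def I2_def I3_def by (rule memory_identity[OF h tj(2) vH(1)])
  have s5: "quad_error T K \<omega> N j (\<lambda>s. Bt (u s) (V h s) v) = k * BV - I3"
    unfolding quad_error_def k_def t_def BV_def I3_def by (rule refl)
  have l1: "L2_inner \<Omega> ((U j - V h (t j)) - (U (j - 1) - V h (t (j - 1)))) v = X - Y"
    using L2.minus_left[OF L2.mem_intros(2)[OF sq(1,3)] L2.mem_intros(2)[OF sq(2,4)] sq(5)]
      L2.minus_left[OF sq(1,3,5)] L2.minus_left[OF sq(2,4,5)] L2.minus_left[OF sq(1,2,5)] L2.minus_left[OF sq(3,4,5)]
    unfolding X_def Y_def by linarith
  have l2: "L2_inner \<Omega> (ut (t j) - (1 / k) *\<^sub>R (V h (t j) - V h (t (j - 1)))) v = L2_inner \<Omega> (ut (t j)) v - 1 / k * Y"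
    unfolding Y_def using L2.minus_left[OF sq(6) L2.mem_intros(3)[OF L2.mem_intros(2)[OF sq(3,4)]] sq(5)]
      L2.scale_left[OF L2.mem_intros(2)[OF sq(3,4)] sq(5)] by simp
  have l3: "(\<Sum>i=1..j. \<omega> N j i * (Bt (u (t i)) (V h (t i)) v - Bt (W i) (U i) v)) = BV - BW"
    by (simp add: BV_def BW_def right_diff_distrib sum_subtractf)
  have l4: "A (t j) (U j - V h (t j)) v = A (t j) (U j) v - A (t j) (V h (t j)) v"
    by (rule A_minus_left[OF tj(2) UH(1) VH(1) vH(1)])
  have "X = k * (1 / k * X)" "Y = k * (1 / k * Y)" using k by simp_all
  then have "X - Y + k * (A (t j) (U j) v - A (t j) (V h (t j)) v)
      = k * (1 / k * X - 1 / k * Y + (A (t j) (U j) v - A (t j) (V h (t j)) v))"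
    by (simp only: distrib_left right_diff_distrib)
  also have "1 / k * X - 1 / k * Y + (A (t j) (U j) v - A (t j) (V h (t j)) v)
      = L2_inner \<Omega> (ut (t j)) v - 1 / k * Y - (k * BV - I3) + k * (BV - BW)"
    using s1 s2 s3 s4 unfolding right_diff_distrib by linarith
  finally show ?thesis unfolding l1 l2 l3 l4 s5 .
qed

text \<open>The constants of the stability estimate: \<open>cq\<close> for the quadrature errors, \<open>cF\<close> for the nonlinear form and for the time
  dependence of the elliptic form, and \<open>cS\<close> for the whole estimate.\<close>

definition cq :: real where
  "cq = (M\<Phi> / sqrt \<nu>0 + 2 * (L\<Phi> / sqrt \<nu>0) * T) * (2 * Cq + K1) + L\<Phi> / sqrt \<nu>0 * T * K1"
definition cF :: real where "cF = (2 * C * (Q + 1) * K1 + 2 * CA) / sqrt \<nu>0"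
definition cS :: real where "cS = (sqrt (2 * CA) + sqrt T * Q + cq + cF) / sqrt \<nu>0"

lemma const_nonneg: "0 \<le> cq" "0 \<le> cF" "0 \<le> cS"
proof -
  show 1: "0 \<le> cq" unfolding cq_def using M\<Phi>_nonneg L\<Phi>_nonneg nu T_pos Cq K1 by simp
  show 2: "0 \<le> cF" unfolding cF_def using C_nonneg Q K1 CA nu by simp
  show "0 \<le> cS" unfolding cS_def using 1 2 CA T_pos Q nu by simp
qed

lemma F_bound:
  assumes h: "h \<in> {0<..1}" and t: "t \<in> {0..T}" and w: "sqint \<Omega> w" and U: "U \<in> H1" and v: "v \<in> H1"
  shows "\<bar>Bt (u t) (V h t) v - Bt w U v\<bar>
    \<le> 2 * C * (Q + 1) * (L2_norm \<Omega> (u t - w) + H1_norm \<Omega> (U - V h t)) * H1_norm \<Omega> v"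
proof -
  have 1: "\<bar>Bt (u t) (V h t) v - Bt w (V h t) v\<bar> \<le> 2 * C * (Q + 1) * L2_norm \<Omega> (u t - w) * H1_norm \<Omega> v"
    by (rule Bt_lipschitz[OF u_sqint[OF t] w V_H1[OF h t] V_grad(1)[OF h t] v Q])
  have "\<bar>Bt w (V h t) v - Bt w U v\<bar> \<le> 2 * C * H1_norm \<Omega> (V h t - U) * H1_norm \<Omega> v"
    unfolding Bt_diff[OF w V_H1[OF h t] U v] by (rule B1_bound[OF w H1_diff[OF V_H1[OF h t] U] v])
  also have "H1_norm \<Omega> (V h t - U) = H1_norm \<Omega> (U - V h t)" by (rule H1_minus[OF V_H1[OF h t] U])
  also have "2 * C * H1_norm \<Omega> (U - V h t) * H1_norm \<Omega> v \<le> 2 * C * (Q + 1) * H1_norm \<Omega> (U - V h t) * H1_norm \<Omega> v"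
  proof -
    have "2 * C * 1 \<le> 2 * C * (Q + 1)" using C_nonneg Q by (intro mult_left_mono) auto
    then show ?thesis by (intro mult_right_mono) auto
  qed
  finally have 2: "\<bar>Bt w (V h t) v - Bt w U v\<bar> \<le> 2 * C * (Q + 1) * H1_norm \<Omega> (U - V h t) * H1_norm \<Omega> v" .
  have "\<bar>Bt (u t) (V h t) v - Bt w U v\<bar> \<le> 2 * C * (Q + 1) * L2_norm \<Omega> (u t - w) * H1_norm \<Omega> v
      + 2 * C * (Q + 1) * H1_norm \<Omega> (U - V h t) * H1_norm \<Omega> v"
    using 1 2 by linarith
  then show ?thesis by (simp add: algebra_simps)
qed

text \<open>The error equation is solved with the elliptic form frozen at \<open>t\<^sub>m\<close> and tested with \<open>\<theta>\<^sub>m\<close> itself; the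
  contributions of the initial error and of the four kinds of sources are estimated one by one, each being a multiple of
  the energy norm of \<open>\<theta>\<^sub>m\<close>.\<close>

theorem stability:
  assumes h: "h \<in> {0<..1}" and step: "two_grid_step \<Omega> T a a0 \<alpha> \<beta> \<gamma> g f \<omega> N (S h) U0 W U"
    and W: "\<And>i. 1 \<le> i \<Longrightarrow> i \<le> N \<Longrightarrow> sqint \<Omega> (W i)" and m: "1 \<le> m" "m \<le> N"
  defines "k \<equiv> T / real N" and "t \<equiv> tgrid T N"
  shows "H1_norm \<Omega> (U m - V h (t m)) \<le> cS * (H1_norm \<Omega> (U 0 - V h 0) + (k + h powr r)
    + k * (\<Sum>i=1..m. L2_norm \<Omega> (u (t i) - W i) + H1_norm \<Omega> (U i - V h (t i))))"
proof -
  have N: "0 < N" using m by simp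
  have k: "0 < k" "real N * k = T" using T_pos N by (auto simp: k_def)
  have tg: "t j = real j * k" for j by (simp add: t_def tgrid_def k_def)
  have tT: "t j \<in> {0..T}" if "j \<le> N" for j
  proof -
    have "real j * k \<le> real N * k" using that k by (intro mult_right_mono) auto
    then show ?thesis using k by (simp add: tg)
  qed
  have tm: "t m \<in> {0..T}" using tT m by blast
  define \<nu> where "\<nu> = sqrt \<nu>0"
  have \<nu>: "0 < \<nu>" "\<nu>\<^sup>2 = \<nu>0" using nu by (auto simp: \<nu>_def)
  have sub: "subspace (S h)" by (rule S_subspace[OF h])
  have SL2: "semi_inner (S h) (L2_inner \<Omega>)"
    using semi_inner_subset[OF semi_inner_L2_H1 sub] S_H1[OF h] by blast
  have SA: "semi_inner (S h) (A (t m))" by (rule semi_inner_A[OF sub S_space(2)[OF h] tm])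
  obtain B where B: "finite B" "S h = span B" using finite_dim_space_span[OF S_space(1)[OF h]] by blast
  obtain R where R: "resolvent (S h) (L2_inner \<Omega>) (A (t m)) k R"
    using resolvent_exists[OF SL2 SA B(2,1) k(1)] by blast
  interpret R: resolvent "S h" "L2_inner \<Omega>" "A (t m)" k R by (rule R)
  have pn: "R.p.nrm x = L2_norm \<Omega> x" for x by (simp add: R.p.nrm_def L2_norm_def)
  have H1n: "H1_norm \<Omega> x \<le> R.a.nrm x / \<nu>" if "x \<in> S h" for x
  proof -
    have "(\<nu> * H1_norm \<Omega> x)\<^sup>2 \<le> A (t m) x x"
      using coercive[OF tm, of x] S_space(2)[OF h] that by (auto simp: power_mult_distrib \<nu>)
    then have "\<nu> * H1_norm \<Omega> x \<le> R.a.nrm x" unfolding R.a.nrm_def by (rule real_le_rsqrt)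
    then show ?thesis using \<nu> by (simp add: pos_le_divide_eq mult.commute)
  qed
  \<comment> \<open>The value beyond the last step is irrelevant; 0 keeps the whole sequence in the space.\<close>
  define \<theta> where "\<theta> j = (if j \<le> N then U j - V h (t j) else 0)" for j
  have \<theta>S: "\<theta> j \<in> S h" for j
    using scheme_mem[OF step] V_mem[OF h tT] R.a.mem_intros by (auto simp: \<theta>_def)
  have \<theta>H: "\<theta> j \<in> H1" for j using \<theta>S S_H1[OF h] by blast
  define w where "w = \<theta> m"
  have w: "w \<in> S h" using \<theta>S w_def by simp
  define nw where "nw = R.a.nrm w"
  have nw0: "0 \<le> nw" using w by (simp add: nw_def)
  define y where "y j = R.D (m - j) w" for j
  have yS: "y j \<in> S h" for j using w by (simp add: y_def)
  have yH: "y j \<in> H1" for j using yS S_H1[OF h] by blast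
  define \<tau> where "\<tau> j = ut (t j) - (1 / k) *\<^sub>R (V h (t j) - V h (t (j - 1)))" for j
  define F where "F i v = Bt (u (t i)) (V h (t i)) v - Bt (W i) (U i) v" for i v
  define e where "e i = L2_norm \<Omega> (u (t i) - W i) + H1_norm \<Omega> (U i - V h (t i))" for i
  have e0: "0 \<le> e i" for i by (simp add: e_def)
  \<comment> \<open>The last term accounts for replacing the elliptic form at \<open>t\<^sub>j\<close> by that at \<open>t\<^sub>m\<close>.\<close>
  define G where "G j v = L2_inner \<Omega> (\<tau> j) v - quad_error T K \<omega> N j (\<lambda>s. Bt (u s) (V h s) v)
      + k * (\<Sum>i=1..j. \<omega> N j i * F i v) + (A (t m) (\<theta> j) v - A (t j) (\<theta> j) v)" for j v
  have duh: "A (t m) w w = A (t m) (\<theta> 0) ((R ^^ m) w) + (\<Sum>j=1..m. G j (y j))"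
    unfolding w_def y_def
  proof (rule R.duhamel[OF \<theta>S \<theta>S])
    fix j v assume j: "1 \<le> j" "j \<le> m" and v: "v \<in> S h"
    then have jN: "j \<le> N" "j - 1 \<le> N" using m by auto
    have th: "\<theta> j = U j - V h (t j)" "\<theta> (j - 1) = U (j - 1) - V h (t (j - 1))" using jN by (auto simp: \<theta>_def)
    have "L2_inner \<Omega> (\<theta> j - \<theta> (j - 1)) v + k * A (t j) (\<theta> j) v
      = k * (L2_inner \<Omega> (\<tau> j) v - quad_error T K \<omega> N j (\<lambda>s. Bt (u s) (V h s) v) + k * (\<Sum>i=1..j. \<omega> N j i * F i v))"
      using error_equation[OF h N step j(1) jN(1) v] unfolding th \<tau>_def F_def k_def t_def .
    then show "L2_inner \<Omega> (\<theta> j - \<theta> (j - 1)) v + k * A (t m) (\<theta> j) v = k * G j v"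
      unfolding G_def distrib_left right_diff_distrib by linarith
  qed
  have comb: "R.a.nrm (\<Sum>j=1..m. c j *\<^sub>R y j) \<le> b * nw" if "0 \<le> b" "\<And>j. j \<in> {1..m} \<Longrightarrow> \<bar>c j\<bar> \<le> b" for c b
  proof -
    have "(\<Sum>j=1..m. c j *\<^sub>R y j) = (\<Sum>j=1..m. (\<lambda>l. c (m - l) *\<^sub>R R.D l w) (m - j))"
      by (intro sum.cong) (auto simp: y_def)
    also have "\<dots> = (\<Sum>l<m. c (m - l) *\<^sub>R R.D l w)" by (rule sum_reverse)
    finally show ?thesis unfolding nw_def using R.nrm_sum_D[OF w, of m "\<lambda>l. c (m - l)" b] that by auto
  qed
  have T0: "\<bar>A (t m) (\<theta> 0) ((R ^^ m) w)\<bar> \<le> sqrt (2 * CA) * H1_norm \<Omega> (\<theta> 0) * nw"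
  proof -
    have "A (t m) (\<theta> 0) (\<theta> 0) \<le> 2 * CA * (H1_norm \<Omega> (\<theta> 0))\<^sup>2"
      using A_bound[OF tm \<theta>H \<theta>H, of 0 0] by (simp add: power2_eq_square mult.assoc)
    then have "R.a.nrm (\<theta> 0) \<le> sqrt (2 * CA * (H1_norm \<Omega> (\<theta> 0))\<^sup>2)"
      unfolding R.a.nrm_def by (rule real_sqrt_le_mono)
    then have n0: "R.a.nrm (\<theta> 0) \<le> sqrt (2 * CA) * H1_norm \<Omega> (\<theta> 0)" by (simp add: real_sqrt_mult)
    have "\<bar>A (t m) (\<theta> 0) ((R ^^ m) w)\<bar> \<le> R.a.nrm (\<theta> 0) * R.a.nrm ((R ^^ m) w)"
      using w by (intro R.a.cauchy_schwarz \<theta>S R.pow_mem)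
    also have "\<dots> \<le> (sqrt (2 * CA) * H1_norm \<Omega> (\<theta> 0)) * nw"
      unfolding nw_def using n0 R.nrm_pow[OF w, of m] w R.a.nrm_nonneg[OF \<theta>S[of 0]] CA
      by (intro mult_mono) auto
    finally show ?thesis .
  qed
  have T1: "\<bar>\<Sum>j=1..m. L2_inner \<Omega> (\<tau> j) (y j)\<bar> \<le> sqrt T * Q * (k + h powr r) * nw"
  proof -
    have \<tau>b: "sqint \<Omega> (\<tau> j)" "L2_norm \<Omega> (\<tau> j) \<le> Q * (k + h powr r)" if j: "j \<in> {1..m}" for j
    proof -
      have d: "t j - t (j - 1) = k" using j by (simp add: tg of_nat_diff algebra_simps)
      have "0 \<le> t (j - 1)" "t (j - 1) < t j" "t j \<le> T" using d k tT[of "j - 1"] tT[of j] j m by auto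
      from truncation_bound[OF h this] show "sqint \<Omega> (\<tau> j)" "L2_norm \<Omega> (\<tau> j) \<le> Q * (k + h powr r)"
        unfolding d \<tau>_def .
    qed
    \<comment> \<open>Cauchy-Schwarz in time turns the square summability of \<open>D\<^sub>l w\<close> into summability.\<close>
    have "(\<Sum>l<m. L2_norm \<Omega> (R.D l w)) \<le> sqrt T * nw"
    proof -
      have "(\<Sum>l<m. \<bar>1\<bar> * \<bar>L2_norm \<Omega> (R.D l w)\<bar>) \<le> L2_set (\<lambda>l. 1) {..<m} * L2_set (\<lambda>l. L2_norm \<Omega> (R.D l w)) {..<m}"
        by (rule L2_set_mult_ineq)
      also have "L2_set (\<lambda>l. 1) {..<m} = sqrt (real m)" by (simp add: L2_set_def)
      also have "L2_set (\<lambda>l. L2_norm \<Omega> (R.D l w)) {..<m} \<le> sqrt (k * A (t m) w w)"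
        unfolding L2_set_def using R.sum_p_D[OF w, of m] by (intro real_sqrt_le_mono) (simp add: L2_norm_sq)
      also have "sqrt (k * A (t m) w w) = sqrt k * nw" by (simp add: real_sqrt_mult nw_def R.a.nrm_def)
      finally have "(\<Sum>l<m. L2_norm \<Omega> (R.D l w)) \<le> sqrt (real m) * (sqrt k * nw)" by (simp add: mult_left_mono)
      also have "\<dots> = sqrt (real m * k) * nw" by (simp add: real_sqrt_mult)
      also have "\<dots> \<le> sqrt T * nw"
        using tT[of m] m nw0 by (intro mult_right_mono real_sqrt_le_mono) (auto simp: tg)
      finally show ?thesis .
    qed
    moreover have "(\<Sum>j=1..m. L2_norm \<Omega> (y j)) = (\<Sum>l<m. L2_norm \<Omega> (R.D l w))"
      unfolding y_def by (rule sum_reverse)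
    ultimately have Ysum: "(\<Sum>j=1..m. L2_norm \<Omega> (y j)) \<le> sqrt T * nw" by simp
    have "\<bar>\<Sum>j=1..m. L2_inner \<Omega> (\<tau> j) (y j)\<bar> \<le> (\<Sum>j=1..m. Q * (k + h powr r) * L2_norm \<Omega> (y j))"
    proof (rule order_trans[OF sum_abs sum_mono])
      fix j assume j: "j \<in> {1..m}"
      have "\<bar>L2_inner \<Omega> (\<tau> j) (y j)\<bar> \<le> L2_norm \<Omega> (\<tau> j) * L2_norm \<Omega> (y j)"
        by (rule L2_cauchy_schwarz[OF \<tau>b(1)[OF j] H1_sqint[OF yH]])
      also have "\<dots> \<le> Q * (k + h powr r) * L2_norm \<Omega> (y j)" using \<tau>b(2)[OF j] by (rule mult_right_mono) simp
      finally show "\<bar>L2_inner \<Omega> (\<tau> j) (y j)\<bar> \<le> Q * (k + h powr r) * L2_norm \<Omega> (y j)" .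
    qed
    also have "\<dots> = Q * (k + h powr r) * (\<Sum>j=1..m. L2_norm \<Omega> (y j))" by (simp add: sum_distrib_left)
    also have "\<dots> \<le> Q * (k + h powr r) * (sqrt T * nw)" using Ysum Q k by (intro mult_left_mono) auto
    finally show ?thesis by (simp add: mult_ac)
  qed
  have T2: "\<bar>\<Sum>j=1..m. quad_error T K \<omega> N j (\<lambda>s. Bt (u s) (V h s) (y j))\<bar> \<le> cq * k * nw"
    unfolding cq_def k_def \<nu>_def[symmetric]
  proof (rule quadrature_superposition[OF R.a.semi_inner_axioms m yS])
    fix s x z and c :: real assume s: "s \<in> {0..T}" and x: "x \<in> S h" and z: "z \<in> S h"
    show "Bt (u s) (V h s) (x + c *\<^sub>R z) = Bt (u s) (V h s) x + c * Bt (u s) (V h s) z"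
      by (rule Bt_lin[OF u_sqint[OF s] V_H1[OF h s] S_H1[OF h x] S_H1[OF h z]])
  next
    fix s x assume s: "s \<in> {0..T}" and x: "x \<in> S h"
    have "M\<Phi> * H1_norm \<Omega> x \<le> M\<Phi> * (R.a.nrm x / \<nu>)" using H1n[OF x] M\<Phi>_nonneg by (rule mult_left_mono)
    then show "\<bar>Bt (u s) (V h s) x\<bar> \<le> M\<Phi> / \<nu> * R.a.nrm x" using \<Phi>_bound[OF h s S_H1[OF h x]] by simp
    fix s' assume s': "s' \<in> {0..T}"
    have "L\<Phi> * \<bar>s - s'\<bar> * H1_norm \<Omega> x \<le> L\<Phi> * \<bar>s - s'\<bar> * (R.a.nrm x / \<nu>)"
      using H1n[OF x] L\<Phi>_nonneg by (intro mult_left_mono) auto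
    then show "\<bar>Bt (u s) (V h s) x - Bt (u s') (V h s') x\<bar> \<le> L\<Phi> / \<nu> * \<bar>s - s'\<bar> * R.a.nrm x"
      using \<Phi>_lipschitz[OF h s s' S_H1[OF h x]] by simp
  next
    show "R.a.nrm (\<Sum>j=1..m. c j *\<^sub>R y j) \<le> b * nw" if "0 \<le> b" "\<And>j. j \<in> {1..m} \<Longrightarrow> \<bar>c j\<bar> \<le> b" for c b
      using that by (rule comb)
  qed (use M\<Phi>_nonneg L\<Phi>_nonneg \<nu> nw0 in auto)
  have T3: "\<bar>\<Sum>j=1..m. k * (\<Sum>i=1..j. \<omega> N j i * F i (y j))\<bar> \<le> 2 * C * (Q + 1) * K1 / \<nu> * (k * (\<Sum>i=1..m. e i)) * nw"
  proof -
    \<comment> \<open>After interchanging the sums, each fixed functional \<open>F\<^sub>i\<close> is tested with one combination of the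
      \<open>y\<^sub>j\<close> whose coefficients are weights; smoothness of the weights in \<open>j\<close> plays no role.\<close>
    define c where "c i j = (if i \<le> j then \<omega> N j i else 0)" for i j
    have Fsum: "(\<Sum>j\<in>J. d j * F i (y j)) = F i (\<Sum>j\<in>J. d j *\<^sub>R y j)" if i: "i \<in> {1..m}" and J: "finite J" for i d J
      using J
    proof (induction J rule: finite_induct)
      case empty
      have z: "Bt w' U' 0 = 0" if "sqint \<Omega> w'" "U' \<in> H1" for w' U'
        using Bt_lin[OF that H1.mem_intros(4) H1.mem_intros(4), of 1] by simp
      have iN: "1 \<le> i" "i \<le> N" using i m by auto
      have "F i 0 = 0"
        unfolding F_def z[OF u_sqint[OF tT[OF iN(2)]] V_H1[OF h tT[OF iN(2)]]]
          z[OF W[OF iN] S_H1[OF h scheme_mem[OF step iN(2)]]] by simp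
      then show ?case by (simp only: sum.empty)
    next
      case (insert j J)
      have s: "(\<Sum>j\<in>J. d j *\<^sub>R y j) \<in> H1" using yH by (intro H1.mem_intros) auto
      have "F i ((\<Sum>j\<in>J. d j *\<^sub>R y j) + d j *\<^sub>R y j) = F i (\<Sum>j\<in>J. d j *\<^sub>R y j) + d j * F i (y j)"
        using i m Bt_lin[OF u_sqint[OF tT] V_H1[OF h tT] s yH, of i i "d j" j]
          Bt_lin[OF W S_H1[OF h scheme_mem[OF step]] s yH, of i i "d j" j]
        by (simp add: F_def algebra_simps)
      then show ?case
        unfolding sum.insert[OF insert(1,2)] insert(3) by (simp only: add.commute)
    qed
    have Fb: "\<bar>F i (\<Sum>j=1..m. c i j *\<^sub>R y j)\<bar> \<le> 2 * C * (Q + 1) * e i * (K1 * nw / \<nu>)" if i: "i \<in> {1..m}" for i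
    proof -
      have iN: "1 \<le> i" "i \<le> N" using i m by auto
      have YS: "(\<Sum>j=1..m. c i j *\<^sub>R y j) \<in> S h" using yS by (intro R.a.mem_intros) auto
      have "\<bar>F i (\<Sum>j=1..m. c i j *\<^sub>R y j)\<bar> \<le> 2 * C * (Q + 1) * e i * H1_norm \<Omega> (\<Sum>j=1..m. c i j *\<^sub>R y j)"
        unfolding F_def e_def
        by (rule F_bound[OF h tT[OF iN(2)] W[OF iN] S_H1[OF h scheme_mem[OF step iN(2)]] S_H1[OF h YS]])
      also have "H1_norm \<Omega> (\<Sum>j=1..m. c i j *\<^sub>R y j) \<le> K1 * nw / \<nu>"
      proof -
        have "R.a.nrm (\<Sum>j=1..m. c i j *\<^sub>R y j) \<le> K1 * nw"
          using i m K1 weight_bound by (intro comb) (auto simp: c_def)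
        then show ?thesis using H1n[OF YS] \<nu> by (meson divide_right_mono less_imp_le order_trans)
      qed
      finally show ?thesis using C_nonneg Q e0 by (simp add: mult_left_mono)
    qed
    have "(\<Sum>j=1..m. k * (\<Sum>i=1..j. \<omega> N j i * F i (y j))) = k * (\<Sum>j=1..m. \<Sum>i=1..m. c i j * F i (y j))"
      unfolding sum_distrib_left[symmetric]
      by (intro arg_cong2[where f = "(*)"] refl sum.cong sum.mono_neutral_cong_left) (auto simp: c_def)
    also have "(\<Sum>j=1..m. \<Sum>i=1..m. c i j * F i (y j)) = (\<Sum>i=1..m. \<Sum>j=1..m. c i j * F i (y j))" by (rule sum.swap)
    also have "\<dots> = (\<Sum>i=1..m. F i (\<Sum>j=1..m. c i j *\<^sub>R y j))" using Fsum by (intro sum.cong) auto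
    finally have eq: "(\<Sum>j=1..m. k * (\<Sum>i=1..j. \<omega> N j i * F i (y j))) = k * (\<Sum>i=1..m. F i (\<Sum>j=1..m. c i j *\<^sub>R y j))" .
    have "\<bar>\<Sum>i=1..m. F i (\<Sum>j=1..m. c i j *\<^sub>R y j)\<bar> \<le> (\<Sum>i=1..m. 2 * C * (Q + 1) * e i * (K1 * nw / \<nu>))"
      by (rule order_trans[OF sum_abs sum_mono]) (rule Fb)
    also have "\<dots> = 2 * C * (Q + 1) * K1 / \<nu> * (\<Sum>i=1..m. e i) * nw"
      by (simp add: sum_distrib_left sum_distrib_right sum_divide_distrib mult_ac)
    finally have "k * \<bar>\<Sum>i=1..m. F i (\<Sum>j=1..m. c i j *\<^sub>R y j)\<bar> \<le> k * (2 * C * (Q + 1) * K1 / \<nu> * (\<Sum>i=1..m. e i) * nw)"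
      using k by (intro mult_left_mono) auto
    then show ?thesis unfolding eq using k by (simp add: abs_mult mult_ac)
  qed
  have T4: "\<bar>\<Sum>j=1..m. A (t m) (\<theta> j) (y j) - A (t j) (\<theta> j) (y j)\<bar> \<le> 2 * CA / \<nu> * (k * (\<Sum>i=1..m. e i)) * nw"
  proof -
    have "\<bar>\<Sum>j=1..m. A (t m) (\<theta> j) (y j) - A (t j) (\<theta> j) (y j)\<bar> \<le> (\<Sum>j=1..m. 2 * CA / \<nu> * (k * e j) * nw)"
    proof (rule order_trans[OF sum_abs sum_mono])
      fix j assume j: "j \<in> {1..m}"
      then have tj: "t j \<in> {0..T}" using tT m by auto
      \<comment> \<open>The factor \<open>m - j\<close> from the Lipschitz bound in time is compensated by the decay of
        \<open>D\<^bsub>m - j\<^esub> w\<close>.\<close>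
      have d: "\<bar>t m - t j\<bar> = real (m - j) * k" using j k by (simp add: tg of_nat_diff algebra_simps abs_mult flip: left_diff_distrib)
      have "\<bar>A (t m) (\<theta> j) (y j) - A (t j) (\<theta> j) (y j)\<bar> \<le> 2 * (CA * \<bar>t m - t j\<bar>) * H1_norm \<Omega> (\<theta> j) * H1_norm \<Omega> (y j)"
        by (rule A_lipschitz[OF tj tm \<theta>H yH])
      also have "\<dots> = 2 * CA * k * H1_norm \<Omega> (\<theta> j) * (real (m - j) * H1_norm \<Omega> (y j))" unfolding d by (simp add: mult_ac)
      also have "\<dots> \<le> 2 * CA * k * e j * (nw / \<nu>)"
      proof (rule mult_mono)
        have "H1_norm \<Omega> (\<theta> j) \<le> e j" using j m by (simp add: \<theta>_def e_def)
        then show "2 * CA * k * H1_norm \<Omega> (\<theta> j) \<le> 2 * CA * k * e j" using CA k by (intro mult_left_mono) auto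
        have "real (m - j) * H1_norm \<Omega> (y j) \<le> real (m - j) * (nw / (real (m - j) + 1) / \<nu>)"
        proof (rule mult_left_mono)
          have "H1_norm \<Omega> (y j) \<le> R.a.nrm (y j) / \<nu>" by (rule H1n[OF yS])
          also have "\<dots> \<le> nw / (real (m - j) + 1) / \<nu>"
            unfolding y_def nw_def using R.nrm_D[OF w, of "m - j"] \<nu> by (intro divide_right_mono) auto
          finally show "H1_norm \<Omega> (y j) \<le> nw / (real (m - j) + 1) / \<nu>" .
        qed simp
        also have "\<dots> = (real (m - j) / (real (m - j) + 1)) * (nw / \<nu>)" by simp
        also have "\<dots> \<le> 1 * (nw / \<nu>)" using nw0 \<nu> by (intro mult_right_mono) auto
        finally show "real (m - j) * H1_norm \<Omega> (y j) \<le> nw / \<nu>" by simp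
      qed (use CA k e0 in auto)
      finally show "\<bar>A (t m) (\<theta> j) (y j) - A (t j) (\<theta> j) (y j)\<bar> \<le> 2 * CA / \<nu> * (k * e j) * nw" by (simp add: mult_ac)
    qed
    also have "\<dots> = 2 * CA / \<nu> * (k * (\<Sum>i=1..m. e i)) * nw" by (simp add: sum_distrib_left sum_distrib_right mult_ac)
    finally show ?thesis .
  qed
  define Z where "Z = sqrt (2 * CA) * H1_norm \<Omega> (\<theta> 0) + sqrt T * Q * (k + h powr r) + cq * k + cF * (k * (\<Sum>i=1..m. e i))"
  have E0: "0 \<le> k * (\<Sum>i=1..m. e i)" using k e0 by (simp add: sum_nonneg)
  have "(\<Sum>j=1..m. G j (y j)) = (\<Sum>j=1..m. L2_inner \<Omega> (\<tau> j) (y j))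
      - (\<Sum>j=1..m. quad_error T K \<omega> N j (\<lambda>s. Bt (u s) (V h s) (y j)))
      + (\<Sum>j=1..m. k * (\<Sum>i=1..j. \<omega> N j i * F i (y j))) + (\<Sum>j=1..m. A (t m) (\<theta> j) (y j) - A (t j) (\<theta> j) (y j))"
    by (simp add: G_def sum.distrib sum_subtractf)
  then have "A (t m) w w \<le> sqrt (2 * CA) * H1_norm \<Omega> (\<theta> 0) * nw + sqrt T * Q * (k + h powr r) * nw + cq * k * nw
      + 2 * C * (Q + 1) * K1 / \<nu> * (k * (\<Sum>i=1..m. e i)) * nw + 2 * CA / \<nu> * (k * (\<Sum>i=1..m. e i)) * nw"
    using duh T0 T1 T2 T3 T4 by linarith
  also have "\<dots> = Z * nw" by (simp add: Z_def cF_def \<nu>_def add_divide_distrib distrib_right)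
  finally have ZZ: "A (t m) w w \<le> Z * R.a.nrm w" by (simp add: nw_def)
  have Z0: "0 \<le> Z" unfolding Z_def using CA T_pos Q k const_nonneg E0 by simp
  have "R.a.nrm w \<le> Z" by (rule R.nrm_le_of_bound[OF w Z0 ZZ])
  then have "H1_norm \<Omega> w \<le> Z / \<nu>" using H1n[OF w] \<nu> by (meson divide_right_mono less_imp_le order_trans)
  also have "Z \<le> (sqrt (2 * CA) + sqrt T * Q + cq + cF) * (H1_norm \<Omega> (\<theta> 0) + (k + h powr r) + k * (\<Sum>i=1..m. e i))"
  proof -
    define p where "p = H1_norm \<Omega> (\<theta> 0) + (k + h powr r) + k * (\<Sum>i=1..m. e i)"
    have hp: "0 \<le> h powr r" by simp
    have p: "H1_norm \<Omega> (\<theta> 0) \<le> p" "k + h powr r \<le> p" "k \<le> p" "k * (\<Sum>i=1..m. e i) \<le> p"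
      unfolding p_def using k E0 hp H1_norm_nonneg[of "\<theta> 0"] by linarith+
    have "sqrt (2 * CA) * H1_norm \<Omega> (\<theta> 0) \<le> sqrt (2 * CA) * p" "sqrt T * Q * (k + h powr r) \<le> sqrt T * Q * p"
      "cq * k \<le> cq * p" "cF * (k * (\<Sum>i=1..m. e i)) \<le> cF * p"
      using p CA T_pos Q const_nonneg by (auto intro!: mult_left_mono)
    then have "Z \<le> sqrt (2 * CA) * p + sqrt T * Q * p + cq * p + cF * p" unfolding Z_def by linarith
    then show ?thesis unfolding p_def[symmetric] by (simp only: distrib_right)
  qed
  finally have "H1_norm \<Omega> w \<le> (sqrt (2 * CA) + sqrt T * Q + cq + cF)
      * (H1_norm \<Omega> (\<theta> 0) + (k + h powr r) + k * (\<Sum>i=1..m. e i)) / \<nu>"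
    using \<nu> by (simp add: divide_right_mono)
  then have "H1_norm \<Omega> w \<le> cS * (H1_norm \<Omega> (\<theta> 0) + (k + h powr r) + k * (\<Sum>i=1..m. e i))"
    by (simp add: cS_def \<nu>_def)
  moreover have "\<theta> 0 = U 0 - V h 0" "w = U m - V h (t m)" using m by (auto simp: \<theta>_def w_def tg)
  ultimately show ?thesis by (simp add: e_def)
qed

text \<open>Gronwall's lemma for a frozen argument \<open>W\<close> that is accurate up to \<open>q\<close> and the error of the scheme itself.  Both
  steps of the two-grid algorithm are of this kind.\<close>

lemma scheme_bound:
  assumes h: "h \<in> {0<..1}" and step: "two_grid_step \<Omega> T a a0 \<alpha> \<beta> \<gamma> g f \<omega> N (S h) U0 W U"
    and W: "\<And>i. 1 \<le> i \<Longrightarrow> i \<le> N \<Longrightarrow> sqint \<Omega> (W i)"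
    and Wb: "\<And>i. 1 \<le> i \<Longrightarrow> i \<le> N \<Longrightarrow>
      L2_norm \<Omega> (u (tgrid T N i) - W i) \<le> q + H1_norm \<Omega> (U i - V h (tgrid T N i))"
    and X0: "H1_norm \<Omega> (U 0 - V h 0) \<le> X0" and q: "0 \<le> q" and small: "2 * cS * (T / real N) \<le> 1 / 2"
    and m: "1 \<le> m" "m \<le> N"
  shows "H1_norm \<Omega> (U m - V h (tgrid T N m)) \<le> 2 * (cS * (X0 + (T / real N + h powr r) + T * q)) * exp (4 * cS * T)"
proof -
  define k where "k = T / real N"
  have N: "0 < N" using m by simp
  have k: "0 < k" "real N * k = T" using T_pos N by (auto simp: k_def)
  define x where "x i = H1_norm \<Omega> (U i - V h (tgrid T N i))" for i
  define b where "b = cS * (X0 + (k + h powr r) + T * q)"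
  have X00: "0 \<le> X0" using X0 H1_norm_nonneg order_trans by blast
  have b0: "0 \<le> b" unfolding b_def using const_nonneg(3) X00 k T_pos q by simp
  have c0: "0 \<le> 2 * cS * k" using const_nonneg(3) k by simp
  have "x m \<le> 2 * b * exp (2 * (2 * cS * k) * real N)"
  proof (rule discrete_gronwall[OF b0 c0 _ _ _ m])
    show "2 * cS * k \<le> 1 / 2" using small by (simp only: k_def)
    show "0 \<le> x i" for i by (simp add: x_def)
    fix n assume n: "1 \<le> n" "n \<le> N"
    have "(\<Sum>i=1..n. L2_norm \<Omega> (u (tgrid T N i) - W i) + x i) \<le> (\<Sum>i=1..n. q + 2 * x i)"
    proof (rule sum_mono)
      fix i assume "i \<in> {1..n}"
      then have "1 \<le> i" "i \<le> N" using n by auto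
      from Wb[OF this] show "L2_norm \<Omega> (u (tgrid T N i) - W i) + x i \<le> q + 2 * x i" by (simp add: x_def)
    qed
    also have "\<dots> = real n * q + 2 * (\<Sum>i=1..n. x i)" by (simp add: sum.distrib sum_distrib_left)
    finally have "k * (\<Sum>i=1..n. L2_norm \<Omega> (u (tgrid T N i) - W i) + x i) \<le> k * (real n * q + 2 * (\<Sum>i=1..n. x i))"
      using k by (intro mult_left_mono) auto
    also have "\<dots> = (real n * k) * q + 2 * k * (\<Sum>i=1..n. x i)" by (simp add: algebra_simps)
    also have "\<dots> \<le> T * q + 2 * k * (\<Sum>i=1..n. x i)"
    proof -
      have "real n * k \<le> real N * k" using n k by (intro mult_right_mono) auto
      then show ?thesis using k q by (intro add_right_mono mult_right_mono) auto
    qed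
    finally have s: "k * (\<Sum>i=1..n. L2_norm \<Omega> (u (tgrid T N i) - W i) + x i) \<le> T * q + 2 * k * (\<Sum>i=1..n. x i)" .
    have "x n \<le> cS * (H1_norm \<Omega> (U 0 - V h 0) + (k + h powr r)
        + k * (\<Sum>i=1..n. L2_norm \<Omega> (u (tgrid T N i) - W i) + x i))"
      unfolding x_def k_def by (rule stability[OF h step W n])
    also have "\<dots> \<le> cS * (X0 + (k + h powr r) + (T * q + 2 * k * (\<Sum>i=1..n. x i)))"
      using s X0 const_nonneg(3) by (intro mult_left_mono add_mono) auto
    also have "\<dots> = b + 2 * cS * k * (\<Sum>i=1..n. x i)" by (simp add: b_def algebra_simps)
    finally show "x n \<le> b + 2 * cS * k * (\<Sum>i=1..n. x i)" .
  qed
  also have "2 * (2 * cS * k) * real N = 4 * cS * T" using k(2) by (simp add: algebra_simps)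
  finally show ?thesis unfolding x_def b_def k_def .
qed

theorem two_grid_convergence:
  "\<forall>C0. \<exists>C>0. \<exists>\<delta>0>0. \<forall>N h H u0h u0H UH Uh n.
     0 < N \<and> T / real N \<le> \<delta>0 \<and> 0 < h \<and> h < H \<and> H \<le> 1 \<and>
     H1_norm \<Omega> (u0h - V h 0) \<le> C0 * h powr r \<and>
     H1_norm \<Omega> (u0H - V H 0) \<le> C0 * H powr r \<and>
     two_grid_step \<Omega> T a a0 \<alpha> \<beta> \<gamma> g f \<omega> N (S H) u0H UH UH \<and>
     two_grid_step \<Omega> T a a0 \<alpha> \<beta> \<gamma> g f \<omega> N (S h) u0h UH Uh \<and>
     1 \<le> n \<and> n \<le> N \<longrightarrow>
     H1_norm \<Omega> (Uh n - u (tgrid T N n)) \<le> C * (H powr r + h powr (r - 1) + T / real N)"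
proof
  fix C0 :: real
  define c0 where "c0 = \<bar>C0\<bar>"
  define E where "E = exp (4 * cS * T)"
  define Cc where "Cc = 2 * (cS * (c0 + 1 + T * Q)) * E"
  define Cf where "Cf = 2 * (cS * (c0 + 1 + T * (Cc + Q))) * E"
  have n0: "0 \<le> c0" "0 \<le> E" "0 \<le> cS" using const_nonneg by (auto simp: c0_def E_def)
  have Cc: "0 \<le> Cc" using n0 T_pos Q by (simp add: Cc_def)
  have Cf: "0 \<le> Cf" using n0 T_pos Q Cc by (simp add: Cf_def)
  have main: "H1_norm \<Omega> (Uh n - u (tgrid T N n)) \<le> (Cf + Q + 1) * (H powr r + h powr (r - 1) + T / real N)"
    if N: "0 < N" and small: "T / real N \<le> 1 / (4 * (cS + 1))" and hH: "0 < h" "h < H" "H \<le> 1"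
      and i0: "H1_norm \<Omega> (u0h - V h 0) \<le> C0 * h powr r" "H1_norm \<Omega> (u0H - V H 0) \<le> C0 * H powr r"
      and sH: "two_grid_step \<Omega> T a a0 \<alpha> \<beta> \<gamma> g f \<omega> N (S H) u0H UH UH"
      and sh: "two_grid_step \<Omega> T a a0 \<alpha> \<beta> \<gamma> g f \<omega> N (S h) u0h UH Uh"
      and n: "1 \<le> n" "n \<le> N" for N n h H u0h u0H UH Uh
  proof -
    define k where "k = T / real N"
    have k: "0 < k" using T_pos N by (simp add: k_def)
    have h: "h \<in> {0<..1}" and H: "H \<in> {0<..1}" using hH by auto
    have tT: "tgrid T N i \<in> {0..T}" if "1 \<le> i" "i \<le> N" for i using tgrid_bounds[OF that] by auto
    \<comment> \<open>The smallness of the step size serves to absorb the last term of the sum in Gronwall's lemma.\<close>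
    have sm: "2 * cS * (T / real N) \<le> 1 / 2"
    proof -
      have "2 * cS * (T / real N) \<le> 2 * cS * (1 / (4 * (cS + 1)))" using small n0 by (intro mult_left_mono) auto
      also have "\<dots> \<le> 1 / 2" using n0 by (simp add: divide_le_eq)
      finally show ?thesis .
    qed
    have UHm: "UH i \<in> H1" if "i \<le> N" for i using scheme_mem[OF sH that] S_H1[OF H] by blast
    have Uhm: "Uh i \<in> H1" if "i \<le> N" for i using scheme_mem[OF sh that] S_H1[OF h] by blast
    have init: "UH 0 = u0H" "Uh 0 = u0h" using sH sh by (auto simp: two_grid_step_def)
    have c0le: "C0 * z \<le> c0 * z" if "0 \<le> z" for z using that by (auto simp: c0_def intro: mult_right_mono)
    have L2tri: "L2_norm \<Omega> (u (tgrid T N i) - UH i) \<le> Q * H powr r + H1_norm \<Omega> (UH i - V H (tgrid T N i))"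
      if i: "1 \<le> i" "i \<le> N" for i
    proof -
      have m: "u (tgrid T N i) - V H (tgrid T N i) \<in> H1" "UH i - V H (tgrid T N i) \<in> H1"
        using u_H1[OF tT[OF i]] V_H1[OF H tT[OF i]] UHm[OF i(2)] H1_diff by auto
      have "u (tgrid T N i) - UH i = (u (tgrid T N i) - V H (tgrid T N i)) - (UH i - V H (tgrid T N i))" by simp
      then have "L2_norm \<Omega> (u (tgrid T N i) - UH i)
          \<le> L2_norm \<Omega> (u (tgrid T N i) - V H (tgrid T N i)) + L2_norm \<Omega> (UH i - V H (tgrid T N i))"
        using L2.nrm_triangle_minus[of "u (tgrid T N i) - V H (tgrid T N i)" \<Omega> "UH i - V H (tgrid T N i)"] m H1_sqint
        by (simp add: L2_nrm)
      then show ?thesis using rho_parts(1)[OF H tT[OF i]] L2_le_H1[of "UH i - V H (tgrid T N i)"] by linarith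
    qed
    \<comment> \<open>On the coarse grid the frozen argument is the unknown, so \<open>q\<close> is the bound of the projection error.\<close>
    have coarse: "H1_norm \<Omega> (UH i - V H (tgrid T N i)) \<le> Cc * (H powr r + k)" if i: "1 \<le> i" "i \<le> N" for i
    proof -
      have "H1_norm \<Omega> (UH i - V H (tgrid T N i))
          \<le> 2 * (cS * (c0 * H powr r + (T / real N + H powr r) + T * (Q * H powr r))) * exp (4 * cS * T)"
      proof (rule scheme_bound[OF H sH _ L2tri _ _ sm i])
        show "sqint \<Omega> (UH i)" if "1 \<le> i" "i \<le> N" for i using UHm[OF that(2)] H1_sqint by blast
        show "H1_norm \<Omega> (UH 0 - V H 0) \<le> c0 * H powr r" unfolding init using i0(2) c0le[of "H powr r"] by simp
      qed (use Q in simp_all)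
      also have "\<dots> \<le> Cc * (H powr r + k)"
      proof -
        have "c0 * H powr r + (k + H powr r) + T * (Q * H powr r) \<le> (c0 + 1 + T * Q) * (H powr r + k)"
          using n0 k T_pos Q by (simp add: algebra_simps)
        then have "2 * (cS * (c0 * H powr r + (k + H powr r) + T * (Q * H powr r))) * E
            \<le> 2 * (cS * ((c0 + 1 + T * Q) * (H powr r + k))) * E"
          using n0 by (intro mult_right_mono mult_left_mono) auto
        then show ?thesis by (simp add: Cc_def E_def k_def mult_ac)
      qed
      finally show ?thesis .
    qed
    have Ws: "sqint \<Omega> (UH i)" if "1 \<le> i" "i \<le> N" for i using UHm[OF that(2)] H1_sqint by blast
    define q where "q = (Cc + Q) * (H powr r + k)"
    have q: "0 \<le> q" using Cc Q k by (simp add: q_def)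
    \<comment> \<open>On the fine grid the frozen argument is the coarse solution, so \<open>q\<close> is the bound of its \<open>L\<^sup>2\<close> error.\<close>
    have Wb: "L2_norm \<Omega> (u (tgrid T N i) - UH i) \<le> q + H1_norm \<Omega> (Uh i - V h (tgrid T N i))"
      if i: "1 \<le> i" "i \<le> N" for i
    proof -
      have "Q * H powr r \<le> Q * (H powr r + k)" using Q k by (intro mult_left_mono) auto
      then have "L2_norm \<Omega> (u (tgrid T N i) - UH i) \<le> q"
        using L2tri[OF i] coarse[OF i] by (simp add: q_def distrib_right)
      then show ?thesis using H1_norm_nonneg[of "Uh i - V h (tgrid T N i)"] by linarith
    qed
    have hr: "h powr r \<le> h powr (r - 1)" using hH by (intro powr_mono') auto
    define D where "D = H powr r + h powr (r - 1) + k"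
    have "H1_norm \<Omega> (Uh n - V h (tgrid T N n))
        \<le> 2 * (cS * (c0 * h powr r + (T / real N + h powr r) + T * q)) * exp (4 * cS * T)"
    proof (rule scheme_bound[OF h sh Ws Wb _ q sm n])
      show "H1_norm \<Omega> (Uh 0 - V h 0) \<le> c0 * h powr r" unfolding init using i0(1) c0le[of "h powr r"] by simp
    qed
    also have "\<dots> \<le> Cf * D"
    proof -
      have pos: "0 \<le> H powr r" "0 \<le> h powr (r - 1)" by simp_all
      have "c0 * h powr r \<le> c0 * D" using hr k pos n0 unfolding D_def by (intro mult_left_mono) linarith+
      moreover have "k + h powr r \<le> D" using hr pos unfolding D_def by linarith
      moreover have "T * q \<le> T * ((Cc + Q) * D)"
        unfolding q_def using T_pos Cc Q pos unfolding D_def by (intro mult_left_mono) auto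
      ultimately have "c0 * h powr r + (k + h powr r) + T * q \<le> (c0 + 1 + T * (Cc + Q)) * D"
        by (simp add: algebra_simps)
      then have "2 * (cS * (c0 * h powr r + (k + h powr r) + T * q)) * E
          \<le> 2 * (cS * ((c0 + 1 + T * (Cc + Q)) * D)) * E"
        using n0 by (intro mult_right_mono mult_left_mono) auto
      then show ?thesis by (simp add: Cf_def E_def k_def mult_ac)
    qed
    finally have fine: "H1_norm \<Omega> (Uh n - V h (tgrid T N n)) \<le> Cf * D" .
    have m: "Uh n - V h (tgrid T N n) \<in> H1" "V h (tgrid T N n) - u (tgrid T N n) \<in> H1"
      using u_H1[OF tT[OF n]] V_H1[OF h tT[OF n]] Uhm[OF n(2)] H1_diff by auto
    have "Uh n - u (tgrid T N n) = (Uh n - V h (tgrid T N n)) + (V h (tgrid T N n) - u (tgrid T N n))" by simp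
    then have "H1_norm \<Omega> (Uh n - u (tgrid T N n))
        \<le> H1_norm \<Omega> (Uh n - V h (tgrid T N n)) + H1_norm \<Omega> (u (tgrid T N n) - V h (tgrid T N n))"
      using H1_triangle[OF m] H1_minus[OF V_H1[OF h tT[OF n]] u_H1[OF tT[OF n]]] by simp
    also have "\<dots> \<le> Cf * D + Q * h powr (r - 1)" using fine rho_parts(3)[OF h tT[OF n]] by (rule add_mono)
    also have "\<dots> \<le> (Cf + Q + 1) * D"
    proof -
      have pos: "0 \<le> H powr r" "0 \<le> h powr (r - 1)" by simp_all
      have "h powr (r - 1) \<le> D" "0 \<le> D" using pos k unfolding D_def by linarith+
      then show ?thesis using mult_left_mono[OF _ Q, of "h powr (r - 1)" D] by (simp add: distrib_right)
    qed
    finally show ?thesis by (simp only: D_def k_def)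
  qed
  have "0 < Cf + Q + 1" "0 < 1 / (4 * (cS + 1))" using Cf Q n0 by auto
  then show "\<exists>C>0. \<exists>\<delta>0>0. \<forall>N h H u0h u0H UH Uh n.
     0 < N \<and> T / real N \<le> \<delta>0 \<and> 0 < h \<and> h < H \<and> H \<le> 1 \<and>
     H1_norm \<Omega> (u0h - V h 0) \<le> C0 * h powr r \<and>
     H1_norm \<Omega> (u0H - V H 0) \<le> C0 * H powr r \<and>
     two_grid_step \<Omega> T a a0 \<alpha> \<beta> \<gamma> g f \<omega> N (S H) u0H UH UH \<and>
     two_grid_step \<Omega> T a a0 \<alpha> \<beta> \<gamma> g f \<omega> N (S h) u0h UH Uh \<and>
     1 \<le> n \<and> n \<le> N \<longrightarrow>
     H1_norm \<Omega> (Uh n - u (tgrid T N n)) \<le> C * (H powr r + h powr (r - 1) + T / real N)"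
    using main by blast
qed

end

theorem theorem4p3:
  fixes \<Omega> :: "(real^'n) set" and T r :: real and K :: "real \<Rightarrow> real"
    and a :: "real^'n \<Rightarrow> real \<Rightarrow> real^'n^'n" and a0 :: "real^'n \<Rightarrow> real \<Rightarrow> real"
    and \<alpha> :: "real^'n \<Rightarrow> real \<Rightarrow> real^'n^'n" and \<beta> \<gamma> :: "real^'n \<Rightarrow> real \<Rightarrow> real^'n"
    and g :: "real^'n \<Rightarrow> real \<Rightarrow> real"
    and f :: "real \<Rightarrow> real^'n \<Rightarrow> real" and u0 :: "real^'n \<Rightarrow> real"
    and u ut utt :: "real \<Rightarrow> real^'n \<Rightarrow> real"
    and S :: "real \<Rightarrow> (real^'n \<Rightarrow> real) set"
    and V Vt :: "real \<Rightarrow> real \<Rightarrow> real^'n \<Rightarrow> real"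
    and \<omega> :: "nat \<Rightarrow> nat \<Rightarrow> nat \<Rightarrow> real"
  assumes domain: "polyhedral_domain \<Omega>"
    and T_pos: "0 < T"
    and kernel: "K absolutely_integrable_on {0..T}"
    and operator_A: "elliptic_operator \<Omega> T a a0"
    and smooth_B:
      "smooth_bounded (\<Omega> \<times> UNIV) (\<lambda>(x, w). \<alpha> x w)" "smooth_bounded (\<Omega> \<times> UNIV) (\<lambda>(x, w). \<beta> x w)"
      "smooth_bounded (\<Omega> \<times> UNIV) (\<lambda>(x, w). \<gamma> x w)" "smooth_bounded (\<Omega> \<times> UNIV) (\<lambda>(x, w). g x w)"
    and zero_B: "\<forall>x\<in>\<Omega>. \<beta> x 0 = 0 \<and> g x 0 = 0"
    and source: "\<forall>t\<in>{0..T}. f t \<in> L2_space \<Omega>"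
    and solution: "weak_solution \<Omega> T K a a0 \<alpha> \<beta> \<gamma> g f u0 u ut"
    and order: "1 + real CARD('n) / 2 \<le> r"
    and family: "fem_family \<Omega> r S"
    and weights: "first_order_weights T K \<omega>"
    and projection: "\<forall>h\<in>{0<..1}. ritz_volterra \<Omega> T K a a0 \<alpha> \<gamma> (S h) u (V h)"
    and regularity_u:
      "\<exists>C. \<forall>t\<in>{0..T}. u t \<in> Hs_space \<Omega> r \<inter> H10_space \<Omega> \<and> Hs_norm \<Omega> r (u t) \<le> C"
      "\<exists>C. \<forall>t\<in>{0..T}. ut t \<in> Hs_space \<Omega> r \<inter> H10_space \<Omega> \<and> Hs_norm \<Omega> r (ut t) \<le> C"
      "\<exists>C. \<forall>t\<in>{0..T}. grad_bounded_by \<Omega> (u t) C"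
      "has_L2_time_deriv \<Omega> T ut utt" "\<exists>C. \<forall>t\<in>{0..T}. L2_norm \<Omega> (utt t) \<le> C"
    and deriv_V: "\<forall>h\<in>{0<..1}. has_L2_time_deriv \<Omega> T (V h) (Vt h) \<and> (\<forall>t\<in>{0..T}. Vt h t \<in> S h)"
    and projection_error:
      "\<exists>C. \<forall>h\<in>{0<..1}. \<forall>t\<in>{0..T}.
         L2_norm \<Omega> (u t - V h t) + h * H1_norm \<Omega> (u t - V h t) + L2_norm \<Omega> (ut t - Vt h t)
           \<le> C * h powr r"
    and projection_bound:
      "\<exists>C. \<forall>h\<in>{0<..1}. \<forall>t\<in>{0..T}.
         grad_bounded_by \<Omega> (V h t) C \<and> grad_bounded_by \<Omega> (Vt h t) C"
    and quadrature_V: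
      "\<exists>C. \<forall>h\<in>{0<..1}. \<forall>v\<in>S h. \<forall>N n. 1 \<le> n \<and> n \<le> N \<longrightarrow>
         \<bar>quad_error T K \<omega> N n (\<lambda>s. B1_form \<Omega> \<alpha> \<gamma> (u s) (V h s) v)\<bar>
           \<le> C * (T / real N) * H1_norm \<Omega> v"
    and quadrature_u:
      "\<exists>C. \<forall>h\<in>{0<..1}. \<forall>v\<in>S h. \<forall>N n. 1 \<le> n \<and> n \<le> N \<longrightarrow>
         \<bar>quad_error T K \<omega> N n (\<lambda>s. L2_inner \<Omega> (\<lambda>x. \<beta> x (u s x)) (weak_grad \<Omega> v)
              + L2_inner \<Omega> (\<lambda>x. g x (u s x)) v)\<bar>
           \<le> C * (T / real N) * H1_norm \<Omega> v"
  shows "\<forall>C0. \<exists>C>0. \<exists>\<delta>0>0. \<forall>N h H u0h u0H UH Uh n.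
     0 < N \<and> T / real N \<le> \<delta>0 \<and> 0 < h \<and> h < H \<and> H \<le> 1 \<and>
     H1_norm \<Omega> (u0h - V h 0) \<le> C0 * h powr r \<and>
     H1_norm \<Omega> (u0H - V H 0) \<le> C0 * H powr r \<and>
     two_grid_step \<Omega> T a a0 \<alpha> \<beta> \<gamma> g f \<omega> N (S H) u0H UH UH \<and>
     two_grid_step \<Omega> T a a0 \<alpha> \<beta> \<gamma> g f \<omega> N (S h) u0h UH Uh \<and>
     1 \<le> n \<and> n \<le> N \<longrightarrow>
     H1_norm \<Omega> (Uh n - u (tgrid T N n)) \<le> C * (H powr r + h powr (r - 1) + T / real N)"
proof -
  have op: "open \<Omega>" and bd: "bounded \<Omega>" using domain by (auto simp: polyhedral_domain_def)
  interpret dom: domain \<Omega> using op bd by unfold_locales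
  obtain C1 C2 C3 C4 where lip: "dom.lip_coeff C1 \<alpha>" "dom.lip_coeff C2 \<beta>" "dom.lip_coeff C3 \<gamma>" "dom.lip_coeff C4 g"
    using smooth_B dom.smooth_bounded_lip_coeff by metis
  define C where "C = C1 + C2 + C3 + C4"
  have "0 \<le> C1" "0 \<le> C2" "0 \<le> C3" "0 \<le> C4" using lip by (auto simp: dom.lip_coeff_def)
  then have "C1 \<le> C" "C2 \<le> C" "C3 \<le> C" "C4 \<le> C" by (auto simp: C_def)
  then have lipC: "dom.lip_coeff C \<alpha>" "dom.lip_coeff C \<beta>" "dom.lip_coeff C \<gamma>" "dom.lip_coeff C g"
    using lip dom.lip_coeff_mono by blast+
  obtain CA \<nu>0 where ell: "elliptic \<Omega> a a0 T CA \<nu>0" using dom.elliptic_exists[OF operator_A] by blast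
  obtain K1 Cq where ker: "kernel T K \<omega> K1 Cq" using kernel_exists[OF T_pos kernel weights] by blast
  obtain Q1 where Q1: "\<And>t. t \<in> {0..T} \<Longrightarrow> L2_norm \<Omega> (utt t) \<le> Q1" using regularity_u(5) by blast
  obtain Q2 where Q2: "\<And>h t. h \<in> {0<..1} \<Longrightarrow> t \<in> {0..T} \<Longrightarrow>
      L2_norm \<Omega> (u t - V h t) + h * H1_norm \<Omega> (u t - V h t) + L2_norm \<Omega> (ut t - Vt h t) \<le> Q2 * h powr r"
    using projection_error by blast
  obtain Q3 where Q3: "\<And>h t. h \<in> {0<..1} \<Longrightarrow> t \<in> {0..T} \<Longrightarrow>
      grad_bounded_by \<Omega> (V h t) Q3 \<and> grad_bounded_by \<Omega> (Vt h t) Q3"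
    using projection_bound by blast
  define Q where "Q = \<bar>Q1\<bar> + \<bar>Q2\<bar> + \<bar>Q3\<bar>"
  have QQ: "Q1 \<le> Q" "Q2 \<le> Q" "Q3 \<le> Q" "0 \<le> Q" by (auto simp: Q_def)
  have grad_mono: "grad_bounded_by \<Omega> v Q" if "grad_bounded_by \<Omega> v Q3" for v
    using that unfolding grad_bounded_by_def by eventually_elim (use QQ in linarith)
  have "0 < real CARD('n)" by simp
  then have r: "1 < r" using order by linarith
  have "discretisation \<Omega> \<alpha> \<beta> \<gamma> g C a a0 T CA \<nu>0 K \<omega> K1 Cq f u ut utt S V Vt r Q"
  proof (intro discretisation.intro ell ker nonlinear_op.intro dom.domain_axioms
      nonlinear_op_axioms.intro lipC discretisation_axioms.intro QQ(4) r)
    show "has_L2_time_deriv \<Omega> T u ut" using solution by (simp add: weak_solution_def)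
    show "has_L2_time_deriv \<Omega> T ut utt" by (rule regularity_u(4))
    show "u t \<in> H10_space \<Omega>" if "t \<in> {0..T}" for t using solution that by (simp add: weak_solution_def)
    show "L2_norm \<Omega> (utt t) \<le> Q" if "t \<in> {0..T}" for t using Q1[OF that] QQ(1) by linarith
    show "L2_inner \<Omega> (ut t) v + A_form \<Omega> a a0 t (u t) v
          + integral {0..t} (\<lambda>s. K (t - s) * B_tilde \<Omega> \<alpha> \<beta> \<gamma> g (u s) (u s) v) = L2_inner \<Omega> (f t) v"
      if "t \<in> {0<..T}" "v \<in> H10_space \<Omega>" for t v
      using solution that unfolding weak_solution_def by blast
    fix h :: real assume h: "h \<in> {0<..1}"
    show "finite_dim_space (S h)" "S h \<subseteq> H10_space \<Omega>" using family h unfolding fem_family_def by blast+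
    show "has_L2_time_deriv \<Omega> T (V h) (Vt h)" using deriv_V h by blast
    fix t assume t: "t \<in> {0..T}"
    show "V h t \<in> S h" using projection h t unfolding ritz_volterra_def by blast
    show "Vt h t \<in> S h" using deriv_V h t by blast
    show "grad_bounded_by \<Omega> (V h t) Q" "grad_bounded_by \<Omega> (Vt h t) Q" using Q3[OF h t] grad_mono by auto
    show "A_form \<Omega> a a0 t (u t - V h t) v
          + integral {0..t} (\<lambda>s. K (t - s) * B1_form \<Omega> \<alpha> \<gamma> (u s) (u s - V h s) v) = 0" if "v \<in> S h" for v
      using projection h t that unfolding ritz_volterra_def by blast
    have "Q2 * h powr r \<le> Q * h powr r" using QQ(2) by (intro mult_right_mono) auto
    then show "L2_norm \<Omega> (u t - V h t) + h * H1_norm \<Omega> (u t - V h t) + L2_norm \<Omega> (ut t - Vt h t) \<le> Q * h powr r"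
      using Q2[OF h t] by linarith
  qed
  then show ?thesis by (rule discretisation.two_grid_convergence)
qed

end
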